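(* Let $0<\sigma<\infty$ and let \[ f(x)=\alpha\,\frac{2\cos\sigma x-1}{(3\sigma x)^2-\pi^2}, \] where $\alpha>0$ is such that $\|f\|_{L^1(\mathbb{R})}=1$. Then $f$ is a strongly exposed point of $D(B^1_\sigma)$ but is not a weak$^*$ exposed point of $D(B^1_\sigma)$. In particular, the set of weak$^*$ exposed points of $D(B^1_\sigma)$ is a proper subset of the set of strongly exposed points of $D(B^1_\sigma)$.
   Context: For $0<\sigma<\infty$, $B^1_\sigma$ is the space of $f\in L^1(\mathbb{R})$ whose Fourier transform is supported in $[-\sigma,\sigma]$, with the $L^1(\mathbb{R})$ norm; $D(B^1_\sigma)$ is its closed unit ball. $C_0(\mathbb{R})$ is the space of continuous complex functions vanishing at infinity; with $\mathfrak{I}_\sigma$ the finite complex Borel measures on $\mathbb{R}$ whose Fourier–Stieltjes transform vanishes for $|t|\ge\sigma$ and $C_{0,\sigma}(\mathbb{R})=\{u\in C_0(\mathbb{R}):\int u\,d\mu=0\ \forall\mu\in\mathfrak{I}_\sigma\}$, $B^1_\sigma$ is the dual of $C_0(\mathbb{R})/C_{0,\sigma}(\mathbb{R})$ via $\langle f,[u]\rangle=\int f u\,dx$; weak$^*$ refers to this duality. A point $f\in D(B^1_\sigma)$ is exposed if there is a continuous linear functional $\Phi_f$ on $B^1_\sigma$ with $\Phi_f(f)=\|\Phi_f\|=1$ and $\mathrm{Re}\,\Phi_f(g)<1$ for all $g\in D(B^1_\sigma)$, $g\ne f$ (this functional is unique). An exposed $f$ is strongly exposed if every sequence $(f_n)$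 in $D(B^1_\sigma)$ with $\Phi_f(f_n)\to1$ converges to $f$ in norm; it is weak$^*$ exposed if $\Phi_f$ is weak$^*$ continuous. *)

theory Defs
  imports "HOL-Analysis.Analysis"
begin

text \<open>Elements of L^1(R) are represented by complex-valued functions on the reals;
  equality in L^1 is equality almost everywhere (Lebesgue measure).\<close>

definition L1norm :: "(real \<Rightarrow> complex) \<Rightarrow> real" where
  "L1norm f = (LINT x|lborel. norm (f x))"

text \<open>Fourier transform (normalisation is irrelevant for the support condition).\<close>
definition fourier :: "(real \<Rightarrow> complex) \<Rightarrow> real \<Rightarrow> complex" where
  "fourier f t = (LINT x|lborel. f x * cis (- (t * x)))"

text \<open>B^1_sigma: L^1 functions whose Fourier transform is supported in [-sigma, sigma]
  (the Fourier transform is continuous, so this means it vanishes for |t| > sigma).\<close>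
definition B1 :: "real \<Rightarrow> (real \<Rightarrow> complex) set" where
  "B1 \<sigma> = {f. integrable lborel f \<and> (\<forall>t. \<sigma> < \<bar>t\<bar> \<longrightarrow> fourier f t = 0)}"

definition DB1 :: "real \<Rightarrow> (real \<Rightarrow> complex) set" where
  "DB1 \<sigma> = {f \<in> B1 \<sigma>. L1norm f \<le> 1}"

definition bounded_functional :: "real \<Rightarrow> ((real \<Rightarrow> complex) \<Rightarrow> complex) \<Rightarrow> bool" where
  "bounded_functional \<sigma> \<Phi> \<longleftrightarrow>
     (\<forall>f\<in>B1 \<sigma>. \<forall>g\<in>B1 \<sigma>. \<forall>a b :: complex.
        \<Phi> (\<lambda>x. a * f x + b * g x) = a * \<Phi> f + b * \<Phi> g) \<and>
     (\<exists>C. \<forall>f\<in>B1 \<sigma>. norm (\<Phi> f) \<le> C * L1norm f)"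

definition fnorm :: "real \<Rightarrow> ((real \<Rightarrow> complex) \<Rightarrow> complex) \<Rightarrow> real" where
  "fnorm \<sigma> \<Phi> = (SUP f\<in>DB1 \<sigma>. norm (\<Phi> f))"

definition exposing :: "real \<Rightarrow> (real \<Rightarrow> complex) \<Rightarrow> ((real \<Rightarrow> complex) \<Rightarrow> complex) \<Rightarrow> bool" where
  "exposing \<sigma> f \<Phi> \<longleftrightarrow> bounded_functional \<sigma> \<Phi> \<and> \<Phi> f = 1 \<and> fnorm \<sigma> \<Phi> = 1 \<and>
     (\<forall>g\<in>DB1 \<sigma>. \<not> (AE x in lborel. g x = f x) \<longrightarrow> Re (\<Phi> g) < 1)"

definition exposed_pt :: "real \<Rightarrow> (real \<Rightarrow> complex) \<Rightarrow> bool" where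
  "exposed_pt \<sigma> f \<longleftrightarrow> f \<in> DB1 \<sigma> \<and> (\<exists>\<Phi>. exposing \<sigma> f \<Phi>)"

definition strongly_exposed :: "real \<Rightarrow> (real \<Rightarrow> complex) \<Rightarrow> bool" where
  "strongly_exposed \<sigma> f \<longleftrightarrow> f \<in> DB1 \<sigma> \<and>
     (\<exists>\<Phi>. exposing \<sigma> f \<Phi> \<and>
        (\<forall>F :: nat \<Rightarrow> real \<Rightarrow> complex. (\<forall>n. F n \<in> DB1 \<sigma>) \<longrightarrow>
           (\<lambda>n. \<Phi> (F n)) \<longlonglongrightarrow> 1 \<longrightarrow>
           (\<lambda>n. L1norm (\<lambda>x. F n x - f x)) \<longlonglongrightarrow> 0))"

definition C0 :: "(real \<Rightarrow> complex) set" where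
  "C0 = {u. continuous_on UNIV u \<and> (u \<longlongrightarrow> 0) at_infinity}"

text \<open>Weak* topology on B^1_sigma = (C_0/C_{0,sigma})^*, pairing <f,[u]> = int f u:
  the coarsest topology on B^1_sigma making all maps f \<mapsto> int f u (u in C_0) continuous.\<close>
definition wstar_top :: "real \<Rightarrow> (real \<Rightarrow> complex) topology" where
  "wstar_top \<sigma> = topology_generated_by
     {{g \<in> B1 \<sigma>. (LINT x|lborel. g x * u x) \<in> U} | u U. u \<in> C0 \<and> open U}"

definition wstar_exposed :: "real \<Rightarrow> (real \<Rightarrow> complex) \<Rightarrow> bool" where
  "wstar_exposed \<sigma> f \<longleftrightarrow> f \<in> DB1 \<sigma> \<and>
     (\<exists>\<Phi>. exposing \<sigma> f \<Phi> \<and> continuous_map (wstar_top \<sigma>) euclidean \<Phi>)"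

definition example_fn :: "real \<Rightarrow> real \<Rightarrow> real \<Rightarrow> complex" where
  "example_fn \<sigma> \<alpha> x = complex_of_real
     (\<alpha> * (2 * cos (\<sigma> * x) - 1) / ((3 * \<sigma> * x)\<^sup>2 - pi\<^sup>2))"

end

theory Submission
  imports Defs "HOL-Probability.Probability" "HOL-Complex_Analysis.Great_Picard"
begin

text \<open>
  Write \<open>f\<close> for the extremal function and \<open>\<beta> = pi / (3 \<sigma>)\<close>. Off \<open>[-\<beta>, \<beta>]\<close> the sign of \<open>f\<close> is that of
  \<open>2 cos (\<sigma> x) - 1\<close>, which has period \<open>2 pi / \<sigma>\<close> and mean \<open>- 1/3\<close>; on \<open>[-\<beta>, \<beta>]\<close> it is flipped. A periodic
  function with this period acts on \<open>B1 \<sigma>\<close> only through its mean, since the Fourier transforms vanish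
  at all other frequencies \<open>n \<sigma>\<close>. So the norming functional of \<open>f\<close> is
  \<open>\<Phi> g = - 1/3 \<integral> g - 2 \<integral>\<^bsub>[-\<beta>, \<beta>]\<^esub> g\<close>.

  \<open>f\<close> is exposed: if \<open>g\<close> in the unit ball has \<open>Re (\<Phi> g) \<ge> 1\<close>, then \<open>g\<close> has the sign of \<open>f\<close> and vanishes at
  the points \<open>\<plusminus> \<beta> + 2 pi n / \<sigma>\<close>, \<open>n \<noteq> 0\<close>, where \<open>f\<close> changes sign. Periodizing the Fourier transform along
  either family of points gives a function with only one Fourier coefficient, that is, a constant; the
  two resulting linear relations determine the transform of \<open>g\<close> up to a factor.

  \<open>f\<close> is strongly exposed: a maximizing sequence has a subsequence converging locally uniformly to some
  \<open>g\<close>. Mass \<open>1 - \<theta>\<close> that escapes to infinity contributes at most \<open>(1 - \<theta>) / 3\<close> to \<open>\<Phi>\<close>, so nothing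
  escapes, \<open>g = f\<close>, and convergence of the norms upgrades pointwise to norm convergence. The same
  argument works for any weak* exposed point, where \<open>\<Phi>\<close> converges along the subsequence by weak*
  continuity.

  \<open>f\<close> is not weak* exposed: its translates tend to \<open>0\<close> weak*, but \<open>\<Phi>\<close> tends to \<open>- 1/3 \<integral> f \<noteq> 0\<close> along them.
\<close>

section \<open>Fourier inversion\<close>

lemma measurable_cis [measurable]: "cis \<in> borel_measurable borel"
  by (intro borel_measurable_continuous_onI continuous_intros)

lemma fourier_integrable:
  assumes "integrable lborel f"
  shows "integrable lborel (\<lambda>x. f x * cis (- (t * x)))"
proof (rule Bochner_Integration.integrable_bound[OF assms])
  note [measurable] = borel_measurable_integrable[OF assms]
  show "(\<lambda>x. f x * cis (- (t * x))) \<in> borel_measurable lborel"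
    by measurable
qed (simp add: norm_mult)

lemma fourier_norm_le:
  "norm (fourier f t) \<le> L1norm f"
  unfolding fourier_def L1norm_def
  by (rule order_trans[OF integral_norm_bound]) (simp add: norm_mult)

lemma continuous_on_fourier:
  assumes "integrable lborel f"
  shows "continuous_on UNIV (fourier f)"
proof -
  note [measurable] = borel_measurable_integrable[OF assms]
  have "(\<lambda>n. fourier f (u n)) \<longlonglongrightarrow> fourier f t" if "u \<longlonglongrightarrow> t" for u t
    unfolding fourier_def
  proof (rule integral_dominated_convergence[where w = "\<lambda>x. norm (f x)"])
    show "AE x in lborel. (\<lambda>n. f x * cis (- (u n * x))) \<longlonglongrightarrow> f x * cis (- (t * x))"
      using that by (intro AE_I2 tendsto_intros)
  qed (use assms in \<open>auto simp: norm_mult\<close>)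
  then show ?thesis
    unfolding continuous_on_sequentially by (auto simp: o_def)
qed

lemma measurable_fourier [measurable]:
  "integrable lborel f \<Longrightarrow> fourier f \<in> borel_measurable borel"
  by (intro borel_measurable_continuous_onI continuous_on_fourier)

lemma fourier_cong_AE:
  assumes "AE x in lborel. f x = g x" "f \<in> borel_measurable borel" "g \<in> borel_measurable borel"
  shows "fourier f = fourier g"
proof
  fix t
  note [measurable] = assms(2,3)
  show "fourier f t = fourier g t"
    unfolding fourier_def
    by (rule integral_cong_AE) (use assms(1) in auto)
qed

text \<open>Fubini for the kernel \<open>f x * \<phi> t * cis (- (t * x))\<close>, whose modulus is
  a product of integrable functions. With a Gaussian for \<phi> it drives the inversion theorem;
  with an indicator it shows that \<open>B1 \<sigma>\<close> is closed under weak limits.\<close>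

lemma fourier_multiplication:
  assumes f: "integrable lborel f" and \<phi>: "integrable lborel \<phi>"
  shows "(LINT t|lborel. fourier f t * \<phi> t) = (LINT x|lborel. f x * fourier \<phi> x)"
proof -
  note [measurable] = borel_measurable_integrable[OF f] borel_measurable_integrable[OF \<phi>]
  let ?K = "\<lambda>(t, x). f x * \<phi> t * cis (- (t * x))"
  have "integrable (lborel \<Otimes>\<^sub>M lborel) ?K"
  proof (rule lborel_pair.Fubini_integrable)
    show "integrable lborel (\<lambda>t. LINT x|lborel. norm (?K (t, x)))"
      using \<phi> by (simp add: norm_mult mult.commute)
    show "AE t in lborel. integrable lborel (\<lambda>x. ?K (t, x))"
    proof (rule AE_I2)
      fix t
      have "integrable lborel (\<lambda>x. \<phi> t * (f x * cis (- (t * x))))"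
        by (intro integrable_mult_right fourier_integrable f)
      then show "integrable lborel (\<lambda>x. ?K (t, x))"
        by (simp add: mult_ac)
    qed
  qed measurable
  from lborel_pair.Fubini_integral[OF this]
  have "(LINT x|lborel. LINT t|lborel. f x * \<phi> t * cis (- (t * x))) =
        (LINT t|lborel. LINT x|lborel. f x * \<phi> t * cis (- (t * x)))"
    by simp
  moreover have "(LINT t|lborel. f x * \<phi> t * cis (- (t * x))) = f x * fourier \<phi> x" for x
    unfolding fourier_def
    by (subst integral_mult_right_zero[symmetric]) (simp add: mult_ac)
  moreover have "(LINT x|lborel. f x * \<phi> t * cis (- (t * x))) = fourier f t * \<phi> t" for t
    unfolding fourier_def
    by (subst integral_mult_left_zero[symmetric]) (simp add: mult_ac)
  ultimately show ?thesis by simp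
qed

section \<open>Criteria for equality almost everywhere\<close>

lemma continuous_AE_eq_imp_eq:
  fixes f g :: "real \<Rightarrow> complex"
  assumes "continuous_on UNIV f" "continuous_on UNIV g" "AE x in lborel. f x = g x"
  shows "f = g"
proof
  fix x
  have "closed {x. f x = g x}"
    using assms by (intro closed_Collect_eq) auto
  moreover have "AE x in lebesgue. x \<in> {x. f x = g x}"
    using AE_completion[OF assms(3)] by simp
  ultimately show "f x = g x"
    using mem_closed_if_AE_lebesgue by blast
qed

text \<open>The half-open intervals form an intersection-stable generator of the Borel sets, so
  Dynkin's argument extends the hypothesis to all Borel sets. Then \<open>u\<close> and 0 have the
  same set integrals and agree almost everywhere.\<close>

lemma AE_eq_0_if_interval_integrals_eq_0:
  fixes u :: "real \<Rightarrow> 'a::{second_countable_topology, banach}"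
  assumes u: "integrable lborel u"
    and zero: "\<And>a b. a \<le> b \<Longrightarrow> (LINT x:{a<..b}|lborel. u x) = 0"
  shows "AE x in lborel. u x = 0"
proof -
  let ?G = "range (\<lambda>(a, b). {a <.. b::real})"
  note [measurable] = borel_measurable_integrable[OF u]
  have [simp]: "set_integrable lborel A u" if "A \<in> sets borel" for A
    using u that unfolding set_integrable_def by (intro integrable_mult_indicator) auto
  have sets: "sets borel = sigma_sets UNIV ?G"
    using arg_cong[OF borel_sigma_sets_Ioc, of sets] by simp
  \<comment> \<open>The complement case of the induction needs the integral over the whole
    line.\<close>
  have total: "(LINT x|lborel. u x) = 0"
  proof -
    have "(\<lambda>n. LINT x:{- real n<..real n}|lborel. u x) \<longlonglongrightarrow> (LINT x|lborel. u x)"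
      unfolding set_lebesgue_integral_def
    proof (rule integral_dominated_convergence[where w = "\<lambda>x. norm (u x)"])
      show "AE x in lborel. (\<lambda>n. indicat_real {- real n<..real n} x *\<^sub>R u x) \<longlonglongrightarrow> u x"
      proof (rule AE_I2, rule tendsto_eventually)
        fix x :: real
        obtain N where "\<bar>x\<bar> < real N" using reals_Archimedean2 by blast
        then show "\<forall>\<^sub>F n in sequentially. indicat_real {- real n<..real n} x *\<^sub>R u x = u x"
          by (intro eventually_sequentiallyI[of N]) (auto simp: indicator_def)
      qed
    qed (use u in \<open>auto simp: indicator_def\<close>)
    then show ?thesis
      using zero by (simp add: LIMSEQ_const_iff)
  qed
  have *: "(LINT x:A|lborel. u x) = 0" if "A \<in> sets borel" for A
  proof -
    have "Int_stable ?G"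
    proof (rule Int_stableI)
      fix A B assume "A \<in> ?G" "B \<in> ?G"
      then obtain a b c d where "A = {a<..b}" "B = {c<..d}" by auto
      then have "A \<inter> B = {max a c<..min b d}" by auto
      then show "A \<inter> B \<in> ?G" by auto
    qed
    moreover have "?G \<subseteq> Pow UNIV" by simp
    moreover have "A \<in> sigma_sets UNIV ?G"
      using that sets by simp
    ultimately show ?thesis
    proof (induction rule: sigma_sets_induct_disjoint)
      case (basic A)
      then obtain a b where "A = {a<..b}" by auto
      then show ?case using zero[of a b] by (cases "a \<le> b") (auto simp: set_lebesgue_integral_def)
    next
      case empty
      show ?case by (simp add: set_lebesgue_integral_def)
    next
      case (compl A)
      then have [measurable]: "A \<in> sets borel" using sets by simp
      have "(LINT x:UNIV|lborel. u x) = (LINT x:A|lborel. u x) + (LINT x:UNIV - A|lborel. u x)"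
        by (subst set_integral_Un[symmetric]) (auto simp: Un_Diff_cancel)
      then show ?case
        using total compl by (simp add: set_lebesgue_integral_def)
    next
      case (union A)
      then have "A i \<in> sets lborel" for i using sets by auto
      then have "(LINT x:(\<Union>i. A i)|lborel. u x) = (\<Sum>i. LINT x:A i|lborel. u x)"
        using union(1) by (intro lebesgue_integral_countable_add) (auto simp: disjoint_family_on_def)
      then show ?case using union by simp
    qed
  qed
  show ?thesis
    by (rule sigma_finite_measure.density_unique_banach[OF sigma_finite_lborel]) (use u * in auto)
qed

text \<open>Scaling reduces this to the characteristic function of the standard normal law. As
  \<epsilon> tends to 0, the right-hand side is \<open>2 * pi\<close> times an approximate identity
  at \<open>y\<close>.\<close>

lemma fourier_gaussian:
  assumes "0 < \<epsilon>"
  shows "fourier (\<lambda>t. of_real (exp (- (\<epsilon> * t)\<^sup>2 / 2)) * cis (t * y)) x =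
         of_real (2 * pi * normal_density y \<epsilon> x)"
    and "integrable lborel (\<lambda>t. of_real (exp (- (\<epsilon> * t)\<^sup>2 / 2)) * cis (t * y))"
proof -
  let ?g = "\<lambda>t. complex_of_real (exp (- (\<epsilon> * t)\<^sup>2 / 2)) * cis (t * y)"
  let ?s = "(y - x) / \<epsilon>"
  have char: "(LINT z|lborel. of_real (std_normal_density z) * cis (?s * z)) = of_real (exp (- ?s\<^sup>2 / 2))"
    using fun_cong[OF char_std_normal_distribution, of ?s]
    by (simp add: char_def integral_density normal_density_nonneg cis_conv_exp mult_ac scaleR_conv_of_real)
  have "fourier ?g x = (1 / \<epsilon>) *\<^sub>R (LINT z|lborel. ?g (z / \<epsilon>) * cis (- (z / \<epsilon> * x)))"
    unfolding fourier_def
    using assms by (subst lborel_integral_real_affine[where c = "1 / \<epsilon>" and t = 0]) (auto simp: mult_ac)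
  also have "(\<lambda>z. ?g (z / \<epsilon>) * cis (- (z / \<epsilon> * x))) =
             (\<lambda>z. of_real (sqrt (2 * pi)) * (of_real (std_normal_density z) * cis (?s * z)))"
    using assms by (auto simp: fun_eq_iff normal_density_def mult.assoc cis_mult field_simps)
  also have "(LINT z|lborel. of_real (sqrt (2 * pi)) * (of_real (std_normal_density z) * cis (?s * z))) =
             of_real (sqrt (2 * pi) * exp (- ?s\<^sup>2 / 2))"
    by (simp only: integral_mult_right_zero char of_real_mult)
  also have "(1 / \<epsilon>) *\<^sub>R complex_of_real (sqrt (2 * pi) * exp (- ?s\<^sup>2 / 2)) =
      of_real (2 * pi * normal_density y \<epsilon> x)"
  proof -
    have "2 * pi = sqrt (2 * pi) * sqrt (2 * pi)" by simp
    moreover have "?s\<^sup>2 = (x - y)\<^sup>2 / \<epsilon>\<^sup>2" by (simp add: power_divide power2_commute)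
    ultimately have "(1 / \<epsilon>) * (sqrt (2 * pi) * exp (- ?s\<^sup>2 / 2)) = 2 * pi * normal_density y \<epsilon> x"
      using assms by (simp add: normal_density_def real_sqrt_mult field_simps)
    then show ?thesis by (metis of_real_mult scaleR_conv_of_real)
  qed
  finally show "fourier ?g x = of_real (2 * pi * normal_density y \<epsilon> x)" .
  have "integrable lborel (\<lambda>t. normal_density 0 (1 / \<epsilon>) t)"
    using assms by (intro integrable_normal_density) auto
  then have "integrable lborel (\<lambda>t. sqrt (2 * pi) / \<epsilon> * normal_density 0 (1 / \<epsilon>) t)"
    by (rule integrable_mult_right)
  also have "(\<lambda>t. sqrt (2 * pi) / \<epsilon> * normal_density 0 (1 / \<epsilon>) t) = (\<lambda>t. exp (- (\<epsilon> * t)\<^sup>2 / 2))"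
    using assms by (auto simp: normal_density_def fun_eq_iff real_sqrt_divide real_sqrt_mult field_simps)
  finally show "integrable lborel ?g"
    by (rule Bochner_Integration.integrable_bound) (auto simp: norm_mult)
qed

text \<open>The multiplication formula trades the damped inversion integral for a Gaussian average
  of \<open>f\<close> around \<open>y\<close> at scale \<epsilon>.\<close>

lemma fourier_inversion_smoothed:
  fixes f :: "real \<Rightarrow> complex"
  assumes f: "integrable lborel f" and "0 < \<epsilon>"
  shows "(LINT t|lborel. fourier f t * (of_real (exp (- (\<epsilon> * t)\<^sup>2 / 2)) * cis (t * y))) =
         2 * pi * (LINT z|lborel. f (y + \<epsilon> * z) * of_real (std_normal_density z))"
proof -
  have "(LINT t|lborel. fourier f t * (of_real (exp (- (\<epsilon> * t)\<^sup>2 / 2)) * cis (t * y))) =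
        (LINT x|lborel. f x * of_real (2 * pi * normal_density y \<epsilon> x))"
    using fourier_multiplication[OF f fourier_gaussian(2)[OF assms(2)]] fourier_gaussian(1)[OF assms(2)]
    by simp
  also have "\<dots> = \<epsilon> *\<^sub>R (LINT z|lborel. f (y + \<epsilon> * z) * of_real (2 * pi * normal_density y \<epsilon> (y + \<epsilon> * z)))"
    using assms by (subst lborel_integral_real_affine[where c = \<epsilon> and t = y]) auto
  also have "\<dots> = (LINT z|lborel. 2 * pi * (f (y + \<epsilon> * z) * of_real (std_normal_density z)))"
    unfolding integral_scaleR_right[symmetric]
    using assms by (intro Bochner_Integration.integral_cong)
      (auto simp: normal_density_def real_sqrt_mult power_mult_distrib scaleR_conv_of_real)
  also have "\<dots> = 2 * pi * (LINT z|lborel. f (y + \<epsilon> * z) * of_real (std_normal_density z))"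
    by (rule integral_mult_right_zero)
  finally show ?thesis .
qed

text \<open>The Gaussian averages \<open>G n\<close> tend pointwise to \<open>h\<close>, because
  integrability of \<open>fourier f\<close> lets the damping be removed under the integral. Over
  every bounded interval their integrals also tend to the integral of \<open>f\<close>. So
  \<open>h\<close> and \<open>f\<close> have the same integrals over intervals.\<close>

theorem fourier_inversion:
  assumes f: "integrable lborel f" and f': "integrable lborel (fourier f)"
  shows "AE x in lborel. f x = fourier (fourier f) (- x) / (2 * pi)"
proof -
  define h where "h x = fourier (fourier f) (- x) / (2 * pi)" for x
  define \<epsilon> where "\<epsilon> n = 1 / real (Suc n)" for n
  have eps: "\<epsilon> n > 0" "\<epsilon> \<longlonglongrightarrow> 0" for n
    unfolding \<epsilon>_def using LIMSEQ_inverse_real_of_nat by (auto simp: inverse_eq_divide)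
  define G where "G n y = (LINT z|lborel. f (y + \<epsilon> n * z) * of_real (std_normal_density z))" for n y
  note [measurable] = borel_measurable_integrable[OF f] borel_measurable_integrable[OF f']
  have Gf: "(LINT t|lborel. fourier f t * (of_real (exp (- (\<epsilon> n * t)\<^sup>2 / 2)) * cis (t * y))) =
            2 * pi * G n y" for n y
    unfolding G_def using fourier_inversion_smoothed[OF f eps(1)] .
  have hmeas[measurable]: "h \<in> borel_measurable borel"
    unfolding h_def using f' by measurable
  have hcont: "continuous_on UNIV h"
    unfolding h_def by (intro continuous_intros continuous_on_compose2[OF continuous_on_fourier[OF f']]) auto
  have Gmeas[measurable]: "G n \<in> borel_measurable borel" for n
    unfolding G_def by measurable
  have Gh: "(\<lambda>n. G n y) \<longlonglongrightarrow> h y" for y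
  proof -
    have "(\<lambda>n. LINT t|lborel. fourier f t * (of_real (exp (- (\<epsilon> n * t)\<^sup>2 / 2)) * cis (t * y)))
       \<longlonglongrightarrow> (LINT t|lborel. fourier f t * (of_real (exp (- (0 * t)\<^sup>2 / 2)) * cis (t * y)))"
    proof (rule integral_dominated_convergence[where w = "\<lambda>t. norm (fourier f t)"])
      show "AE t in lborel. (\<lambda>n. fourier f t * (of_real (exp (- (\<epsilon> n * t)\<^sup>2 / 2)) * cis (t * y)))
         \<longlonglongrightarrow> fourier f t * (of_real (exp (- (0 * t)\<^sup>2 / 2)) * cis (t * y))"
        by (intro AE_I2 tendsto_intros eps) auto
    qed (use f' in \<open>auto simp: norm_mult intro!: mult_left_le\<close>)
    then have "(\<lambda>n. 2 * pi * G n y / (2 * pi)) \<longlonglongrightarrow> fourier (fourier f) (- y) / (2 * pi)"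
      unfolding Gf by (intro tendsto_intros) (auto simp: fourier_def mult.commute)
    then show ?thesis by (simp add: h_def)
  qed
  have Gbound: "norm (G n y) \<le> L1norm (fourier f) / (2 * pi)" for n y
  proof -
    have "norm (2 * pi * G n y) \<le> (LINT t|lborel. norm (fourier f t * (of_real (exp (- (\<epsilon> n * t)\<^sup>2 / 2)) * cis (t * y))))"
      unfolding Gf[symmetric] by (rule integral_norm_bound)
    also have "\<dots> \<le> L1norm (fourier f)"
      unfolding L1norm_def
      by (rule integral_mono_AE')
        (use f' in \<open>auto simp: norm_mult intro!: mult_left_le\<close>)
    finally show ?thesis by (simp add: norm_mult field_simps)
  qed
  \<comment> \<open>Testing on an interval moves the shift from \<open>f\<close> to an indicator,
    where convergence is elementary.\<close>
  have key: "(LINT y:{a<..b}|lborel. h y) = (LINT y:{a<..b}|lborel. f y)" if "a \<le> b" for a b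
  proof -
    let ?I = "indicator {a<..b} :: real \<Rightarrow> real"
    have 1: "(\<lambda>n. LINT y|lborel. ?I y *\<^sub>R G n y) \<longlonglongrightarrow> (LINT y|lborel. ?I y *\<^sub>R h y)"
    proof (rule integral_dominated_convergence[where w = "\<lambda>y. ?I y * (L1norm (fourier f) / (2 * pi))"])
      show "AE y in lborel. norm (?I y *\<^sub>R G n y) \<le> ?I y * (L1norm (fourier f) / (2 * pi))" for n
        using Gbound by (intro AE_I2) (auto simp: indicator_def)
      show "AE y in lborel. (\<lambda>n. ?I y *\<^sub>R G n y) \<longlonglongrightarrow> ?I y *\<^sub>R h y"
        by (intro AE_I2 tendsto_intros Gh)
    qed (use that in auto)
    \<comment> \<open>After Fubini the interval integral is taken first: \<open>J n z\<close>
      integrates \<open>f\<close> over the interval translated by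
      \<open>\<epsilon> n * z\<close>.\<close>
    define J where "J n z = (LINT w|lborel. ?I (w - \<epsilon> n * z) *\<^sub>R f w)" for n z
    have Jmeas[measurable]: "J n \<in> borel_measurable borel" for n
      unfolding J_def by measurable
    have Jbound: "norm (J n z) \<le> L1norm f" for n z
      unfolding J_def L1norm_def
      by (rule order_trans[OF integral_norm_bound], rule integral_mono_AE')
        (use f in \<open>auto simp: indicator_def\<close>)
    have 2: "(LINT y|lborel. ?I y *\<^sub>R G n y) = (LINT z|lborel. J n z * of_real (std_normal_density z))" for n
    proof -
      let ?K = "\<lambda>z y. ?I y *\<^sub>R (f (y + \<epsilon> n * z) * of_real (std_normal_density z))"
      have int1: "integrable lborel (\<lambda>y. f (y + c))" for c
        using lborel_integrable_real_affine[OF f, of 1 c] by (simp add: add.commute)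
      have int2: "integrable lborel (\<lambda>y. ?K z y)" for z
        by (rule Bochner_Integration.integrable_bound[OF integrable_mult_left[OF int1[of "\<epsilon> n * z"],
              of "of_real (std_normal_density z)"]])
          (auto simp: indicator_def)
      have "integrable (lborel \<Otimes>\<^sub>M lborel) (\<lambda>(z, y). ?K z y)"
      proof (rule lborel_pair.Fubini_integrable)
        show "integrable lborel (\<lambda>z. LINT y|lborel. norm (case (z, y) of (z, y) \<Rightarrow> ?K z y))"
        proof (rule Bochner_Integration.integrable_bound)
          show "integrable lborel (\<lambda>z. L1norm f * std_normal_density z)"
            by (intro integrable_mult_right integrable_normal_density) auto
          show "AE z in lborel. norm (LINT y|lborel. norm (case (z, y) of (z, y) \<Rightarrow> ?K z y))
             \<le> norm (L1norm f * std_normal_density z)"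
          proof (rule AE_I2)
            fix z
            have "(LINT y|lborel. norm (?K z y)) \<le> (LINT y|lborel. norm (f (y + \<epsilon> n * z)) * std_normal_density z)"
              by (rule integral_mono_AE')
                (use int1 in \<open>auto simp: indicator_def norm_mult normal_density_nonneg\<close>)
            also have "\<dots> = L1norm f * std_normal_density z"
              unfolding L1norm_def
              by (simp, subst (2) lborel_integral_real_affine[where c = 1 and t = "\<epsilon> n * z"]) (auto simp: add.commute)
            finally show "norm (LINT y|lborel. norm (case (z, y) of (z, y) \<Rightarrow> ?K z y))
               \<le> norm (L1norm f * std_normal_density z)"
              by (simp add: integral_nonneg_AE)
          qed
        qed measurable
        show "AE z in lborel. integrable lborel (\<lambda>y. case (z, y) of (z, y) \<Rightarrow> ?K z y)"
          using int2 by simp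
      qed measurable
      from lborel_pair.Fubini_integral[OF this]
      have "(LINT y|lborel. LINT z|lborel. ?K z y) = (LINT z|lborel. LINT y|lborel. ?K z y)" .
      moreover have "(LINT z|lborel. ?K z y) = ?I y *\<^sub>R G n y" for y
        unfolding G_def by (rule integral_scaleR_right)
      moreover have "(LINT y|lborel. ?K z y) = J n z * of_real (std_normal_density z)" for z
      proof -
        have "J n z = (LINT y|lborel. ?I y *\<^sub>R f (y + \<epsilon> n * z))"
          unfolding J_def
          by (subst lborel_integral_real_affine[where c = 1 and t = "\<epsilon> n * z"]) (auto simp: add.commute)
        then show ?thesis
          by (simp flip: integral_mult_left_zero)
      qed
      ultimately show ?thesis by (simp only:)
    qed
    have 3: "(\<lambda>n. J n z) \<longlonglongrightarrow> (LINT w|lborel. ?I w *\<^sub>R f w)" for z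
      unfolding J_def
    proof (rule integral_dominated_convergence[where w = "\<lambda>x. norm (f x)"])
      \<comment> \<open>Only the two endpoints, a null set, can spoil the convergence of the
        translated indicators.\<close>
      have ptw: "(\<lambda>n. ?I (w - \<epsilon> n * z)) \<longlonglongrightarrow> ?I w" if w: "w \<noteq> a" "w \<noteq> b" for w
      proof -
        have lim: "(\<lambda>n. w - \<epsilon> n * z) \<longlonglongrightarrow> w"
          using tendsto_diff[OF tendsto_const tendsto_mult_left_zero[OF eps(2)], of w z] by simp
        consider "w < a" | "a < w" "w < b" | "b < w" using w by linarith
        then show ?thesis
        proof cases
          case 1
          then show ?thesis using order_tendstoD(2)[OF lim 1]
            by (intro tendsto_eventually) (auto elim!: eventually_mono simp: indicator_def)
        next
          case 2
          then show ?thesis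
            using eventually_conj[OF order_tendstoD(1)[OF lim 2(1)] order_tendstoD(2)[OF lim 2(2)]]
            by (intro tendsto_eventually) (auto elim!: eventually_mono simp: indicator_def)
        next
          case 3
          then show ?thesis using order_tendstoD(1)[OF lim 3] \<open>a \<le> b\<close>
            by (intro tendsto_eventually) (auto elim!: eventually_mono simp: indicator_def)
        qed
      qed
      show "AE w in lborel. (\<lambda>n. ?I (w - \<epsilon> n * z) *\<^sub>R f w) \<longlonglongrightarrow> ?I w *\<^sub>R f w"
        using AE_lborel_singleton[of a] AE_lborel_singleton[of b]
        by eventually_elim (intro tendsto_intros ptw)
    qed (use f in \<open>auto simp: indicator_def\<close>)
    have 4: "(\<lambda>n. LINT z|lborel. J n z * of_real (std_normal_density z)) \<longlonglongrightarrow>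
             (LINT z|lborel. (LINT w|lborel. ?I w *\<^sub>R f w) * of_real (std_normal_density z))"
    proof (rule integral_dominated_convergence[where w = "\<lambda>z. L1norm f * std_normal_density z"])
      show "AE z in lborel. (\<lambda>n. J n z * of_real (std_normal_density z))
         \<longlonglongrightarrow> (LINT w|lborel. ?I w *\<^sub>R f w) * of_real (std_normal_density z)"
        by (intro AE_I2 tendsto_intros 3)
      show "AE z in lborel. norm (J n z * of_real (std_normal_density z)) \<le> L1norm f * std_normal_density z" for n
        using Jbound by (auto simp: norm_mult normal_density_nonneg intro!: mult_right_mono)
    qed auto
    have "(LINT z|lborel. complex_of_real (std_normal_density z)) = 1"
      using integral_normal_density[of 1 0] by (simp only: integral_complex_of_real) simp
    then have "(LINT z|lborel. (LINT w|lborel. ?I w *\<^sub>R f w) * of_real (std_normal_density z)) =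
               (LINT w|lborel. ?I w *\<^sub>R f w)"
      by (simp only: integral_mult_right_zero mult_1_right)
    with 4 have "(\<lambda>n. LINT y|lborel. ?I y *\<^sub>R G n y) \<longlonglongrightarrow> (LINT w|lborel. ?I w *\<^sub>R f w)"
      unfolding 2 by simp
    with 1 show ?thesis
      unfolding set_lebesgue_integral_def by (rule LIMSEQ_unique)
  qed
  \<comment> \<open>\<open>h\<close> is only known to be integrable on bounded intervals, so the
    comparison is made on \<open>{- real N<..real N}\<close> for every \<open>N\<close>.\<close>
  have "AE x in lborel. \<forall>N::nat. indicator {- real N<..real N} x *\<^sub>R (f x - h x) = 0"
    unfolding AE_all_countable
  proof
    fix N :: nat
    have hint: "set_integrable lborel {a<..b} h" for a b
      by (rule set_integrable_subset[of lborel "{a..b}"])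
        (auto intro!: borel_integrable_atLeastAtMost' continuous_on_subset[OF hcont])
    have fint: "set_integrable lborel A f" if "A \<in> sets lborel" for A
      using f that unfolding set_integrable_def by (intro integrable_mult_indicator)
    show "AE x in lborel. indicator {- real N<..real N} x *\<^sub>R (f x - h x) = 0"
    proof (rule AE_eq_0_if_interval_integrals_eq_0)
      show "integrable lborel (\<lambda>x. indicator {- real N<..real N} x *\<^sub>R (f x - h x))"
        using set_integral_diff(1)[OF fint hint] unfolding set_integrable_def by simp
      fix a b :: real
      let ?a = "max a (- real N)" and ?b = "min b (real N)"
      have "(LINT x:{a<..b}|lborel. indicator {- real N<..real N} x *\<^sub>R (f x - h x)) =
            (LINT x:{?a<..?b}|lborel. f x - h x)"
        unfolding set_lebesgue_integral_def by (intro Bochner_Integration.integral_cong) (auto simp: indicator_def)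
      also have "\<dots> = 0"
      proof (cases "?a \<le> ?b")
        case True
        then show ?thesis
          using key[OF True] by (subst set_integral_diff(2)[OF fint hint]) auto
      next
        case False
        then have empty: "{?a<..?b} = {}" by auto
        show ?thesis unfolding empty by (simp add: set_lebesgue_integral_def)
      qed
      finally show "(LINT x:{a<..b}|lborel. indicator {- real N<..real N} x *\<^sub>R (f x - h x)) = 0" .
    qed
  qed
  then show ?thesis
  proof eventually_elim
    case (elim x)
    obtain N where "\<bar>x\<bar> < real N" using reals_Archimedean2 by blast
    then show ?case using elim[rule_format, of N] by (simp add: h_def indicator_def split: if_splits)
  qed
qed

section \<open>Uniqueness of Fourier coefficients\<close>

text \<open>The product formula for \<open>cos \<theta> * cos (n * \<theta>)\<close> lowers
  \<open>m\<close> at the price of the neighbouring frequencies \<open>n + 1\<close> and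
  \<open>n - 1\<close>, hence an induction over \<open>m\<close> for all \<open>n\<close> at
  once.\<close>

lemma integral_cos_power_eq_0:
  fixes w :: "'a \<Rightarrow> complex" and \<theta> :: "'a \<Rightarrow> real" and n :: nat
  assumes w: "integrable M w" and [measurable]: "\<theta> \<in> borel_measurable M"
    and zero: "\<And>n::nat. (LINT x|M. w x * of_real (cos (n * \<theta> x))) = 0"
  shows "(LINT x|M. w x * of_real (cos (\<theta> x) ^ m * cos (n * \<theta> x))) = 0"
proof (induction m arbitrary: n)
  case 0
  then show ?case using zero by simp
next
  case (Suc m)
  note [measurable] = borel_measurable_integrable[OF w]
  show ?case
  proof (cases n)
    \<comment> \<open>There is no natural frequency below 0; instead one factor
      \<open>cos (\<theta> x)\<close> is read as frequency 1.\<close>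
    case 0
    have "cos (\<theta> x) ^ Suc m * cos (n * \<theta> x) = cos (\<theta> x) ^ m * cos (real 1 * \<theta> x)" for x
      using 0 by simp
    then show ?thesis using Suc.IH[of 1] by (simp only:)
  next
    case (Suc k)
    have int: "integrable M (\<lambda>x. w x * of_real (cos (\<theta> x) ^ m * cos (j * \<theta> x)))" for j :: nat
    proof (rule Bochner_Integration.integrable_bound[OF w])
      show "AE x in M. norm (w x * of_real (cos (\<theta> x) ^ m * cos (j * \<theta> x))) \<le> norm (w x)"
        by (intro AE_I2) (auto simp: norm_mult norm_power abs_mult power_abs intro!: mult_left_le mult_le_one power_le_one)
    qed measurable
    have "w x * of_real (cos (\<theta> x) ^ Suc m * cos (n * \<theta> x)) =
          (1 / 2) * (w x * of_real (cos (\<theta> x) ^ m * cos (real (Suc n) * \<theta> x)) +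
                     w x * of_real (cos (\<theta> x) ^ m * cos (real k * \<theta> x)))" for x
    proof -
      have "real (Suc n) * \<theta> x = n * \<theta> x + \<theta> x" "real k * \<theta> x = n * \<theta> x - \<theta> x"
        using Suc by (auto simp: algebra_simps)
      then have "cos (\<theta> x) * cos (n * \<theta> x) = (cos (real (Suc n) * \<theta> x) + cos (real k * \<theta> x)) / 2"
        by (simp only: cos_add cos_diff) simp
      then have "cos (\<theta> x) ^ Suc m * cos (n * \<theta> x) =
          (cos (\<theta> x) ^ m * cos (real (Suc n) * \<theta> x) + cos (\<theta> x) ^ m * cos (real k * \<theta> x)) / 2"
        by (simp only: power_Suc2 mult.assoc) (simp only: distrib_left[symmetric] times_divide_eq_right)
      then show ?thesis
        by (simp only: of_real_divide of_real_add) (simp add: field_simps)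
    qed
    then have "(LINT x|M. w x * of_real (cos (\<theta> x) ^ Suc m * cos (n * \<theta> x))) =
        (1 / 2) * ((LINT x|M. w x * of_real (cos (\<theta> x) ^ m * cos (real (Suc n) * \<theta> x))) +
                   (LINT x|M. w x * of_real (cos (\<theta> x) ^ m * cos (real k * \<theta> x))))"
      using int by (simp only: integral_mult_right_zero Bochner_Integration.integral_add)
    then show ?thesis by (simp only: Suc.IH) simp
  qed
qed

text \<open>Weierstrass: \<psi> is uniformly close to a polynomial on \<open>{-1..1}\<close>, and
  powers of \<open>cos (\<theta> x)\<close> pair to zero with \<open>w\<close>. The general weight
  covers both a function cut to one period and an integrable function on the whole line.\<close>

lemma integral_continuous_cos_eq_0:
  fixes w :: "'a \<Rightarrow> complex" and \<theta> :: "'a \<Rightarrow> real" and \<psi> :: "real \<Rightarrow> real"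
  assumes w: "integrable M w" and [measurable]: "\<theta> \<in> borel_measurable M"
    and zero: "\<And>n::nat. (LINT x|M. w x * of_real (cos (n * \<theta> x))) = 0"
    and \<psi>: "continuous_on {-1..1} \<psi>" and [measurable]: "(\<lambda>x. \<psi> (cos (\<theta> x))) \<in> borel_measurable M"
  shows "(LINT x|M. w x * of_real (\<psi> (cos (\<theta> x)))) = 0"
proof -
  note [measurable] = borel_measurable_integrable[OF w]
  have bound: "norm (LINT x|M. w x * of_real (\<psi> (cos (\<theta> x)))) \<le> e * (LINT x|M. norm (w x))" if e: "e > 0" for e
  proof -
    obtain p where p: "real_polynomial_function p" "\<And>x. x \<in> {-1..1} \<Longrightarrow> \<bar>\<psi> x - p x\<bar> < e"
      using Stone_Weierstrass_real_polynomial_function[OF compact_Icc \<psi> e] by metis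
    obtain a N where p_eq: "p = (\<lambda>x. \<Sum>i\<le>N. a i * x ^ i)"
      using p(1) unfolding real_polynomial_function_iff_sum by blast
    have int: "integrable M (\<lambda>x. w x * of_real (cos (\<theta> x) ^ m))" for m
    proof (rule Bochner_Integration.integrable_bound[OF w])
      show "AE x in M. norm (w x * of_real (cos (\<theta> x) ^ m)) \<le> norm (w x)"
        by (intro AE_I2) (auto simp: norm_mult norm_power power_abs intro!: mult_left_le power_le_one)
    qed measurable
    have expand: "w x * of_real (p (cos (\<theta> x))) = (\<Sum>i\<le>N. of_real (a i) * (w x * of_real (cos (\<theta> x) ^ i)))" for x
      by (simp add: p_eq sum_distrib_left mult_ac)
    have intp: "integrable M (\<lambda>x. w x * of_real (p (cos (\<theta> x))))"
      unfolding expand by (intro Bochner_Integration.integrable_sum integrable_mult_right int)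
    have "(LINT x|M. w x * of_real (p (cos (\<theta> x)))) = (\<Sum>i\<le>N. of_real (a i) * (LINT x|M. w x * of_real (cos (\<theta> x) ^ i)))"
      unfolding expand
      by (subst Bochner_Integration.integral_sum) (auto intro!: integrable_mult_right int simp del: of_real_power)
    also have "\<dots> = 0"
      using integral_cos_power_eq_0[OF w assms(2) zero, of _ 0] by simp
    finally have p0: "(LINT x|M. w x * of_real (p (cos (\<theta> x)))) = 0" .
    have le: "norm (w x * of_real (\<psi> (cos (\<theta> x))) - w x * of_real (p (cos (\<theta> x)))) \<le> e * norm (w x)" for x
    proof -
      have "\<bar>\<psi> (cos (\<theta> x)) - p (cos (\<theta> x))\<bar> \<le> e"
        using p(2)[of "cos (\<theta> x)"] by simp
      then have "norm (w x) * norm (complex_of_real (\<psi> (cos (\<theta> x)) - p (cos (\<theta> x)))) \<le> norm (w x) * e"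
        by (intro mult_left_mono) (simp_all only: norm_of_real norm_ge_zero)
      then show ?thesis
        by (simp only: norm_mult[symmetric] of_real_diff right_diff_distrib mult.commute[of e])
    qed
    have [measurable]: "(\<lambda>x. w x * of_real (p (cos (\<theta> x)))) \<in> borel_measurable M"
      using intp by simp
    have intd: "integrable M (\<lambda>x. w x * of_real (\<psi> (cos (\<theta> x))) - w x * of_real (p (cos (\<theta> x))))"
      by (rule Bochner_Integration.integrable_bound[OF integrable_mult_right[OF integrable_norm[OF w], of e]])
        (use le e in auto)
    have "(LINT x|M. w x * of_real (\<psi> (cos (\<theta> x)))) =
          (LINT x|M. (w x * of_real (\<psi> (cos (\<theta> x))) - w x * of_real (p (cos (\<theta> x)))) + w x * of_real (p (cos (\<theta> x))))"
      by simp
    also have "\<dots> = (LINT x|M. w x * of_real (\<psi> (cos (\<theta> x))) - w x * of_real (p (cos (\<theta> x))))"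
      using Bochner_Integration.integral_add[OF intd intp] p0 by simp
    also have "norm \<dots> \<le> (LINT x|M. norm (w x * of_real (\<psi> (cos (\<theta> x))) - w x * of_real (p (cos (\<theta> x)))))"
      by (rule integral_norm_bound)
    also have "\<dots> \<le> (LINT x|M. e * norm (w x))"
      by (rule integral_mono_AE') (use w le e in auto)
    finally show ?thesis by simp
  qed
  define W where "W = (LINT x|M. norm (w x))"
  have "W \<ge> 0" unfolding W_def by simp
  have "norm (LINT x|M. w x * of_real (\<psi> (cos (\<theta> x)))) \<le> e" if "e > 0" for e
  proof -
    \<comment> \<open>Dividing by \<open>W + 1\<close> instead of \<open>W\<close> also covers a
      weight of norm 0.\<close>
    have "norm (LINT x|M. w x * of_real (\<psi> (cos (\<theta> x)))) \<le> e / (W + 1) * W"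
      using bound[of "e / (W + 1)"] that \<open>W \<ge> 0\<close> unfolding W_def by simp
    also have "\<dots> \<le> e"
      using that \<open>W \<ge> 0\<close> by (simp add: field_simps)
    finally show ?thesis .
  qed
  then show ?thesis
    using field_le_epsilon[of "norm (LINT x|M. w x * of_real (\<psi> (cos (\<theta> x))))" 0] by simp
qed

text \<open>The zero set is closed; containing almost every point of the open interval, it contains
  the interval and then its closure.\<close>

lemma continuous_eq_0_if_AE:
  fixes E :: "real \<Rightarrow> complex"
  assumes "continuous_on UNIV E" "AE s in lborel. s \<in> {a<..<b} \<longrightarrow> E s = 0" "s \<in> {a..b}" "a < b"
  shows "E s = 0"
proof -
  have cl: "closed {s. E s = 0}"
    using assms(1) by (intro closed_Collect_eq) auto
  have "x \<in> {s. E s = 0}" if "x \<in> {a<..<b}" for x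
    using mem_closed_if_AE_lebesgue_open[of "{a<..<b}" "{s. E s = 0}" x] cl that AE_completion[OF assms(2)] by simp
  then have "closure {a<..<b} \<subseteq> {s. E s = 0}"
    using cl by (intro closure_minimal) auto
  then show ?thesis
    using assms by auto
qed

lemma integrable_indicator_continuous:
  fixes f :: "real \<Rightarrow> complex"
  assumes "continuous_on UNIV f"
  shows "integrable lborel (\<lambda>x. indicator {a..b} x *\<^sub>R f x)"
  using borel_integrable_atLeastAtMost'[OF continuous_on_subset[OF assms subset_UNIV]]
  unfolding set_integrable_def .

text \<open>By symmetry \<open>E\<close> is a function of \<open>cos (2 pi s / L)\<close>, so \<open>E\<close> itself can serve as a test function.\<close>

lemma symmetric_fourier_coefficients_unique:
  fixes E :: "real \<Rightarrow> complex"
  assumes cont: "continuous_on UNIV E" and L: "0 < L"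
    and sym: "\<And>s. s \<in> {0..L} \<Longrightarrow> E (L - s) = E s"
    and zero: "\<And>n::nat. (LINT s|lborel. (indicator {0..L} s *\<^sub>R E s) * of_real (cos (n * (2 * pi * s / L)))) = 0"
    and s: "s \<in> {0..L}"
  shows "E s = 0"
proof -
  define w where "w s = indicator {0..L} s *\<^sub>R E s" for s
  have w: "integrable lborel w"
    unfolding w_def by (rule integrable_indicator_continuous[OF cont])
  note [measurable] = borel_measurable_integrable[OF w] borel_measurable_continuous_onI[OF cont]
  \<comment> \<open>\<open>arccos\<close> recovers \<open>s\<close> from
    \<open>cos (2 * pi * s / L)\<close> on the first half of the period only; the symmetry of
    \<open>E\<close> supplies the second half.\<close>
  define A where "A c = E (L * arccos c / (2 * pi))" for c
  have A_eq: "A (cos (2 * pi * s / L)) = E s" if s: "s \<in> {0..L}" for s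
  proof (cases "s \<le> L / 2")
    case True
    then have "arccos (cos (2 * pi * s / L)) = 2 * pi * s / L"
      using s L by (intro arccos_cos) (auto simp: field_simps)
    then show ?thesis using L by (simp add: A_def)
  next
    case False
    have "cos (2 * pi * s / L) = cos (2 * pi - 2 * pi * s / L)"
      by (simp add: cos_diff)
    moreover have "arccos (cos (2 * pi - 2 * pi * s / L)) = 2 * pi - 2 * pi * s / L"
      using False s L by (intro arccos_cos) (auto simp: field_simps)
    ultimately have "A (cos (2 * pi * s / L)) = E (L * (2 * pi - 2 * pi * s / L) / (2 * pi))"
      by (simp add: A_def)
    also have "L * (2 * pi - 2 * pi * s / L) / (2 * pi) = L - s"
      using L by (simp add: field_simps)
    finally show ?thesis using sym[OF s] by simp
  qed
  have Acont: "continuous_on {-1..1} A"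
    unfolding A_def
    by (intro continuous_on_compose2[OF cont] continuous_intros) auto
  have Ameas: "(\<lambda>s. A (cos (2 * pi * s / L))) \<in> borel_measurable lborel"
    using L by (auto intro!: borel_measurable_continuous_onI continuous_on_compose2[OF Acont] continuous_intros)
  have 1: "(LINT s|lborel. w s * of_real (Re (E s))) = 0"
  proof -
    have "(LINT s|lborel. w s * of_real (Re (A (cos (2 * pi * s / L))))) = 0"
      by (rule integral_continuous_cos_eq_0[where \<theta> = "\<lambda>s. 2 * pi * s / L" and \<psi> = "\<lambda>c. Re (A c)"])
        (use w zero Ameas in \<open>auto simp: w_def[symmetric] intro!: continuous_intros Acont\<close>)
    moreover have "w s * of_real (Re (A (cos (2 * pi * s / L)))) = w s * of_real (Re (E s))" for s
      using A_eq[of s] by (auto simp: w_def indicator_def)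
    ultimately show ?thesis by simp
  qed
  have 2: "(LINT s|lborel. w s * of_real (Im (E s))) = 0"
  proof -
    have "(LINT s|lborel. w s * of_real (Im (A (cos (2 * pi * s / L))))) = 0"
      by (rule integral_continuous_cos_eq_0[where \<theta> = "\<lambda>s. 2 * pi * s / L" and \<psi> = "\<lambda>c. Im (A c)"])
        (use w zero Ameas in \<open>auto simp: w_def[symmetric] intro!: continuous_intros Acont\<close>)
    moreover have "w s * of_real (Im (A (cos (2 * pi * s / L)))) = w s * of_real (Im (E s))" for s
      using A_eq[of s] by (auto simp: w_def indicator_def)
    ultimately show ?thesis by simp
  qed
  have i1: "integrable lborel (\<lambda>s. w s * of_real (Re (E s)))" "integrable lborel (\<lambda>s. w s * of_real (Im (E s)))"
    unfolding w_def scaleR_conv_of_real mult.assoc unfolding scaleR_conv_of_real[symmetric]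
    by (intro integrable_indicator_continuous continuous_intros cont)+
  \<comment> \<open>Testing against the real and the imaginary part of \<open>E\<close> and adding
    up gives the integral of \<open>(norm (E s))\<^sup>2\<close> over one period.\<close>
  have "(LINT s|lborel. Re (w s * of_real (Re (E s))) + Im (w s * of_real (Im (E s)))) = 0"
    by (simp only: Bochner_Integration.integral_add[OF integrable_Re[OF i1(1)] integrable_Im[OF i1(2)]]
        integral_Re[OF i1(1)] integral_Im[OF i1(2)] 1 2) simp
  moreover have eq: "Re (w s * of_real (Re (E s))) + Im (w s * of_real (Im (E s))) = indicator {0..L} s * (norm (E s))\<^sup>2" for s
    by (simp add: w_def cmod_power2 algebra_simps) (simp add: power2_eq_square algebra_simps)
  ultimately have "(LINT s|lborel. indicator {0..L} s * (norm (E s))\<^sup>2) = 0"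
    by (simp only:)
  moreover have "integrable lborel (\<lambda>s. indicator {0..L} s * (norm (E s))\<^sup>2)"
    unfolding eq[symmetric] using i1 by (intro Bochner_Integration.integrable_add integrable_Re integrable_Im)
  ultimately have "AE s in lborel. indicator {0..L} s * (norm (E s))\<^sup>2 = 0"
    by (subst (asm) integral_nonneg_eq_0_iff_AE) auto
  then have "AE s in lborel. s \<in> {0<..<L} \<longrightarrow> E s = 0"
    by eventually_elim (auto simp: indicator_def)
  then show ?thesis
    using continuous_eq_0_if_AE[OF cont _ s L] by blast
qed

text \<open>The symmetric case applies to the even part of \<open>H\<close>, and then to \<open>H s * sin (2 pi s / L)\<close>.\<close>

lemma fourier_coefficients_unique:
  fixes H :: "real \<Rightarrow> complex"
  assumes cont: "continuous_on UNIV H" and L: "0 < L"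
    and zero: "\<And>n::int. (LINT s|lborel. (indicator {0..L} s *\<^sub>R H s) * cis (n * (2 * pi * s / L))) = 0"
    and s: "s \<in> {0..L}"
  shows "H s = 0"
proof -
  define \<theta> where "\<theta> s = 2 * pi * s / L" for s
  have zero_hbi: "has_bochner_integral lborel (\<lambda>s. indicator {0..L} s *\<^sub>R (H s * cis (of_int n * \<theta> s))) 0" for n
  proof -
    have "integrable lborel (\<lambda>s. indicator {0..L} s *\<^sub>R (H s * cis (of_int n * \<theta> s)))"
      unfolding \<theta>_def using L by (intro integrable_indicator_continuous continuous_intros cont) auto
    then show ?thesis using zero[of n] by (simp add: has_bochner_integral_iff \<theta>_def)
  qed
  \<comment> \<open>The reflection at \<open>L / 2\<close> turns frequency \<open>n\<close> into
    \<open>- n\<close>, up to a multiple of \<open>2 * pi\<close> in the argument.\<close>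
  have refl_hbi: "has_bochner_integral lborel (\<lambda>s. indicator {0..L} s *\<^sub>R (H (L - s) * cis (of_int n * \<theta> s))) 0" for n
  proof -
    have "has_bochner_integral lborel
       (\<lambda>s. indicator {0..L} (L + (-1) * s) *\<^sub>R (H (L + (-1) * s) * cis (of_int (- n) * \<theta> (L + (-1) * s)))) (0 /\<^sub>R \<bar>-1\<bar>)"
      using zero_hbi[of "- n"] by (subst (asm) lborel_has_bochner_integral_real_affine_iff[where c = "-1" and t = L]) auto
    moreover have "cis (of_int (- n) * \<theta> (L + (-1) * s)) = cis (of_int n * \<theta> s)" for s
    proof -
      have "of_int (- n) * \<theta> (L + (-1) * s) = of_int n * \<theta> s + 2 * pi * of_int (- n)"
        using L by (simp add: \<theta>_def field_simps)
      then show ?thesis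
        by (simp only: cis_mult[symmetric] cis_multiple_2pi[OF Ints_of_int]) simp
    qed
    moreover have "indicator {0..L} (L + (-1) * s) = (indicator {0..L} s :: real)" for s
      by (auto simp: indicator_def)
    ultimately show ?thesis by (simp only:) simp
  qed
  have cos_cis: "complex_of_real (cos x) = (1/2) * (cis x + cis (- x))" for x
    by (simp add: complex_eq_iff)
  have E0: "H s + H (L - s) = 0" if "s \<in> {0..L}" for s
  proof (rule symmetric_fourier_coefficients_unique[OF _ L _ _ that])
    show "continuous_on UNIV (\<lambda>s. H s + H (L - s))"
      by (intro continuous_intros cont continuous_on_compose2[OF cont]) auto
    show "H (L - s) + H (L - (L - s)) = H s + H (L - s)" for s by simp
    fix n :: nat
    have "has_bochner_integral lborel (\<lambda>s. (1/2) * ((indicator {0..L} s *\<^sub>R (H s * cis (of_int (int n) * \<theta> s)) +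
        indicator {0..L} s *\<^sub>R (H (L - s) * cis (of_int (int n) * \<theta> s))) +
       (indicator {0..L} s *\<^sub>R (H s * cis (of_int (- int n) * \<theta> s)) +
        indicator {0..L} s *\<^sub>R (H (L - s) * cis (of_int (- int n) * \<theta> s))))) ((1/2) * ((0 + 0) + (0 + 0)))"
      by (intro has_bochner_integral_mult_right has_bochner_integral_add zero_hbi refl_hbi)
    also have "(\<lambda>s. (1/2) * ((indicator {0..L} s *\<^sub>R (H s * cis (of_int (int n) * \<theta> s)) +
        indicator {0..L} s *\<^sub>R (H (L - s) * cis (of_int (int n) * \<theta> s))) +
       (indicator {0..L} s *\<^sub>R (H s * cis (of_int (- int n) * \<theta> s)) +
        indicator {0..L} s *\<^sub>R (H (L - s) * cis (of_int (- int n) * \<theta> s))))) =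
       (\<lambda>s. (indicator {0..L} s *\<^sub>R (H s + H (L - s))) * of_real (cos (n * (2 * pi * s / L))))"
      unfolding cos_cis by (auto simp: fun_eq_iff \<theta>_def indicator_def algebra_simps)
    finally show "(LINT s|lborel. (indicator {0..L} s *\<^sub>R (H s + H (L - s))) * of_real (cos (n * (2 * pi * s / L)))) = 0"
      by (simp add: has_bochner_integral_iff)
  qed
  have sin_cis: "complex_of_real (sin x) = (1 / (2 * \<i>)) * (cis x - cis (- x))" for x
    by (simp add: complex_eq_iff)
  \<comment> \<open>By \<open>E0\<close>, \<open>H\<close> is odd about \<open>L / 2\<close>; so is
    the sine, and the product is symmetric. Sine times cosine is half the sum of the sines at the
    frequencies \<open>n + 1\<close> and \<open>1 - n\<close>, so the hypothesis applies
    again.\<close>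
  have O0: "H s * of_real (sin (\<theta> s)) = 0" if "s \<in> {0..L}" for s
  proof (rule symmetric_fourier_coefficients_unique[OF _ L _ _ that])
    show "continuous_on UNIV (\<lambda>s. H s * of_real (sin (\<theta> s)))"
      unfolding \<theta>_def using L by (intro continuous_intros cont) auto
    show "H (L - s) * of_real (sin (\<theta> (L - s))) = H s * of_real (sin (\<theta> s))" if "s \<in> {0..L}" for s
    proof -
      have "\<theta> (L - s) = 2 * pi - \<theta> s" using L by (simp add: \<theta>_def field_simps)
      then have "sin (\<theta> (L - s)) = - sin (\<theta> s)" by (simp add: sin_diff)
      then show ?thesis using E0[OF that] by (simp add: add_eq_0_iff)
    qed
    fix n :: nat
    have "has_bochner_integral lborel (\<lambda>s. (1 / (4 * \<i>)) * (
        (indicator {0..L} s *\<^sub>R (H s * cis (of_int (int n + 1) * \<theta> s)) -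
         indicator {0..L} s *\<^sub>R (H s * cis (of_int (- (int n + 1)) * \<theta> s))) +
        (indicator {0..L} s *\<^sub>R (H s * cis (of_int (1 - int n) * \<theta> s)) -
         indicator {0..L} s *\<^sub>R (H s * cis (of_int (- (1 - int n)) * \<theta> s))))) ((1 / (4 * \<i>)) * ((0 - 0) + (0 - 0)))"
      by (intro has_bochner_integral_mult_right has_bochner_integral_add has_bochner_integral_diff zero_hbi)
    also have "(\<lambda>s. (1 / (4 * \<i>)) * (
        (indicator {0..L} s *\<^sub>R (H s * cis (of_int (int n + 1) * \<theta> s)) -
         indicator {0..L} s *\<^sub>R (H s * cis (of_int (- (int n + 1)) * \<theta> s))) +
        (indicator {0..L} s *\<^sub>R (H s * cis (of_int (1 - int n) * \<theta> s)) -
         indicator {0..L} s *\<^sub>R (H s * cis (of_int (- (1 - int n)) * \<theta> s))))) =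
       (\<lambda>s. (indicator {0..L} s *\<^sub>R (H s * of_real (sin (\<theta> s)))) * of_real (cos (n * (2 * pi * s / L))))"
    proof
      fix s
      have "sin (\<theta> s) * cos (n * \<theta> s) = (1/2) * (sin (of_int (int n + 1) * \<theta> s) + sin (of_int (1 - int n) * \<theta> s))"
        by (simp add: sin_add sin_diff algebra_simps)
      then have "complex_of_real (sin (\<theta> s)) * of_real (cos (n * (2 * pi * s / L))) =
          (1/2) * (of_real (sin (of_int (int n + 1) * \<theta> s)) + of_real (sin (of_int (1 - int n) * \<theta> s)))"
        unfolding \<theta>_def of_real_mult[symmetric] of_real_add[symmetric] by (simp only: of_real_mult) simp
      also have "\<dots> = (1 / (4 * \<i>)) * ((cis (of_int (int n + 1) * \<theta> s) - cis (of_int (- (int n + 1)) * \<theta> s)) +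
           (cis (of_int (1 - int n) * \<theta> s) - cis (of_int (- (1 - int n)) * \<theta> s)))"
        unfolding sin_cis by (simp add: field_simps)
      finally show "(1 / (4 * \<i>)) * (
        (indicator {0..L} s *\<^sub>R (H s * cis (of_int (int n + 1) * \<theta> s)) -
         indicator {0..L} s *\<^sub>R (H s * cis (of_int (- (int n + 1)) * \<theta> s))) +
        (indicator {0..L} s *\<^sub>R (H s * cis (of_int (1 - int n) * \<theta> s)) -
         indicator {0..L} s *\<^sub>R (H s * cis (of_int (- (1 - int n)) * \<theta> s)))) =
       (indicator {0..L} s *\<^sub>R (H s * of_real (sin (\<theta> s)))) * of_real (cos (n * (2 * pi * s / L)))"
        by (auto simp: indicator_def mult.assoc) (simp add: algebra_simps)
    qed
    finally show "(LINT s|lborel. (indicator {0..L} s *\<^sub>R (H s * of_real (sin (\<theta> s)))) * of_real (cos (n * (2 * pi * s / L)))) = 0"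
      by (simp add: has_bochner_integral_iff)
  qed
  \<comment> \<open>Inside the period the sine vanishes only at \<open>L / 2\<close>, a null
    set.\<close>
  have "AE s in lborel. s \<in> {0<..<L} \<longrightarrow> H s = 0"
    using AE_lborel_singleton[of "L / 2"]
  proof eventually_elim
    case (elim s)
    show ?case
    proof
      assume s: "s \<in> {0<..<L}"
      have "sin (\<theta> s) \<noteq> 0"
      proof (cases "s < L / 2")
        case True
        then have "sin (\<theta> s) > 0" using s L by (intro sin_gt_zero) (auto simp: \<theta>_def field_simps)
        then show ?thesis by simp
      next
        case False
        then have "sin (\<theta> s) < 0" using s L elim by (intro sin_lt_zero) (auto simp: \<theta>_def field_simps)
        then show ?thesis by simp
      qed
      then show "H s = 0" using O0[of s] s by simp
    qed
  qed
  then show ?thesis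
    using continuous_eq_0_if_AE[OF cont _ s L] by blast
qed

section \<open>Band-limited functions\<close>

lemma integrable_if_continuous_support:
  fixes F :: "real \<Rightarrow> complex"
  assumes "continuous_on UNIV F" "\<And>t. \<sigma> < \<bar>t\<bar> \<Longrightarrow> F t = 0"
  shows "integrable lborel F"
proof -
  have "integrable lborel (\<lambda>t. indicator {-\<sigma>..\<sigma>} t *\<^sub>R F t)"
    using borel_integrable_atLeastAtMost'[OF continuous_on_subset[OF assms(1)]]
    unfolding set_integrable_def by blast
  also have "(\<lambda>t. indicator {-\<sigma>..\<sigma>} t *\<^sub>R F t) = F"
    using assms(2) by (auto simp: fun_eq_iff indicator_def abs_le_iff not_le[symmetric])
  finally show ?thesis .
qed

lemma B1_integrable: "g \<in> B1 \<sigma> \<Longrightarrow> integrable lborel g"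
  by (simp add: B1_def)

text \<open>Continuity of the transform carries the vanishing over to the endpoints. They matter
  because the frequencies of the periodic sign function are the multiples of \<sigma>, including
  \<sigma> and \<open>- \<sigma>\<close> themselves.\<close>

lemma fourier_B1_eq_0:
  assumes "g \<in> B1 \<sigma>" "\<sigma> \<le> \<bar>t\<bar>" "0 < \<sigma>"
  shows "fourier g t = 0"
proof (rule ccontr)
  assume ne: "fourier g t \<noteq> 0"
  have "closed {t. fourier g t = 0}"
    using continuous_on_fourier[OF B1_integrable[OF assms(1)]]
    by (intro closed_Collect_eq) auto
  then have "open {t. fourier g t \<noteq> 0}"
    by (simp add: closed_def Collect_neg_eq)
  with ne obtain e where e: "e > 0" "ball t e \<subseteq> {t. fourier g t \<noteq> 0}"
    using open_contains_ball by blast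
  have "t + sgn t * (e / 2) \<in> ball t e" "\<sigma> < \<bar>t + sgn t * (e / 2)\<bar>"
    using e assms by (auto simp: dist_norm sgn_if abs_if split: if_splits)
  then show False
    using e assms(1) by (auto simp: B1_def)
qed

lemma integrable_fourier_B1:
  assumes "g \<in> B1 \<sigma>"
  shows "integrable lborel (fourier g)"
  using assms by (intro integrable_if_continuous_support[of "fourier g" \<sigma>] continuous_on_fourier) (auto simp: B1_def)

text \<open>The continuous representative of a band-limited function, obtained by Fourier inversion.\<close>

definition bl_rep :: "(real \<Rightarrow> complex) \<Rightarrow> real \<Rightarrow> complex" where
  "bl_rep g x = fourier (fourier g) (- x) / (2 * pi)"

lemma AE_eq_bl_rep:
  assumes "g \<in> B1 \<sigma>"
  shows "AE x in lborel. g x = bl_rep g x"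
  using fourier_inversion[OF B1_integrable[OF assms] integrable_fourier_B1[OF assms]]
  by (simp add: bl_rep_def)

lemma continuous_on_bl_rep:
  assumes "g \<in> B1 \<sigma>"
  shows "continuous_on UNIV (bl_rep g)"
  unfolding bl_rep_def
  by (intro continuous_intros continuous_on_compose2[OF continuous_on_fourier[OF integrable_fourier_B1[OF assms]]]) auto

lemma norm_fourier_B1_le:
  assumes "g \<in> B1 \<sigma>"
  shows "norm (fourier g t) \<le> indicator {-\<sigma>..\<sigma>} t * L1norm g"
  using assms fourier_norm_le[of g t] by (auto simp: B1_def indicator_def abs_le_iff not_le[symmetric])

text \<open>The transform is bounded by the L1 norm on an interval of length
  \<open>2 * \<sigma>\<close>, so inversion gives the constant \<open>\<sigma> / pi\<close>, relaxed
  here to \<sigma>. This is the uniform bound for the compactness argument.\<close>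

lemma bl_rep_bound:
  assumes "g \<in> B1 \<sigma>" "0 < \<sigma>"
  shows "norm (bl_rep g x) \<le> \<sigma> * L1norm g"
proof -
  have "L1norm (fourier g) \<le> (LINT t|lborel. indicator {-\<sigma>..\<sigma>} t * L1norm g)"
    unfolding L1norm_def[of "fourier g"]
    using norm_fourier_B1_le[OF assms(1)] assms(2)
    by (intro integral_mono_AE') (auto simp: L1norm_def)
  also have "\<dots> = 2 * \<sigma> * L1norm g"
    using assms by simp
  finally have "norm (fourier (fourier g) (- x)) \<le> 2 * \<sigma> * L1norm g"
    using fourier_norm_le[of "fourier g" "- x"] by linarith
  then have "norm (fourier (fourier g) (- x)) / (2 * pi) \<le> 2 * \<sigma> * L1norm g / (2 * pi)"
    by (intro divide_right_mono) auto
  then have "norm (bl_rep g x) \<le> 2 * \<sigma> * L1norm g / (2 * pi)"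
    by (simp add: bl_rep_def norm_divide)
  also have "\<dots> \<le> \<sigma> * L1norm g"
  proof -
    have "0 \<le> \<sigma> * L1norm g" using assms by (simp add: L1norm_def)
    then have "\<sigma> * L1norm g * 1 \<le> \<sigma> * L1norm g * pi"
      using pi_gt3 by (intro mult_left_mono) auto
    then show ?thesis by (simp add: field_simps)
  qed
  finally show ?thesis .
qed

lemma norm_cis_diff_le: "norm (cis a - cis b) \<le> \<bar>a - b\<bar>"
proof -
  have "cis a - cis b = cis b * (cis (a - b) - 1)"
    by (simp add: right_diff_distrib cis_mult)
  then have "norm (cis a - cis b) = norm (cis (a - b) - 1)"
    by (simp add: norm_mult)
  also have "\<dots> \<le> \<bar>a - b\<bar>"
    using iexp_approx1[of "a - b" 0] by (simp add: cis_conv_exp)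
  finally show ?thesis .
qed

text \<open>A Bernstein-type bound: on the band, exponentials at \<open>x\<close> and
  \<open>y\<close> differ by at most \<open>\<sigma> * \<bar>x - y\<bar>\<close>. It supplies the
  equicontinuity for the compactness argument; the constant is again enlarged by the factor
  \<open>pi\<close>.\<close>

lemma bl_rep_lipschitz:
  assumes "g \<in> B1 \<sigma>" "0 < \<sigma>"
  shows "norm (bl_rep g x - bl_rep g y) \<le> \<sigma>\<^sup>2 * L1norm g * \<bar>x - y\<bar>"
proof -
  note int = integrable_fourier_B1[OF assms(1)]
  note [measurable] = borel_measurable_integrable[OF int]
  have "fourier (fourier g) (- x) - fourier (fourier g) (- y) =
        (LINT t|lborel. fourier g t * cis (- (- x * t)) - fourier g t * cis (- (- y * t)))"
    unfolding fourier_def[of "fourier g"]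
    by (rule Bochner_Integration.integral_diff[symmetric]) (rule fourier_integrable[OF int])+
  also have "norm \<dots> \<le> (LINT t|lborel. norm (fourier g t * cis (- (- x * t)) - fourier g t * cis (- (- y * t))))"
    by (rule integral_norm_bound)
  also have "\<dots> \<le> (LINT t|lborel. indicator {-\<sigma>..\<sigma>} t * (L1norm g * (\<sigma> * \<bar>x - y\<bar>)))"
  proof (rule integral_mono_AE')
    show "AE t in lborel. norm (fourier g t * cis (- (- x * t)) - fourier g t * cis (- (- y * t)))
       \<le> indicator {-\<sigma>..\<sigma>} t * (L1norm g * (\<sigma> * \<bar>x - y\<bar>))"
    proof (rule AE_I2)
      fix t
      have "norm (fourier g t * cis (- (- x * t)) - fourier g t * cis (- (- y * t))) =
            norm (fourier g t) * norm (cis (x * t) - cis (y * t))"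
        by (simp add: norm_mult flip: right_diff_distrib)
      also have "\<dots> \<le> (indicator {-\<sigma>..\<sigma>} t * L1norm g) * \<bar>x * t - y * t\<bar>"
        by (intro mult_mono norm_fourier_B1_le[OF assms(1)] norm_cis_diff_le) (auto simp: L1norm_def)
      also have "\<dots> = (indicator {-\<sigma>..\<sigma>} t * L1norm g) * (\<bar>t\<bar> * \<bar>x - y\<bar>)"
        by (simp only: left_diff_distrib[symmetric] abs_mult mult.commute[of "\<bar>t\<bar>"])
      also have "\<dots> \<le> indicator {-\<sigma>..\<sigma>} t * (L1norm g * (\<sigma> * \<bar>x - y\<bar>))"
        by (auto simp: indicator_def L1norm_def intro!: mult_left_mono mult_right_mono)
      finally show "norm (fourier g t * cis (- (- x * t)) - fourier g t * cis (- (- y * t)))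
       \<le> indicator {-\<sigma>..\<sigma>} t * (L1norm g * (\<sigma> * \<bar>x - y\<bar>))" .
    qed
  qed (use assms in \<open>auto simp: L1norm_def\<close>)
  also have "\<dots> = 2 * \<sigma>\<^sup>2 * L1norm g * \<bar>x - y\<bar>"
    using assms by (simp add: power2_eq_square mult_ac)
  finally have "norm (fourier (fourier g) (- x) - fourier (fourier g) (- y)) / (2 * pi) \<le>
      2 * \<sigma>\<^sup>2 * L1norm g * \<bar>x - y\<bar> / (2 * pi)"
    by (intro divide_right_mono) auto
  also have "\<dots> \<le> \<sigma>\<^sup>2 * L1norm g * \<bar>x - y\<bar>"
  proof -
    have "0 \<le> \<sigma>\<^sup>2 * L1norm g * \<bar>x - y\<bar>" using assms by (simp add: L1norm_def)
    then have "\<sigma>\<^sup>2 * L1norm g * \<bar>x - y\<bar> * 1 \<le> \<sigma>\<^sup>2 * L1norm g * \<bar>x - y\<bar> * pi"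
      using pi_gt3 by (intro mult_left_mono) auto
    then show ?thesis by (simp add: field_simps)
  qed
  finally show ?thesis
    by (simp add: bl_rep_def norm_divide flip: diff_divide_distrib)
qed

section \<open>The extremal function and its sign\<close>

lemma fourier_cmult: "fourier (\<lambda>x. c * f x) t = c * fourier f t"
  unfolding fourier_def by (simp add: mult.assoc)

lemma example_fn_measurable [measurable]: "example_fn \<sigma> \<alpha> \<in> borel_measurable borel"
  unfolding example_fn_def by measurable

text \<open>By \<open>fourier_f\<close>, the Fourier transform of the extremal function up to a
  negative constant. The maximum with 0 cuts it off outside the band.\<close>

definition spectrum_fn :: "real \<Rightarrow> real \<Rightarrow> real" where
  "spectrum_fn \<sigma> t = sin (pi / 3 * max 0 (1 - \<bar>t\<bar> / \<sigma>))"

lemma spectrum_fn_eq_0: "0 < \<sigma> \<Longrightarrow> \<sigma> \<le> \<bar>t\<bar> \<Longrightarrow> spectrum_fn \<sigma> t = 0"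
  by (simp add: spectrum_fn_def max_def)

lemma continuous_on_spectrum_fn [continuous_intros]:
  "0 < \<sigma> \<Longrightarrow> continuous_on A (spectrum_fn \<sigma>)"
  unfolding spectrum_fn_def by (intro continuous_intros) auto

lemma spectrum_fn_minus [simp]: "spectrum_fn \<sigma> (- t) = spectrum_fn \<sigma> t"
  by (simp add: spectrum_fn_def)

lemma integrable_spectrum_fn:
  "0 < \<sigma> \<Longrightarrow> integrable lborel (\<lambda>t. complex_of_real (spectrum_fn \<sigma> t))"
  by (rule integrable_if_continuous_support[where \<sigma> = \<sigma>]) (auto intro!: continuous_intros simp: spectrum_fn_eq_0)

text \<open>For an even function the transform is twice a cosine integral over
  \<open>{0..\<sigma>}\<close>. The integrand
  \<open>sin (\<beta> * (\<sigma> - t)) * cos (x * t)\<close> has an elementary antiderivative with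
  denominator \<open>\<beta>\<^sup>2 - x\<^sup>2\<close>.\<close>

lemma fourier_spectrum_fn:
  assumes \<sigma>: "0 < \<sigma>" and x: "(3 * \<sigma> * x)\<^sup>2 \<noteq> pi\<^sup>2" and \<alpha>: "\<alpha> \<noteq> 0"
  shows "fourier (\<lambda>t. complex_of_real (spectrum_fn \<sigma> t)) x = - of_real (3 * pi * \<sigma> / \<alpha>) * example_fn \<sigma> \<alpha> x"
proof -
  let ?F = "\<lambda>t. complex_of_real (spectrum_fn \<sigma> t)"
  define \<beta> where "\<beta> = pi / (3 * \<sigma>)"
  have pi_eq: "pi = 3 * \<sigma> * \<beta>" using \<sigma> by (simp add: \<beta>_def)
  have x2: "\<beta>\<^sup>2 - x\<^sup>2 \<noteq> 0"
    using x \<sigma> by (auto simp: pi_eq power_mult_distrib)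
  have refl: "fourier ?F x = (LINT t|lborel. ?F t * cis (x * t))"
    unfolding fourier_def
    by (subst lborel_integral_real_affine[where c = "-1" and t = 0]) auto
  have i: "integrable lborel (\<lambda>t. ?F t * cis (- (x * t)))" for x
    using fourier_integrable[OF integrable_spectrum_fn[OF \<sigma>]] .
  have "2 * fourier ?F x = (LINT t|lborel. ?F t * cis (- (x * t))) + (LINT t|lborel. ?F t * cis (x * t))"
    using refl by (simp add: fourier_def)
  also have "\<dots> = (LINT t|lborel. ?F t * cis (- (x * t)) + ?F t * cis (x * t))"
    using i[of x] i[of "- x"] by (intro Bochner_Integration.integral_add[symmetric]) simp_all
  also have "\<dots> = (LINT t|lborel. of_real (2 * (spectrum_fn \<sigma> t * cos (x * t))))"
    by (intro Bochner_Integration.integral_cong) (auto simp: complex_eq_iff)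
  also have "\<dots> = of_real (2 * (LINT t|lborel. spectrum_fn \<sigma> t * cos (x * t)))"
    by (simp only: integral_complex_of_real integral_mult_right_zero)
  finally have 1: "fourier ?F x = of_real (LINT t|lborel. spectrum_fn \<sigma> t * cos (x * t))"
    by simp
  let ?G = "\<lambda>t. (\<beta> * (cos (\<beta> * (\<sigma> - t)) * cos (x * t)) - x * (sin (\<beta> * (\<sigma> - t)) * sin (x * t))) / (\<beta>\<^sup>2 - x\<^sup>2)"
  have "has_bochner_integral lborel (\<lambda>t. indicator {0..\<sigma>} t *\<^sub>R (sin (\<beta> * (\<sigma> - t)) * cos (x * t))) (?G \<sigma> - ?G 0)"
  proof (rule has_bochner_integral_FTC_Icc)
    fix t
    have "(?G has_real_derivative sin (\<beta> * (\<sigma> - t)) * cos (x * t)) (at t within {0..\<sigma>})"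
      using x2 by (auto intro!: derivative_eq_intros) (simp add: field_simps power2_eq_square)
    then show "(?G has_vector_derivative sin (\<beta> * (\<sigma> - t)) * cos (x * t)) (at t within {0..\<sigma>})"
      by (simp add: has_real_derivative_iff_has_vector_derivative)
  qed (use \<sigma> in \<open>auto intro!: continuous_intros\<close>)
  also have "(\<lambda>t. indicator {0..\<sigma>} t *\<^sub>R (sin (\<beta> * (\<sigma> - t)) * cos (x * t))) =
             (\<lambda>t. indicator {0..} t *\<^sub>R (spectrum_fn \<sigma> t * cos (x * t)))"
  proof
    fix t
    show "indicator {0..\<sigma>} t *\<^sub>R (sin (\<beta> * (\<sigma> - t)) * cos (x * t)) = indicator {0..} t *\<^sub>R (spectrum_fn \<sigma> t * cos (x * t))"
    proof (cases "0 \<le> t \<and> t \<le> \<sigma>")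
      case True
      then have "spectrum_fn \<sigma> t = sin (\<beta> * (\<sigma> - t))"
        using \<sigma> by (simp add: spectrum_fn_def \<beta>_def max_def field_simps)
      then show ?thesis using True by (simp add: indicator_def)
    qed (use spectrum_fn_eq_0[OF \<sigma>, of t] in \<open>auto simp: indicator_def\<close>)
  qed
  finally have "has_bochner_integral lborel (\<lambda>t. spectrum_fn \<sigma> t * cos (x * t)) (2 *\<^sub>R (?G \<sigma> - ?G 0))"
    by (rule has_bochner_integral_even_function) simp
  then have 2: "(LINT t|lborel. spectrum_fn \<sigma> t * cos (x * t)) = 2 * (?G \<sigma> - ?G 0)"
    by (simp add: has_bochner_integral_iff)
  \<comment> \<open>This lower endpoint value is the source of the \<open>- 1\<close> in the
    numerator \<open>2 * cos (\<sigma> * x) - 1\<close>.\<close>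
  have "cos (\<beta> * \<sigma>) = 1 / 2"
    using \<sigma> by (simp add: \<beta>_def cos_60)
  then have "2 * (?G \<sigma> - ?G 0) = \<beta> * (2 * cos (\<sigma> * x) - 1) / (\<beta>\<^sup>2 - x\<^sup>2)"
    by (simp add: mult.commute diff_divide_distrib[symmetric] right_diff_distrib)
  also have "\<dots> = - (3 * pi * \<sigma> / \<alpha>) * (\<alpha> * (2 * cos (\<sigma> * x) - 1) / ((3 * \<sigma> * x)\<^sup>2 - pi\<^sup>2))"
  proof -
    have den: "(3 * \<sigma> * x)\<^sup>2 - pi\<^sup>2 = - (9 * \<sigma>\<^sup>2) * (\<beta>\<^sup>2 - x\<^sup>2)"
      by (simp add: pi_eq power_mult_distrib algebra_simps)
    have num: "3 * pi * \<sigma> = 9 * \<sigma>\<^sup>2 * \<beta>"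
      using \<sigma> by (simp add: \<beta>_def power2_eq_square)
    have "\<beta> * A / D = - (9 * s * \<beta> / \<alpha>) * (\<alpha> * A / (- (9 * s) * D))" if "D \<noteq> 0" "s \<noteq> 0" for A D s :: real
      using that \<alpha> by (simp add: field_simps)
    then show ?thesis
      unfolding den num using x2 \<sigma> by simp
  qed
  finally show ?thesis
    unfolding 1 2 example_fn_def by (simp only: of_real_mult of_real_minus)
qed

lemma AE_not_singular: "0 < \<sigma> \<Longrightarrow> AE x in lborel. (3 * \<sigma> * x)\<^sup>2 \<noteq> pi\<^sup>2"
  using AE_lborel_singleton[of "pi / (3 * \<sigma>)"] AE_lborel_singleton[of "- (pi / (3 * \<sigma>))"]
proof eventually_elim
  case (elim x)
  then have "3 * \<sigma> * x \<noteq> pi" "3 * \<sigma> * x \<noteq> - pi"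
    using \<open>0 < \<sigma>\<close> by (auto simp: field_simps)
  then show ?case unfolding power2_eq_iff by blast
qed

section \<open>The extremal function and its norming functional\<close>

locale extremal_example =
  fixes \<sigma> \<alpha> :: real
  assumes \<sigma>: "0 < \<sigma>" and \<alpha>: "0 < \<alpha>" and norm1: "L1norm (example_fn \<sigma> \<alpha>) = 1"
begin

abbreviation f :: "real \<Rightarrow> complex" where "f \<equiv> example_fn \<sigma> \<alpha>"

definition \<beta> :: real where "\<beta> = pi / (3 * \<sigma>)"

definition sgn_f :: "real \<Rightarrow> real" where "sgn_f x = sgn (Re (f x))"

text \<open>Pairing with the sign makes \<open>\<Phi> f\<close> the norm of \<open>f\<close>;
  \<open>\<Phi>_eq\<close> identifies it with the form that sees only the mean and the interval
  \<open>{-\<beta>..\<beta>}\<close>.\<close>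

definition \<Phi> :: "(real \<Rightarrow> complex) \<Rightarrow> complex" where
  "\<Phi> g = (LINT x|lborel. g x * of_real (sgn_f x))"

lemma \<beta>_pos: "0 < \<beta>" and \<sigma>\<beta>: "\<sigma> * \<beta> = pi / 3"
  using \<sigma> by (auto simp: \<beta>_def)

text \<open>The integral of a non-integrable function is 0 by convention, so the normalisation
  \<open>norm1\<close> forces integrability.\<close>

lemma integrable_f: "integrable lborel f"
proof -
  have "integrable lborel (\<lambda>x. norm (f x))"
    using norm1 not_integrable_integral_eq unfolding L1norm_def by fastforce
  then show ?thesis
    by (subst (asm) integrable_norm_iff) auto
qed

text \<open>Almost everywhere \<open>f\<close> is a multiple of the transform of
  \<open>spectrum_fn \<sigma>\<close>. That transform is therefore integrable, and inversion
  applies; continuity turns its conclusion into an identity at every point.\<close>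

lemma fourier_f: "fourier f t = - of_real (2 * \<alpha> / (3 * \<sigma>) * spectrum_fn \<sigma> t)"
proof -
  let ?F = "\<lambda>t. complex_of_real (spectrum_fn \<sigma> t)"
  let ?k = "- complex_of_real (\<alpha> / (3 * pi * \<sigma>))"
  have int: "integrable lborel ?F" using integrable_spectrum_fn \<sigma> .
  note [measurable] = borel_measurable_integrable[OF int]
  have F_meas[measurable]: "fourier ?F \<in> borel_measurable borel"
    by (rule measurable_fourier[OF int])
  have AE: "AE x in lborel. f x = ?k * fourier ?F x"
    using AE_not_singular[OF \<sigma>]
    by eventually_elim (use \<sigma> \<alpha> in \<open>auto simp: fourier_spectrum_fn[of \<sigma> _ \<alpha>]\<close>)
  then have "integrable lborel (\<lambda>x. ?k * fourier ?F x)"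
    using integrable_f by (subst integrable_cong_AE[where g = f]) auto
  from integrable_mult_right[OF this, of "inverse ?k"]
  have int2: "integrable lborel (fourier ?F)"
    using \<sigma> \<alpha> by (simp add: mult.assoc[symmetric])
  have "?F = (\<lambda>x. fourier (fourier ?F) (- x) / (2 * pi))"
  proof (rule continuous_AE_eq_imp_eq)
    show "continuous_on UNIV (\<lambda>x. fourier (fourier ?F) (- x) / (2 * pi))"
      by (intro continuous_intros continuous_on_compose2[OF continuous_on_fourier[OF int2]]) auto
  qed (use fourier_inversion[OF int int2] \<sigma> in \<open>auto intro!: continuous_intros\<close>)
  from fun_cong[OF this, of "- t"] have F: "fourier (fourier ?F) t = 2 * pi * ?F t"
    by (simp add: field_simps)
  have "fourier f t = fourier (\<lambda>x. ?k * fourier ?F x) t"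
    by (rule fun_cong[OF fourier_cong_AE[OF AE]]) auto
  also have "\<dots> = ?k * (2 * pi * ?F t)"
    by (simp only: fourier_cmult F)
  finally show ?thesis using \<sigma> by (simp add: field_simps)
qed

lemma f_in_B1: "f \<in> B1 \<sigma>"
  using integrable_f \<sigma> by (auto simp: B1_def fourier_f spectrum_fn_eq_0)

lemma f_in_DB1: "f \<in> DB1 \<sigma>"
  using f_in_B1 norm1 by (simp add: DB1_def)

lemma fourier_f_0: "fourier f 0 \<noteq> 0"
  using \<sigma> \<alpha> by (simp add: fourier_f spectrum_fn_def sin_60)

text \<open>At the two excluded points the quotient defining \<open>f\<close> is 0/0, hence 0 by
  default, while the continuous representative is nonzero there.\<close>

lemma bl_rep_f:
  assumes "(3 * \<sigma> * x)\<^sup>2 \<noteq> pi\<^sup>2"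
  shows "bl_rep f x = f x"
proof -
  have "fourier f = (\<lambda>t. - of_real (2 * \<alpha> / (3 * \<sigma>)) * complex_of_real (spectrum_fn \<sigma> t))"
    by (simp add: fun_eq_iff fourier_f)
  then have "fourier (fourier f) (- x) = - of_real (2 * \<alpha> / (3 * \<sigma>)) * fourier (\<lambda>t. complex_of_real (spectrum_fn \<sigma> t)) (- x)"
    by (simp only: fourier_cmult)
  also have "\<dots> = - of_real (2 * \<alpha> / (3 * \<sigma>)) * (- of_real (3 * pi * \<sigma> / \<alpha>) * f (- x))"
    using assms \<sigma> \<alpha> by (subst fourier_spectrum_fn[of \<sigma> "- x" \<alpha>]) auto
  also have "f (- x) = f x" by (simp add: example_fn_def)
  finally show ?thesis using \<sigma> \<alpha> by (simp add: bl_rep_def field_simps)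
qed

lemma measurable_sgn_f [measurable]: "sgn_f \<in> borel_measurable borel"
  unfolding sgn_f_def sgn_if by measurable

lemma cos_gt_half:
  assumes "\<bar>x\<bar> \<le> pi / \<sigma>"
  shows "\<bar>x\<bar> < \<beta> \<Longrightarrow> 2 * cos (\<sigma> * x) - 1 > 0" and "\<beta> < \<bar>x\<bar> \<Longrightarrow> 2 * cos (\<sigma> * x) - 1 < 0"
proof -
  have c: "cos (\<sigma> * x) = cos (\<sigma> * \<bar>x\<bar>)" by (simp add: abs_if)
  have pi: "\<sigma> * \<bar>x\<bar> \<le> pi" using assms \<sigma> by (simp add: field_simps)
  { assume "\<bar>x\<bar> < \<beta>"
    then have "\<sigma> * \<bar>x\<bar> < pi / 3"
      using \<sigma> \<sigma>\<beta> mult_strict_left_mono[of "\<bar>x\<bar>" \<beta> \<sigma>] by linarith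
    then have "cos (pi / 3) < cos (\<sigma> * \<bar>x\<bar>)"
      using \<sigma> by (intro cos_monotone_0_pi) auto
    then show "2 * cos (\<sigma> * x) - 1 > 0" using c cos_60 by simp }
  { assume "\<beta> < \<bar>x\<bar>"
    then have "pi / 3 < \<sigma> * \<bar>x\<bar>"
      using \<sigma> \<sigma>\<beta> mult_strict_left_mono[of \<beta> "\<bar>x\<bar>" \<sigma>] by linarith
    then have "cos (\<sigma> * \<bar>x\<bar>) < cos (pi / 3)"
      using pi by (intro cos_monotone_0_pi) auto
    then show "2 * cos (\<sigma> * x) - 1 < 0" using c cos_60 by simp }
qed

text \<open>The denominator of \<open>f\<close> is negative exactly for
  \<open>\<bar>x\<bar> < \<beta>\<close>, where the numerator is positive; subtracting 2 turns the
  sign 1 into \<open>- 1\<close> there.\<close>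

lemma sgn_f_eq:
  assumes "\<bar>x\<bar> \<noteq> \<beta>"
  shows "sgn_f x = sgn (2 * cos (\<sigma> * x) - 1) - 2 * indicator {-\<beta>..\<beta>} x"
proof -
  have *: "(3 * \<sigma> * x)\<^sup>2 - pi\<^sup>2 = (3 * \<sigma>)\<^sup>2 * (\<bar>x\<bar> - \<beta>) * (\<bar>x\<bar> + \<beta>)"
    using \<sigma> by (simp add: \<beta>_def power2_eq_square field_simps)
  show ?thesis
  proof (cases "\<bar>x\<bar> < \<beta>")
    case True
    then have "(3 * \<sigma> * x)\<^sup>2 - pi\<^sup>2 < 0"
      unfolding * using \<sigma> by (intro mult_neg_pos mult_pos_neg) auto
    moreover have "\<beta> \<le> pi / \<sigma>" using \<sigma> by (simp add: \<beta>_def field_simps)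
    then have "2 * cos (\<sigma> * x) - 1 > 0"
      using True by (intro cos_gt_half) auto
    ultimately have "Re (f x) < 0" "sgn (2 * cos (\<sigma> * x) - 1) = 1"
      using \<alpha> by (auto simp: example_fn_def intro!: divide_pos_neg)
    then show ?thesis using True by (auto simp: sgn_f_def indicator_def abs_less_iff)
  next
    case False
    then have "(3 * \<sigma> * x)\<^sup>2 - pi\<^sup>2 > 0"
      unfolding * using \<sigma> \<beta>_pos assms by (intro mult_pos_pos) auto
    then have "sgn_f x = sgn (2 * cos (\<sigma> * x) - 1)"
      using \<alpha> by (simp add: sgn_f_def example_fn_def sgn_divide sgn_mult)
    then show ?thesis using False assms by (auto simp: indicator_def abs_if split: if_splits)
  qed
qed

text \<open>Subtracting from \<open>g\<close> a constant \<open>c\<close> on one single period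
  leaves \<open>w\<close> with zero pairing against every \<open>cos (n * (\<sigma> * x))\<close>:
  for \<open>n = 0\<close> by the choice of \<open>c\<close>, for \<open>n > 0\<close> because both
  parts pair to zero. Hence \<open>w\<close> pairs to zero with continuous functions of
  \<open>cos (\<sigma> * x)\<close> and, in the limit, with the sign. The pairing of
  \<open>g\<close> is thus that of the constant.\<close>

lemma integral_B1_sgn_cos:
  assumes g: "g \<in> B1 \<sigma>"
  shows "(LINT x|lborel. g x * of_real (sgn (2 * cos (\<sigma> * x) - 1))) = - fourier g 0 / 3"
proof -
  note gi = B1_integrable[OF g]
  note [measurable] = borel_measurable_integrable[OF gi]
  define T where "T = pi / \<sigma>"
  have T: "T > 0" "\<sigma> * T = pi" "\<beta> < T" using \<sigma> by (auto simp: T_def \<beta>_def field_simps)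
  let ?I = "indicator {-T..T} :: real \<Rightarrow> real"
  define c where "c = fourier g 0 * of_real (1 / (2 * T))"
  define w where "w x = g x - c * of_real (?I x)" for x
  have Iint: "integrable lborel (\<lambda>x. c * of_real (?I x))"
    using T by auto
  have w: "integrable lborel w"
    unfolding w_def using gi Iint by simp
  note [measurable] = borel_measurable_integrable[OF w]
  have int_cos: "integrable lborel (\<lambda>x. u x * of_real (k x))"
    if "integrable lborel u" "\<And>x. \<bar>k x\<bar> \<le> 1" "k \<in> borel_measurable borel" for u :: "real \<Rightarrow> complex" and k
    using that(3) that(2) borel_measurable_integrable[OF that(1)]
    by (intro Bochner_Integration.integrable_bound[OF that(1)]) (auto simp: norm_mult intro!: mult_left_le)
  have wk: "(LINT x|lborel. w x * of_real (k x)) =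
      (LINT x|lborel. g x * of_real (k x)) - c * of_real (LINT x|lborel. ?I x * k x)"
    if k: "\<And>x. \<bar>k x\<bar> \<le> 1" "k \<in> borel_measurable borel" for k
  proof -
    have "(LINT x|lborel. w x * of_real (k x)) = (LINT x|lborel. g x * of_real (k x) - c * of_real (?I x) * of_real (k x))"
      by (simp add: w_def left_diff_distrib)
    also have "\<dots> = (LINT x|lborel. g x * of_real (k x)) - (LINT x|lborel. c * of_real (?I x) * of_real (k x))"
      by (intro Bochner_Integration.integral_diff int_cos gi Iint k)
    also have "(LINT x|lborel. c * of_real (?I x) * of_real (k x)) = c * (LINT x|lborel. of_real (?I x * k x))"
      by (simp add: mult.assoc)
    finally show ?thesis by (simp only: integral_complex_of_real)
  qed
  have zero: "(LINT x|lborel. w x * of_real (cos (n * (\<sigma> * x)))) = 0" for n :: nat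
  proof (cases "n = 0")
    case True
    have "(LINT x|lborel. w x * of_real (cos (n * (\<sigma> * x)))) = fourier g 0 - c * of_real (LINT x|lborel. ?I x * 1)"
      using True wk[of "\<lambda>x. 1"] by (simp add: fourier_def)
    also have "(LINT x|lborel. ?I x * 1) = 2 * T" using T by simp
    finally show ?thesis using T by (simp add: c_def)
  next
    case False
    have "has_bochner_integral lborel (\<lambda>x. ?I x *\<^sub>R cos (n * \<sigma> * x)) (sin (n * \<sigma> * T) / (n * \<sigma>) - sin (n * \<sigma> * (- T)) / (n * \<sigma>))"
    proof (rule has_bochner_integral_FTC_Icc)
      fix x
      have "((\<lambda>x. sin (n * \<sigma> * x) / (n * \<sigma>)) has_real_derivative cos (n * \<sigma> * x)) (at x within {-T..T})"
        using False \<sigma> by (auto intro!: derivative_eq_intros)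
      then show "((\<lambda>x. sin (n * \<sigma> * x) / (n * \<sigma>)) has_vector_derivative cos (n * \<sigma> * x)) (at x within {-T..T})"
        by (simp add: has_real_derivative_iff_has_vector_derivative)
    qed (use T in \<open>auto intro!: continuous_intros\<close>)
    moreover have "sin (n * \<sigma> * T) = 0"
      using T by (simp add: mult.assoc)
    ultimately have "(LINT x|lborel. ?I x * cos (n * (\<sigma> * x))) = 0"
      by (simp add: has_bochner_integral_iff mult.assoc)
    moreover have "(LINT x|lborel. g x * of_real (cos (n * (\<sigma> * x)))) = 0"
    proof -
      have "(LINT x|lborel. g x * of_real (cos (n * (\<sigma> * x)))) =
            (LINT x|lborel. (1/2) * (g x * cis (- (n * \<sigma> * x)) + g x * cis (- (- (n * \<sigma>) * x))))"
        by (intro Bochner_Integration.integral_cong) (auto simp: complex_eq_iff field_simps)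
      also have "\<dots> = (1/2) * (fourier g (n * \<sigma>) + fourier g (- (n * \<sigma>)))"
        unfolding fourier_def integral_mult_right_zero
        by (subst Bochner_Integration.integral_add) (intro fourier_integrable[OF gi] | simp)+
      also have "\<dots> = 0"
        using fourier_B1_eq_0[OF g _ \<sigma>, of "n * \<sigma>"] fourier_B1_eq_0[OF g _ \<sigma>, of "- (n * \<sigma>)"] False \<sigma>
        by (simp add: abs_mult)
      finally show ?thesis .
    qed
    ultimately show ?thesis
      by (subst wk) auto
  qed
  \<comment> \<open>Steep lines clipped to \<open>[-1, 1]\<close>: continuous, and equal to
    \<open>sgn (2 * c - 1)\<close> for all large \<open>k\<close>.\<close>
  define \<psi> where "\<psi> k c = max (-1) (min 1 (real k * (2 * c - 1)))" for k :: nat and c :: real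
  have "(LINT x|lborel. w x * of_real (\<psi> k (cos (\<sigma> * x)))) = 0" for k
    by (rule integral_continuous_cos_eq_0[where \<theta> = "\<lambda>x. \<sigma> * x"])
      (use w zero in \<open>auto simp: \<psi>_def intro!: continuous_intros\<close>)
  moreover have "(\<lambda>k. LINT x|lborel. w x * of_real (\<psi> k (cos (\<sigma> * x)))) \<longlonglongrightarrow>
      (LINT x|lborel. w x * of_real (sgn (2 * cos (\<sigma> * x) - 1)))"
  proof (rule integral_dominated_convergence[where w = "\<lambda>x. norm (w x)"])
    have "(\<lambda>k. \<psi> k c) \<longlonglongrightarrow> sgn (2 * c - 1)" for c
    proof -
      obtain N where N: "1 \<le> real N * \<bar>2 * c - 1\<bar> \<or> 2 * c - 1 = 0"
        using ex_less_of_nat_mult[of "\<bar>2 * c - 1\<bar>" 1] by (cases "2 * c - 1 = 0") (auto intro: less_imp_le)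
      have "\<psi> k c = sgn (2 * c - 1)" if "k \<ge> N" for k
      proof -
        have "real N * \<bar>2 * c - 1\<bar> \<le> real k * \<bar>2 * c - 1\<bar>"
          using that by (intro mult_right_mono) auto
        then have k: "1 \<le> \<bar>real k * (2 * c - 1)\<bar> \<or> 2 * c - 1 = 0"
          using N by (simp only: abs_mult abs_of_nat) linarith
        show ?thesis
        proof (cases "2 * c - 1" "0::real" rule: linorder_cases)
          case less
          then have "real k * (2 * c - 1) \<le> 0" by (intro mult_nonneg_nonpos) auto
          then show ?thesis using k less by (auto simp: \<psi>_def)
        next
          case greater
          then have "real k * (2 * c - 1) \<ge> 0" by (intro mult_nonneg_nonneg) auto
          then show ?thesis using k greater by (auto simp: \<psi>_def)
        qed (auto simp: \<psi>_def)
      qed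
      then show ?thesis
        by (intro tendsto_eventually eventually_sequentiallyI[of N])
    qed
    then show "AE x in lborel. (\<lambda>k. w x * of_real (\<psi> k (cos (\<sigma> * x)))) \<longlonglongrightarrow> w x * of_real (sgn (2 * cos (\<sigma> * x) - 1))"
      by (intro AE_I2 tendsto_intros)
    show "AE x in lborel. norm (w x * of_real (\<psi> k (cos (\<sigma> * x)))) \<le> norm (w x)" for k
      by (intro AE_I2) (auto simp: norm_mult \<psi>_def intro!: mult_left_le)
  qed (use w in \<open>auto simp: \<psi>_def sgn_if\<close>)
  ultimately have "(LINT x|lborel. w x * of_real (sgn (2 * cos (\<sigma> * x) - 1))) = 0"
    by (simp add: LIMSEQ_const_iff)
  \<comment> \<open>On the period of length \<open>2 * T\<close> the sign is 1 on length
    \<open>2 * \<beta> = 2 * T / 3\<close> and \<open>- 1\<close> on the rest, so its mean is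
    \<open>- 1 / 3\<close>.\<close>
  moreover have "(LINT x|lborel. ?I x * sgn (2 * cos (\<sigma> * x) - 1)) = - 2 * T / 3"
  proof -
    have "AE x in lborel. ?I x * sgn (2 * cos (\<sigma> * x) - 1) = 2 * indicator {-\<beta>..\<beta>} x - ?I x"
      using AE_lborel_singleton[of \<beta>] AE_lborel_singleton[of "- \<beta>"]
    proof eventually_elim
      case (elim x)
      consider "\<bar>x\<bar> > T" | "\<bar>x\<bar> \<le> T" "\<bar>x\<bar> < \<beta>" | "\<bar>x\<bar> \<le> T" "\<beta> < \<bar>x\<bar>" using elim by linarith
      then show ?case
      proof cases
        case 1
        then show ?thesis using T by (auto simp: indicator_def)
      next
        case 2
        then show ?thesis using cos_gt_half(1)[of x] by (auto simp: T_def indicator_def)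
      next
        case 3
        then show ?thesis using cos_gt_half(2)[of x] by (auto simp: T_def indicator_def)
      qed
    qed
    then have "(LINT x|lborel. ?I x * sgn (2 * cos (\<sigma> * x) - 1)) = (LINT x|lborel. 2 * indicator {-\<beta>..\<beta>} x - ?I x)"
      by (intro integral_cong_AE) (auto simp: sgn_if)
    also have "\<dots> = 2 * (2 * \<beta>) - 2 * T"
      using T \<beta>_pos by (subst Bochner_Integration.integral_diff) auto
    also have "\<beta> = T / 3" by (simp add: \<beta>_def T_def)
    finally show ?thesis by simp
  qed
  moreover have "\<bar>sgn (2 * cos (\<sigma> * x) - 1)\<bar> \<le> 1" for x
    by (simp add: sgn_if)
  moreover have "(\<lambda>x. sgn (2 * cos (\<sigma> * x) - 1)) \<in> borel_measurable borel"
    unfolding sgn_if by measurable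
  ultimately have "0 = (LINT x|lborel. g x * of_real (sgn (2 * cos (\<sigma> * x) - 1))) - c * of_real (- 2 * T / 3)"
    using wk[of "\<lambda>x. sgn (2 * cos (\<sigma> * x) - 1)"] by (simp only:)
  then show ?thesis
    using T by (simp add: c_def field_simps add_eq_0_iff)
qed

lemma \<Phi>_eq:
  assumes g: "g \<in> B1 \<sigma>"
  shows "\<Phi> g = - fourier g 0 / 3 - 2 * (LINT x|lborel. indicator {-\<beta>..\<beta>} x *\<^sub>R g x)"
proof -
  note gi = B1_integrable[OF g]
  note [measurable] = borel_measurable_integrable[OF gi]
  let ?S = "\<lambda>x. sgn (2 * cos (\<sigma> * x) - 1)"
  have S_int: "integrable lborel (\<lambda>x. g x * of_real (?S x))"
    by (rule Bochner_Integration.integrable_bound[OF gi]) (auto simp: norm_mult sgn_if)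
  have I_int: "integrable lborel (\<lambda>x. indicator {-\<beta>..\<beta>} x *\<^sub>R g x)"
    by (rule integrable_mult_indicator[OF _ gi]) auto
  have "AE x in lborel. g x * of_real (sgn_f x) = g x * of_real (?S x) - 2 * (indicator {-\<beta>..\<beta>} x *\<^sub>R g x)"
    using AE_lborel_singleton[of \<beta>] AE_lborel_singleton[of "- \<beta>"]
  proof eventually_elim
    case (elim x)
    then have "\<bar>x\<bar> \<noteq> \<beta>" by auto
    then show ?case by (simp add: sgn_f_eq scaleR_conv_of_real algebra_simps)
  qed
  then have "\<Phi> g = (LINT x|lborel. g x * of_real (?S x) - 2 * (indicator {-\<beta>..\<beta>} x *\<^sub>R g x))"
    unfolding \<Phi>_def by (intro integral_cong_AE) (auto simp: sgn_if)
  also have "\<dots> = (LINT x|lborel. g x * of_real (?S x)) - (LINT x|lborel. 2 * (indicator {-\<beta>..\<beta>} x *\<^sub>R g x))"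
    by (intro Bochner_Integration.integral_diff S_int integrable_mult_right I_int)
  finally show ?thesis
    by (simp only: integral_B1_sgn_cos[OF g] integral_mult_right_zero)
qed

end

section \<open>Exposedness\<close>

lemma has_bochner_integral_cis_period:
  fixes n :: int
  assumes L: "0 < L" and n: "n \<noteq> 0"
  shows "has_bochner_integral lborel (\<lambda>s. indicator {0..L} s *\<^sub>R cis (n * (2 * pi * s / L))) 0"
proof -
  define k where "k = of_int n * (2 * pi / L)"
  have k: "k \<noteq> 0" using L n by (simp add: k_def)
  have eq: "of_int n * (2 * pi * s / L) = k * s" for s by (simp add: k_def)
  let ?G = "\<lambda>s. cis (k * s) / (\<i> * of_real k)"
  have "has_bochner_integral lborel (\<lambda>s. indicator {0..L} s *\<^sub>R cis (k * s)) (?G L - ?G 0)"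
  proof (rule has_bochner_integral_FTC_Icc)
    fix s
    have "((\<lambda>s. cis (k * s)) has_vector_derivative (k *\<^sub>R (\<i> * cis (k * s)))) (at s within {0..L})"
    proof -
      have "((\<lambda>z. exp (\<i> * (of_real k * z))) has_field_derivative k *\<^sub>R (\<i> * cis (k * s))) (at (complex_of_real s))"
        by (auto intro!: derivative_eq_intros simp: cis_conv_exp scaleR_conv_of_real)
      from has_vector_derivative_real_field[OF this] show ?thesis
        by (simp add: cis_conv_exp)
    qed
    from has_vector_derivative_divide[OF this, of "\<i> * of_real k"]
    show "(?G has_vector_derivative cis (k * s)) (at s within {0..L})"
      using k by (simp add: scaleR_conv_of_real)
  qed (use L in \<open>auto intro!: continuous_intros\<close>)
  moreover have "cis (k * L) = 1"
    using L cis_multiple_2pi[of "of_int n"] by (simp add: k_def mult.commute)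
  ultimately show ?thesis unfolding eq by simp
qed

text \<open>For each sign \<open>e\<close>, the function \<open>d\<close>, modulated and folded onto
  one period, has vanishing Fourier coefficients except at frequency 0, so the folded function is
  constant; \<open>d 0 = 0\<close> makes the constant 0. The two signs give two independent linear
  relations between \<open>d s\<close> and \<open>d (s - \<sigma>)\<close>.\<close>

lemma two_shift_interpolation_unique:
  fixes d :: "real \<Rightarrow> complex"
  assumes \<sigma>: "0 < \<sigma>" and cont: "continuous_on UNIV d"
    and supp: "\<And>t. \<sigma> \<le> \<bar>t\<bar> \<Longrightarrow> d t = 0" and d0: "d 0 = 0"
    and zero: "\<And>e n. e \<in> {1, -1 :: int} \<Longrightarrow> n \<noteq> (0 :: int) \<Longrightarrow>
       (LINT t|lborel. d t * cis (t * (of_int e * (pi / (3 * \<sigma>)) + of_int n * (2 * pi / \<sigma>)))) = 0"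
  shows "d t = 0"
proof -
  define \<beta> where "\<beta> = pi / (3 * \<sigma>)"
  have main: "d s + d (s - \<sigma>) * cis (- (e * (pi / 3))) = 0" if e: "e \<in> {1, -1::int}" and s: "s \<in> {0..\<sigma>}" for e s
  proof -
    \<comment> \<open>The two halves of the band are folded onto \<open>{0..\<sigma>}\<close>. The
      shift by \<open>n * (2 * pi / \<sigma>)\<close> in \<open>zero\<close> has period \<sigma> on
      the transform side, so \<open>zero\<close> is about the coefficients of
      \<open>H\<close>.\<close>
    define H where "H s = d s * cis (s * (e * \<beta>)) + d (s - \<sigma>) * cis ((s - \<sigma>) * (e * \<beta>))" for s
    have Hcont: "continuous_on UNIV H"
      unfolding H_def by (intro continuous_intros cont continuous_on_compose2[OF cont]) auto
    have Hint: "has_bochner_integral lborel (\<lambda>s. indicator {0..\<sigma>} s *\<^sub>R H s * cis (n * (2 * pi * s / \<sigma>))) 0" if n: "n \<noteq> 0" for n :: int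
    proof -
      define q where "q s = d s * cis (s * (e * \<beta>)) * cis (of_int n * (2 * pi * s / \<sigma>))" for s
      have qcont: "continuous_on UNIV q"
        unfolding q_def using \<sigma> by (intro continuous_intros cont) auto
      have i1: "integrable lborel (\<lambda>s. indicator {0..\<sigma>} s *\<^sub>R q s)"
        and i2: "integrable lborel (\<lambda>s. indicator {-\<sigma>..0} s *\<^sub>R q s)"
        by (rule integrable_indicator_continuous[OF qcont])+
      have q_shift: "q (-\<sigma> + 1 * s) = d (s - \<sigma>) * cis ((s - \<sigma>) * (e * \<beta>)) * cis (of_int n * (2 * pi * s / \<sigma>))" for s
      proof -
        have "of_int n * (2 * pi * s / \<sigma>) = of_int n * (2 * pi * (s - \<sigma>) / \<sigma>) + 2 * pi * of_int n"
          using \<sigma> by (simp add: field_simps)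
        then have "cis (of_int n * (2 * pi * s / \<sigma>)) = cis (of_int n * (2 * pi * (s - \<sigma>) / \<sigma>))"
          by (simp only: cis_mult[symmetric] cis_multiple_2pi[OF Ints_of_int]) simp
        moreover have "-\<sigma> + 1 * s = s - \<sigma>" by simp
        ultimately show ?thesis by (simp only: q_def)
      qed
      have H_eq: "indicator {0..\<sigma>} s *\<^sub>R H s * cis (n * (2 * pi * s / \<sigma>)) =
          indicator {0..\<sigma>} s *\<^sub>R q s + indicator {-\<sigma>..0} (-\<sigma> + 1 * s) *\<^sub>R q (-\<sigma> + 1 * s)" for s
        unfolding q_shift by (auto simp: H_def q_def indicator_def distrib_right)
      have shift: "(LINT s|lborel. indicator {-\<sigma>..0} (-\<sigma> + 1 * s) *\<^sub>R q (-\<sigma> + 1 * s)) = (LINT s|lborel. indicator {-\<sigma>..0} s *\<^sub>R q s)"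
        by (subst (2) lborel_integral_real_affine[where c = 1 and t = "- \<sigma>"]) auto
      have i3: "integrable lborel (\<lambda>s. indicator {-\<sigma>..0} (-\<sigma> + 1 * s) *\<^sub>R q (-\<sigma> + 1 * s))"
        by (rule lborel_integrable_real_affine[OF i2]) simp
      have "(LINT s|lborel. indicator {0..\<sigma>} s *\<^sub>R q s + indicator {-\<sigma>..0} (-\<sigma> + 1 * s) *\<^sub>R q (-\<sigma> + 1 * s)) =
            (LINT s|lborel. indicator {0..\<sigma>} s *\<^sub>R q s) + (LINT s|lborel. indicator {-\<sigma>..0} s *\<^sub>R q s)"
        using Bochner_Integration.integral_add[OF i1 i3] shift by simp
      also have "\<dots> = (LINT s|lborel. indicator {0..\<sigma>} s *\<^sub>R q s + indicator {-\<sigma>..0} s *\<^sub>R q s)"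
        by (rule Bochner_Integration.integral_add[symmetric, OF i1 i2])
      also have "\<dots> = (LINT t|lborel. d t * cis (t * (e * (pi / (3 * \<sigma>)) + n * (2 * pi / \<sigma>))))"
      proof (rule Bochner_Integration.integral_cong[OF refl])
        fix t
        have "q t = d t * cis (t * (e * (pi / (3 * \<sigma>)) + n * (2 * pi / \<sigma>)))"
          by (simp add: q_def mult.assoc cis_mult \<beta>_def algebra_simps)
        \<comment> \<open>The two indicators overlap only at 0, where \<open>d\<close>
          vanishes.\<close>
        moreover have "indicator {0..\<sigma>} t *\<^sub>R q t + indicator {-\<sigma>..0} t *\<^sub>R q t = q t"
          using supp[of t] d0 by (cases "t = 0") (auto simp: q_def indicator_def)
        ultimately show "indicator {0..\<sigma>} t *\<^sub>R q t + indicator {-\<sigma>..0} t *\<^sub>R q t =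
            d t * cis (t * (e * (pi / (3 * \<sigma>)) + n * (2 * pi / \<sigma>)))" by simp
      qed
      also have "\<dots> = 0" by (rule zero[OF e n])
      finally show ?thesis
        unfolding H_eq has_bochner_integral_iff using Bochner_Integration.integrable_add[OF i1 i3] by simp
    qed
    \<comment> \<open>Subtracting the mean removes the one coefficient that \<open>zero\<close>
      leaves open.\<close>
    define c where "c = (LINT s|lborel. indicator {0..\<sigma>} s *\<^sub>R H s) / \<sigma>"
    have "H s - c = 0" if "s \<in> {0..\<sigma>}" for s
    proof (rule fourier_coefficients_unique[OF _ \<sigma> _ that])
      show "continuous_on UNIV (\<lambda>s. H s - c)"
        by (intro continuous_intros Hcont)
      fix n :: int
      show "(LINT s|lborel. (indicator {0..\<sigma>} s *\<^sub>R (H s - c)) * cis (n * (2 * pi * s / \<sigma>))) = 0"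
      proof (cases "n = 0")
        case True
        have "(LINT s|lborel. indicator {0..\<sigma>} s *\<^sub>R H s - indicator {0..\<sigma>} s *\<^sub>R c) =
           (LINT s|lborel. indicator {0..\<sigma>} s *\<^sub>R H s) - (LINT s|lborel. indicator {0..\<sigma>} s *\<^sub>R c)"
          by (intro Bochner_Integration.integral_diff integrable_indicator_continuous Hcont continuous_intros)
        also have "(LINT s|lborel. indicator {0..\<sigma>} s *\<^sub>R c) = \<sigma> *\<^sub>R c"
          using \<sigma> by simp
        also have "(LINT s|lborel. indicator {0..\<sigma>} s *\<^sub>R H s) - \<sigma> *\<^sub>R c = 0"
          using \<sigma> by (simp add: c_def scaleR_conv_of_real)
        finally show ?thesis
          using True by (simp add: scaleR_diff_right)
      next
        case False
        have "has_bochner_integral lborel (\<lambda>s. indicator {0..\<sigma>} s *\<^sub>R H s * cis (n * (2 * pi * s / \<sigma>)) -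
            c * (indicator {0..\<sigma>} s *\<^sub>R cis (n * (2 * pi * s / \<sigma>)))) (0 - c * 0)"
          by (intro has_bochner_integral_diff has_bochner_integral_mult_right Hint[OF False]
              has_bochner_integral_cis_period[OF \<sigma> False])
        also have "(\<lambda>s. indicator {0..\<sigma>} s *\<^sub>R H s * cis (n * (2 * pi * s / \<sigma>)) -
            c * (indicator {0..\<sigma>} s *\<^sub>R cis (n * (2 * pi * s / \<sigma>)))) =
            (\<lambda>s. (indicator {0..\<sigma>} s *\<^sub>R (H s - c)) * cis (n * (2 * pi * s / \<sigma>)))"
          by (auto simp: fun_eq_iff indicator_def algebra_simps)
        finally show ?thesis by (simp add: has_bochner_integral_iff)
      qed
    qed
    \<comment> \<open>The constant is \<open>H 0\<close>, which vanishes because \<open>d\<close>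
      does at 0 and at \<open>- \<sigma>\<close>.\<close>
    from this[of 0] this[OF s] have "H s = 0"
      using \<sigma> d0 supp[of "- \<sigma>"] by (simp add: H_def)
    moreover have "H s = (d s + d (s - \<sigma>) * cis (- (e * (pi / 3)))) * cis (s * (e * \<beta>))"
    proof -
      have "(s - \<sigma>) * (e * \<beta>) = - (e * (pi / 3)) + s * (e * \<beta>)"
        using \<sigma> by (simp add: \<beta>_def field_simps)
      then show ?thesis
        by (simp add: H_def distrib_right cis_mult mult.assoc)
    qed
    ultimately show ?thesis by simp
  qed
  have pair: "d s = 0 \<and> d (s - \<sigma>) = 0" if "s \<in> {0..\<sigma>}" for s
  proof -
    have a: "d s + d (s - \<sigma>) * cis (- (pi / 3)) = 0" "d s + d (s - \<sigma>) * cis (pi / 3) = 0"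
      using main[of 1, OF _ that] main[of "-1", OF _ that] by simp_all
    then have "(d s + d (s - \<sigma>) * cis (pi / 3)) - (d s + d (s - \<sigma>) * cis (- (pi / 3))) = 0" by simp
    then have "d (s - \<sigma>) * (cis (pi / 3) - cis (- (pi / 3))) = 0"
      by (simp only: right_diff_distrib) simp
    \<comment> \<open>The determinant of the two relations, equal to
      \<open>2 * \<i> * sin (pi / 3)\<close>.\<close>
    moreover have "cis (pi / 3) - cis (- (pi / 3)) \<noteq> 0"
      by (simp add: complex_eq_iff sin_60)
    ultimately have "d (s - \<sigma>) = 0" by simp
    then show ?thesis using a by simp
  qed
  consider "\<sigma> \<le> \<bar>t\<bar>" | "t \<in> {0..\<sigma>}" | "t + \<sigma> \<in> {0..\<sigma>}" by fastforce
  then show ?thesis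
    using supp pair[of t] pair[of "t + \<sigma>"] by cases auto
qed

section \<open>Linear structure of the band-limited space and its bounded functionals\<close>

lemma fourier_add:
  assumes "integrable lborel f" "integrable lborel g"
  shows "fourier (\<lambda>x. f x + g x) t = fourier f t + fourier g t"
  unfolding fourier_def distrib_right
  by (intro Bochner_Integration.integral_add fourier_integrable assms)

lemma B1_lincomb:
  assumes "f \<in> B1 \<sigma>" "g \<in> B1 \<sigma>"
  shows "(\<lambda>x. a * f x + b * g x) \<in> B1 \<sigma>"
  using assms by (auto simp: B1_def fourier_cmult fourier_add)

lemma B1_cmult: "f \<in> B1 \<sigma> \<Longrightarrow> (\<lambda>x. a * f x) \<in> B1 \<sigma>"
  using B1_lincomb[of f \<sigma> f a 0] by simp

lemma B1_zero: "(\<lambda>x. 0) \<in> B1 \<sigma>"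
  by (simp add: B1_def fourier_def)

lemma L1norm_nonneg: "0 \<le> L1norm f"
  by (simp add: L1norm_def)

lemma L1norm_cmult: "L1norm (\<lambda>x. a * f x) = norm a * L1norm f"
  by (simp add: L1norm_def norm_mult)

lemma L1norm_cong_AE:
  assumes "AE x in lborel. f x = g x" "f \<in> borel_measurable borel" "g \<in> borel_measurable borel"
  shows "L1norm f = L1norm g"
  unfolding L1norm_def by (rule integral_cong_AE) (use assms in auto)

lemma bounded_functional_lincomb:
  "bounded_functional \<sigma> \<Psi> \<Longrightarrow> f \<in> B1 \<sigma> \<Longrightarrow> g \<in> B1 \<sigma> \<Longrightarrow>
   \<Psi> (\<lambda>x. a * f x + b * g x) = a * \<Psi> f + b * \<Psi> g"
  unfolding bounded_functional_def by blast

lemma bounded_functional_cmult: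
  "bounded_functional \<sigma> \<Psi> \<Longrightarrow> f \<in> B1 \<sigma> \<Longrightarrow> \<Psi> (\<lambda>x. a * f x) = a * \<Psi> f"
  using bounded_functional_lincomb[of \<sigma> \<Psi> f f a 0] by simp

text \<open>Functionals act on functions, not on classes; boundedness makes them respect the
  classes, since the difference has norm 0.\<close>

lemma bounded_functional_cong_AE:
  assumes \<Psi>: "bounded_functional \<sigma> \<Psi>" and f: "f \<in> B1 \<sigma>" and g: "g \<in> B1 \<sigma>"
    and eq: "AE x in lborel. f x = g x"
  shows "\<Psi> f = \<Psi> g"
proof -
  obtain C where C: "\<And>f. f \<in> B1 \<sigma> \<Longrightarrow> norm (\<Psi> f) \<le> C * L1norm f"
    using \<Psi> unfolding bounded_functional_def by blast
  note [measurable] = borel_measurable_integrable[OF B1_integrable[OF f]]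
    borel_measurable_integrable[OF B1_integrable[OF g]]
  have "L1norm (\<lambda>x. 1 * f x + (-1) * g x) = L1norm (\<lambda>x. 0)"
    by (rule L1norm_cong_AE) (use eq in auto)
  then have "norm (\<Psi> (\<lambda>x. 1 * f x + (-1) * g x)) \<le> 0"
    using C[OF B1_lincomb[OF f g, of 1 "-1"]] by (simp add: L1norm_def)
  then show ?thesis
    unfolding bounded_functional_lincomb[OF \<Psi> f g] by simp
qed

text \<open>Rescaling to the unit ball. The supremum in \<open>fnorm\<close> bounds the values only
  once they are known to be bounded above, which the constant \<open>C\<close> provides;
  \<open>C\<close> also settles functions of norm 0, which cannot be rescaled.\<close>

lemma norm_functional_le:
  assumes \<Psi>: "bounded_functional \<sigma> \<Psi>" "fnorm \<sigma> \<Psi> = 1" and g: "g \<in> B1 \<sigma>"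
  shows "norm (\<Psi> g) \<le> L1norm g"
proof -
  obtain C where C: "\<And>f. f \<in> B1 \<sigma> \<Longrightarrow> norm (\<Psi> f) \<le> C * L1norm f"
    using \<Psi> unfolding bounded_functional_def by blast
  show ?thesis
  proof (cases "L1norm g = 0")
    case True
    then show ?thesis using C[OF g] by simp
  next
    case False
    then have pos: "L1norm g > 0" using L1norm_nonneg[of g] by simp
    let ?g = "\<lambda>x. of_real (1 / L1norm g) * g x"
    have "norm (\<Psi> h) \<le> \<bar>C\<bar>" if "h \<in> DB1 \<sigma>" for h
    proof -
      have "norm (\<Psi> h) \<le> C * L1norm h" using that C by (simp add: DB1_def)
      also have "\<dots> \<le> \<bar>C\<bar> * 1"
        using that L1norm_nonneg[of h] by (intro mult_mono) (auto simp: DB1_def)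
      finally show ?thesis by simp
    qed
    then have "bdd_above ((\<lambda>f. norm (\<Psi> f)) ` DB1 \<sigma>)"
      by (auto simp: bdd_above_def)
    moreover have "?g \<in> DB1 \<sigma>"
      using B1_cmult[OF g, of "of_real (1 / L1norm g)"] pos
      unfolding DB1_def mem_Collect_eq L1norm_cmult by (simp add: norm_divide)
    ultimately have "norm (\<Psi> ?g) \<le> 1"
      unfolding \<Psi>(2)[symmetric] fnorm_def by (intro cSUP_upper)
    then show ?thesis
      unfolding bounded_functional_cmult[OF \<Psi>(1) g] using pos
      by (simp add: norm_mult norm_divide field_simps)
  qed
qed

section \<open>The functional \<Phi> exposes \<open>f\<close>\<close>

context extremal_example
begin

lemma integrable_mult_sgn_f:
  fixes g :: "real \<Rightarrow> complex"
  assumes "integrable lborel g"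
  shows "integrable lborel (\<lambda>x. g x * of_real (sgn_f x))"
proof (rule Bochner_Integration.integrable_bound[OF assms])
  note [measurable] = borel_measurable_integrable[OF assms]
  show "(\<lambda>x. g x * complex_of_real (sgn_f x)) \<in> borel_measurable lborel" by measurable
qed (auto simp: norm_mult sgn_f_def sgn_if)

lemma norm_\<Phi>_le:
  assumes "integrable lborel g"
  shows "norm (\<Phi> g) \<le> L1norm g"
  unfolding \<Phi>_def L1norm_def
  by (rule order_trans[OF integral_norm_bound], rule integral_mono_AE')
    (use assms in \<open>auto simp: norm_mult sgn_f_def sgn_if\<close>)

lemma bounded_functional_\<Phi>: "bounded_functional \<sigma> \<Phi>"
  unfolding bounded_functional_def
proof (intro conjI ballI allI)
  fix g h :: "real \<Rightarrow> complex" and a b :: complex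
  assume g: "g \<in> B1 \<sigma>" and h: "h \<in> B1 \<sigma>"
  have "\<Phi> (\<lambda>x. a * g x + b * h x) = (LINT x|lborel. a * (g x * of_real (sgn_f x)) + b * (h x * of_real (sgn_f x)))"
    unfolding \<Phi>_def by (simp add: algebra_simps)
  also have "\<dots> = (LINT x|lborel. a * (g x * of_real (sgn_f x))) + (LINT x|lborel. b * (h x * of_real (sgn_f x)))"
    by (intro Bochner_Integration.integral_add integrable_mult_right integrable_mult_sgn_f B1_integrable[OF g] B1_integrable[OF h])
  finally show "\<Phi> (\<lambda>x. a * g x + b * h x) = a * \<Phi> g + b * \<Phi> h"
    by (simp add: \<Phi>_def)
next
  show "\<exists>C. \<forall>f\<in>B1 \<sigma>. norm (\<Phi> f) \<le> C * L1norm f"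
    using norm_\<Phi>_le by (intro exI[of _ 1]) (auto simp: B1_integrable)
qed

lemma \<Phi>_f: "\<Phi> f = 1"
proof -
  have "f x * of_real (sgn_f x) = of_real (norm (f x))" for x
  proof -
    have r: "f x = of_real (Re (f x))" by (simp add: example_fn_def)
    show ?thesis
      unfolding sgn_f_def by (subst (1 3) r, unfold norm_of_real) (simp add: sgn_if abs_if flip: of_real_mult)
  qed
  then have "\<Phi> f = of_real (L1norm f)"
    unfolding \<Phi>_def L1norm_def by simp
  then show ?thesis by (simp add: norm1)
qed

lemma fnorm_\<Phi>: "fnorm \<sigma> \<Phi> = 1"
proof -
  have le: "norm (\<Phi> g) \<le> 1" if "g \<in> DB1 \<sigma>" for g
    using norm_\<Phi>_le[of g] that by (auto simp: DB1_def B1_def)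
  show ?thesis
    unfolding fnorm_def
  proof (rule antisym)
    show "(SUP g\<in>DB1 \<sigma>. norm (\<Phi> g)) \<le> 1"
      using le f_in_DB1 by (intro cSUP_least) auto
    have "norm (\<Phi> f) \<le> (SUP g\<in>DB1 \<sigma>. norm (\<Phi> g))"
      using le f_in_DB1 by (intro cSUP_upper) (auto simp: bdd_above_def)
    then show "1 \<le> (SUP g\<in>DB1 \<sigma>. norm (\<Phi> g))" by (simp add: \<Phi>_f)
  qed
qed

lemma two_pi_div_\<sigma>: "2 * pi / \<sigma> = 6 * \<beta>"
  using \<sigma> by (simp add: \<beta>_def field_simps)

lemma sgn_Re_f:
  assumes "\<beta> < \<bar>x\<bar>"
  shows "sgn (Re (f x)) = sgn (2 * cos (\<sigma> * x) - 1)"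
proof -
  have "x \<notin> {-\<beta>..\<beta>}" using assms by auto
  then show ?thesis using sgn_f_eq[of x] assms by (simp add: sgn_f_def)
qed

lemma bl_rep_f_eq:
  assumes "\<beta> < \<bar>x\<bar>"
  shows "bl_rep f x = f x"
proof (rule bl_rep_f)
  have "3 * \<sigma> * \<beta> = pi" using \<sigma> by (simp add: \<beta>_def)
  then have "(3 * \<sigma> * x)\<^sup>2 = pi\<^sup>2 \<longleftrightarrow> (3 * \<sigma> * x)\<^sup>2 = (3 * \<sigma> * \<beta>)\<^sup>2" by simp
  also have "\<dots> \<longleftrightarrow> x\<^sup>2 = \<beta>\<^sup>2" using \<sigma> by (simp add: power_mult_distrib)
  finally show "(3 * \<sigma> * x)\<^sup>2 \<noteq> pi\<^sup>2"
    using assms \<beta>_pos by (auto simp: power2_eq_iff)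
qed

text \<open>A nonzero multiple of the period \<open>6 * \<beta>\<close> has modulus at least
  \<open>6 * \<beta>\<close>; taking off \<beta> and \<open>\<bar>\<eta>\<bar>\<close> leaves more
  than \<open>4 * \<beta>\<close>. So the formula for the sign outside
  \<open>{-\<beta>..\<beta>}\<close> holds near these points.\<close>

lemma far_from_origin:
  assumes "e \<in> {1, -1::int}" "n \<noteq> (0::int)" "\<bar>\<eta>\<bar> < \<beta>"
  shows "\<beta> < \<bar>e * \<beta> + n * (2 * pi / \<sigma>) + \<eta>\<bar>"
proof -
  have "1 \<le> \<bar>n\<bar>" using assms(2) by linarith
  then have "1 * (6 * \<beta>) \<le> of_int \<bar>n\<bar> * (6 * \<beta>)"
    using \<beta>_pos by (intro mult_right_mono) auto
  then have "6 * \<beta> \<le> \<bar>of_int n * (6 * \<beta>)\<bar>"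
    using \<beta>_pos by (simp add: abs_mult)
  moreover have "\<bar>of_int e * \<beta>\<bar> = \<beta>" using assms(1) \<beta>_pos by auto
  ultimately show ?thesis
    unfolding two_pi_div_\<sigma> using assms(3) by linarith
qed

text \<open>The factor \<open>e\<close> on \<eta> lets evenness of the cosine map the neighbourhoods
  of both families of points onto that of \<beta>, with the same orientation.\<close>

lemma cos_shift:
  fixes n :: int
  assumes "e \<in> {1, -1::int}"
  shows "cos (\<sigma> * (e * \<beta> + n * (2 * pi / \<sigma>) + of_int e * \<eta>)) = cos (\<sigma> * (\<beta> + \<eta>))"
proof -
  have "\<sigma> * (e * \<beta> + n * (2 * pi / \<sigma>) + e * \<eta>) = e * (\<sigma> * (\<beta> + \<eta>)) + 2 * pi * n"
    using \<sigma> by (simp add: field_simps)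
  then have "cos (\<sigma> * (e * \<beta> + n * (2 * pi / \<sigma>) + e * \<eta>)) = cos (e * (\<sigma> * (\<beta> + \<eta>)))"
    using cos_int_2pin[of n] sin_int_2pin[of n] by (simp add: cos_add)
  also have "\<dots> = cos (\<sigma> * (\<beta> + \<eta>))"
    using assms by (auto simp del: distrib_left)
  finally show ?thesis .
qed

text \<open>Next to the point, \<open>h\<close> is nonnegative on the side where \<open>f > 0\<close> and nonpositive on the other.\<close>

lemma same_sign_imp_zero:
  assumes cont: "continuous_on UNIV h" and AE: "AE x in lborel. norm (h x) = Re (h x) * sgn_f x"
    and e: "e \<in> {1, -1::int}" and n: "n \<noteq> (0::int)"
  shows "h (e * \<beta> + n * (2 * pi / \<sigma>)) = 0"
proof -
  define x0 where "x0 = e * \<beta> + n * (2 * pi / \<sigma>)"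
  let ?F = "bl_rep f"
  \<comment> \<open>\<open>sgn_f\<close> is discontinuous; multiplying the condition by the modulus
    of the continuous \<open>Re (?F x)\<close> makes it a closed one, which then holds
    everywhere.\<close>
  let ?C = "{x. norm (h x) * \<bar>Re (?F x)\<bar> = Re (h x) * Re (?F x)}"
  have "closed ?C"
    by (intro closed_Collect_eq continuous_intros cont continuous_on_bl_rep[OF f_in_B1])
  moreover have "AE x in lborel. x \<in> ?C"
    using AE AE_eq_bl_rep[OF f_in_B1]
  proof eventually_elim
    case (elim x)
    have "sgn_f x * \<bar>Re (f x)\<bar> = Re (f x)" by (simp add: sgn_f_def sgn_if)
    then have "Re (h x) * sgn_f x * \<bar>Re (f x)\<bar> = Re (h x) * Re (f x)" by (simp only: mult.assoc)
    then show ?case using elim by simp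
  qed
  ultimately have C: "norm (h x) * \<bar>Re (?F x)\<bar> = Re (h x) * Re (?F x)" for x
    using mem_closed_if_AE_lebesgue[of ?C x] AE_completion by blast
  have ef: "\<bar>of_int e * \<eta>\<bar> = \<bar>\<eta>\<bar>" for \<eta> :: real using e by auto
  have sgn_at: "sgn (Re (?F (x0 + e * \<eta>))) = sgn (2 * cos (\<sigma> * (\<beta> + \<eta>)) - 1)" if "\<bar>\<eta>\<bar> < \<beta>" for \<eta> :: real
  proof -
    have far: "\<beta> < \<bar>x0 + e * \<eta>\<bar>"
      unfolding x0_def using e n that by (intro far_from_origin) (auto simp: ef)
    then have "sgn (Re (?F (x0 + e * \<eta>))) = sgn (2 * cos (\<sigma> * (x0 + e * \<eta>)) - 1)"
      by (simp add: bl_rep_f_eq sgn_Re_f)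
    then show ?thesis
      unfolding x0_def cos_shift[OF e] .
  qed
  \<comment> \<open>The denominator \<open>k + 2\<close> keeps the step strictly below \<beta> for
    every \<open>k\<close>.\<close>
  define \<eta> where "\<eta> k = \<beta> / real (k + 2)" for k
  have \<eta>: "0 < \<eta> k" "\<eta> k < \<beta>" for k
    using \<beta>_pos by (auto simp: \<eta>_def field_simps intro!: add_pos_nonneg)
  have "\<eta> \<longlonglongrightarrow> 0"
    unfolding \<eta>_def by (rule LIMSEQ_ignore_initial_segment[OF lim_const_over_n])
  then have lim: "(\<lambda>k. x0 + e * (c * \<eta> k)) \<longlonglongrightarrow> x0 + of_int e * (c * 0)" for c :: real
    by (intro tendsto_intros)
  have isc: "isCont h x" for x
    using cont by (simp add: continuous_on_eq_continuous_at)
  have lims: "(\<lambda>k. norm (h (x0 + e * (c * \<eta> k)))) \<longlonglongrightarrow> norm (h x0)"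
    "(\<lambda>k. Re (h (x0 + e * (c * \<eta> k)))) \<longlonglongrightarrow> Re (h x0)" for c
    using isCont_tendsto_compose[OF isc, OF lim[of c]] by (auto intro!: tendsto_intros)
  have T: "\<beta> \<le> pi / \<sigma> / 2" using \<sigma> by (simp add: \<beta>_def field_simps)
  have right: "norm (h (x0 + e * (1 * \<eta> k))) = - Re (h (x0 + e * (1 * \<eta> k)))" for k
  proof -
    have "2 * cos (\<sigma> * (\<beta> + \<eta> k)) - 1 < 0"
      using \<eta>[of k] \<beta>_pos T by (intro cos_gt_half(2)) auto
    then have "Re (?F (x0 + e * (1 * \<eta> k))) < 0"
      using sgn_at[of "\<eta> k"] \<eta>[of k] by (simp add: sgn_if split: if_splits)
    moreover from this have "(norm (h (x0 + e * (1 * \<eta> k))) + Re (h (x0 + e * (1 * \<eta> k)))) * Re (?F (x0 + e * (1 * \<eta> k))) = 0"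
      using C[of "x0 + e * (1 * \<eta> k)"] by (simp add: algebra_simps)
    ultimately show ?thesis by simp
  qed
  have left: "norm (h (x0 + e * ((-1) * \<eta> k))) = Re (h (x0 + e * ((-1) * \<eta> k)))" for k
  proof -
    have "2 * cos (\<sigma> * (\<beta> + (- 1) * \<eta> k)) - 1 > 0"
      using \<eta>[of k] \<beta>_pos T by (intro cos_gt_half(1)) auto
    then have "Re (?F (x0 + e * ((-1) * \<eta> k))) > 0"
      using sgn_at[of "(-1) * \<eta> k"] \<eta>[of k] by (simp add: sgn_if split: if_splits)
    then show ?thesis using C[of "x0 + e * ((-1) * \<eta> k)"] by simp
  qed
  have "norm (h x0) = - Re (h x0)"
    using LIMSEQ_unique[OF lims(1)[of 1, unfolded right] tendsto_minus[OF lims(2)[of 1]]] .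
  moreover have "norm (h x0) = Re (h x0)"
    using LIMSEQ_unique[OF lims(1)[of "-1", unfolded left] lims(2)[of "-1"]] .
  ultimately show ?thesis by (simp add: x0_def)
qed

lemma \<Phi>_exposes:
  assumes g: "g \<in> DB1 \<sigma>" and ge: "Re (\<Phi> g) \<ge> 1"
  shows "AE x in lborel. g x = f x"
proof -
  have gB: "g \<in> B1 \<sigma>" and gn: "L1norm g \<le> 1" using g by (auto simp: DB1_def)
  note gi = B1_integrable[OF gB]
  note [measurable] = borel_measurable_integrable[OF gi]
  \<comment> \<open>The integrand is nonnegative and its integral
    \<open>L1norm g - Re (\<Phi> g)\<close> is at most 0.\<close>
  have "AE x in lborel. norm (g x) - Re (g x * of_real (sgn_f x)) = 0"
  proof -
    have int: "integrable lborel (\<lambda>x. norm (g x) - Re (g x * of_real (sgn_f x)))"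
      by (intro Bochner_Integration.integrable_diff integrable_norm integrable_Re integrable_mult_sgn_f gi)
    have nn: "0 \<le> norm (g x) - Re (g x * of_real (sgn_f x))" for x
      using complex_Re_le_cmod[of "g x * of_real (sgn_f x)"]
      by (auto simp: norm_mult sgn_f_def sgn_if split: if_splits)
    have "(LINT x|lborel. norm (g x) - Re (g x * of_real (sgn_f x))) = L1norm g - Re (\<Phi> g)"
      unfolding L1norm_def \<Phi>_def
      by (simp only: Bochner_Integration.integral_diff[OF integrable_norm[OF gi] integrable_Re[OF integrable_mult_sgn_f[OF gi]]]
          integral_Re[OF integrable_mult_sgn_f[OF gi]])
    moreover have "0 \<le> (LINT x|lborel. norm (g x) - Re (g x * of_real (sgn_f x)))"
      by (intro Bochner_Integration.integral_nonneg nn)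
    ultimately have "(LINT x|lborel. norm (g x) - Re (g x * of_real (sgn_f x))) = 0"
      using ge gn by linarith
    then show ?thesis
      using integral_nonneg_eq_0_iff_AE[OF int] nn by simp
  qed
  then have AE: "AE x in lborel. norm (bl_rep g x) = Re (bl_rep g x) * sgn_f x"
    using AE_eq_bl_rep[OF gB] by eventually_elim simp
  note h0 = same_sign_imp_zero[OF continuous_on_bl_rep[OF gB] AE]
  \<comment> \<open>This choice makes the difference \<open>d\<close> of the transforms vanish at 0,
    as the interpolation lemma requires.\<close>
  define c where "c = fourier g 0 / fourier f 0"
  define d where "d t = fourier g t - c * fourier f t" for t
  have "d t = 0" for t
  proof (rule two_shift_interpolation_unique[OF \<sigma>])
    show "continuous_on UNIV d"
      unfolding d_def by (intro continuous_intros continuous_on_fourier gi integrable_f)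
    show "d t = 0" if "\<sigma> \<le> \<bar>t\<bar>" for t
      using fourier_B1_eq_0[OF gB that \<sigma>] fourier_B1_eq_0[OF f_in_B1 that \<sigma>] by (simp add: d_def)
    show "d 0 = 0" using fourier_f_0 by (simp add: d_def c_def)
    \<comment> \<open>At these points \<open>f\<close> vanishes by its formula and \<open>g\<close>
      by the sign condition, so the inversion integral of \<open>d\<close> vanishes too.\<close>
    fix e n :: int assume e: "e \<in> {1, -1}" and n: "n \<noteq> 0"
    define x0 where "x0 = e * \<beta> + n * (2 * pi / \<sigma>)"
    have far: "\<beta> < \<bar>x0\<bar>" using far_from_origin[OF e n, of 0] \<beta>_pos by (simp add: x0_def)
    have "cos (\<sigma> * x0) = 1 / 2"
      using cos_shift[OF e, of n 0] \<sigma>\<beta> cos_60 by (simp add: x0_def)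
    then have "2 * cos (\<sigma> * x0) - 1 = 0" by simp
    then have "bl_rep f x0 = 0"
      unfolding bl_rep_f_eq[OF far] example_fn_def by (simp only:) simp
    moreover have "bl_rep g x0 = 0" using h0[OF e n] by (simp add: x0_def)
    ultimately have "fourier (fourier g) (- x0) = 0" "fourier (fourier f) (- x0) = 0"
      by (auto simp: bl_rep_def)
    moreover have "(LINT t|lborel. d t * cis (t * x0)) = fourier (fourier g) (- x0) - c * fourier (fourier f) (- x0)"
    proof -
      have "(LINT t|lborel. d t * cis (t * x0)) =
        (LINT t|lborel. fourier g t * cis (- (- x0 * t)) - c * (fourier f t * cis (- (- x0 * t))))"
        by (intro Bochner_Integration.integral_cong) (auto simp: d_def algebra_simps)
      also have "\<dots> = (LINT t|lborel. fourier g t * cis (- (- x0 * t))) - (LINT t|lborel. c * (fourier f t * cis (- (- x0 * t))))"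
        by (intro Bochner_Integration.integral_diff integrable_mult_right fourier_integrable
            integrable_fourier_B1[OF gB] integrable_fourier_B1[OF f_in_B1])
      finally show ?thesis unfolding fourier_def[of "fourier g"] fourier_def[of "fourier f"] by (simp only: integral_mult_right_zero)
    qed
    ultimately show "(LINT t|lborel. d t * cis (t * (e * (pi / (3 * \<sigma>)) + n * (2 * pi / \<sigma>)))) = 0"
      unfolding x0_def \<beta>_def by simp
  qed
  then have "fourier g = (\<lambda>t. c * fourier f t)" by (simp add: d_def fun_eq_iff)
  then have bl: "bl_rep g x = c * bl_rep f x" for x
    by (simp add: bl_rep_def fourier_cmult)
  have eq: "AE x in lborel. g x = c * f x"
    using AE_eq_bl_rep[OF gB] AE_eq_bl_rep[OF f_in_B1] by eventually_elim (simp add: bl)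
  have "\<Phi> g = c"
    using bounded_functional_cong_AE[OF bounded_functional_\<Phi> gB B1_cmult[OF f_in_B1] eq]
      bounded_functional_cmult[OF bounded_functional_\<Phi> f_in_B1, of c] \<Phi>_f by simp
  then have "Re c \<ge> 1" using ge by simp
  moreover have "norm c \<le> 1"
    using L1norm_cong_AE[OF eq] gn norm1 by (simp add: L1norm_cmult)
  ultimately have "Re c = 1" "norm c = 1"
    using complex_Re_le_cmod[of c] by linarith+
  then have "c = 1"
    using cmod_power2[of c] by (simp add: complex_eq_iff)
  then show ?thesis using eq by simp
qed

lemma exposing_\<Phi>: "exposing \<sigma> f \<Phi>"
  unfolding exposing_def using bounded_functional_\<Phi> \<Phi>_f fnorm_\<Phi> \<Phi>_exposes by force

end

section \<open>Compactness and weak* convergence\<close>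

lemma C0_bounded:
  assumes "u \<in> C0"
  obtains U where "U > 0" "\<And>x. norm (u x) \<le> U"
proof -
  have "eventually (\<lambda>x. dist (u x) 0 < 1) at_infinity"
    using assms by (intro tendstoD) (auto simp: C0_def)
  then obtain R where R: "\<And>x. R \<le> norm x \<Longrightarrow> norm (u x) < 1"
    by (auto simp: eventually_at_infinity)
  have "compact (u ` cball 0 R)"
    using assms continuous_on_subset[of UNIV u "cball 0 R"]
    by (intro compact_continuous_image) (auto simp: C0_def)
  then have "bounded (u ` cball 0 R)" by (rule compact_imp_bounded)
  then obtain B where B: "\<forall>y\<in>u ` cball 0 R. norm y \<le> B"
    unfolding bounded_iff by blast
  have "norm (u x) \<le> max B 1" for x
  proof (cases "R \<le> norm x")
    case True
    then show ?thesis using R[of x] by linarith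
  next
    case False
    then have "u x \<in> u ` cball 0 R" by (intro imageI) simp
    then have "norm (u x) \<le> B" using B by blast
    then show ?thesis by simp
  qed
  then show ?thesis by (rule that[rotated]) simp
qed

lemma measurable_C0: "u \<in> C0 \<Longrightarrow> u \<in> borel_measurable borel"
  by (intro borel_measurable_continuous_onI) (simp add: C0_def)

lemma integrable_mult_C0:
  assumes f: "integrable lborel f" and u: "u \<in> C0"
  shows "integrable lborel (\<lambda>x. f x * u x)"
proof -
  obtain U where U: "U > 0" "\<And>x. norm (u x) \<le> U" using C0_bounded[OF u] by blast
  note [measurable] = measurable_C0[OF u] borel_measurable_integrable[OF f]
  show ?thesis
  proof (rule Bochner_Integration.integrable_bound[OF integrable_mult_right[OF f, of "of_real U"]])
    have "norm (f x) * norm (u x) \<le> norm (f x) * U" for x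
      by (intro mult_left_mono U(2)) simp
    then show "AE x in lborel. norm (f x * u x) \<le> norm (of_real U * f x)"
      using U(1) by (intro AE_I2) (simp add: norm_mult mult.commute)
  qed measurable
qed

text \<open>Far out \<open>u\<close> is small and the L1 norms are at most 1, so the tails are
  uniformly small. On the remaining bounded interval the uniform bound \<open>C\<close> permits
  dominated convergence.\<close>

lemma integral_mult_C0_tendsto:
  fixes F :: "nat \<Rightarrow> real \<Rightarrow> complex"
  assumes F: "\<And>n. integrable lborel (F n)" "\<And>n. L1norm (F n) \<le> 1" "\<And>n. AE x in lborel. norm (F n x) \<le> C"
    and g: "integrable lborel g" "L1norm g \<le> 1"
    and lim: "AE x in lborel. (\<lambda>n. F n x) \<longlonglongrightarrow> g x" and u: "u \<in> C0"
  shows "(\<lambda>n. LINT x|lborel. F n x * u x) \<longlonglongrightarrow> (LINT x|lborel. g x * u x)"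
proof (rule LIMSEQ_I)
  fix e :: real assume e: "e > 0"
  note [measurable] = measurable_C0[OF u] borel_measurable_integrable[OF F(1)] borel_measurable_integrable[OF g(1)]
  have "eventually (\<lambda>x. dist (u x) 0 < e / 4) at_infinity"
    using u e by (intro tendstoD) (auto simp: C0_def)
  then obtain R where R: "\<And>x. R \<le> \<bar>x\<bar> \<Longrightarrow> norm (u x) < e / 4"
    by (auto simp: eventually_at_infinity)
  let ?I = "indicator {-R..R} :: real \<Rightarrow> real"
  have ui: "integrable lborel (\<lambda>x. ?I x *\<^sub>R u x)"
    using u by (intro integrable_indicator_continuous) (auto simp: C0_def)
  have tail: "norm ((LINT x|lborel. k x * u x) - (LINT x|lborel. k x * (?I x *\<^sub>R u x))) \<le> e / 4"
    if k: "integrable lborel k" "L1norm k \<le> 1" for k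
  proof -
    note [measurable] = borel_measurable_integrable[OF k(1)]
    have i1: "integrable lborel (\<lambda>x. k x * u x)" by (rule integrable_mult_C0[OF k(1) u])
    have i2: "integrable lborel (\<lambda>x. k x * (?I x *\<^sub>R u x))"
      by (rule Bochner_Integration.integrable_bound[OF i1]) (auto simp: indicator_def norm_mult)
    have "(LINT x|lborel. k x * u x) - (LINT x|lborel. k x * (?I x *\<^sub>R u x)) =
          (LINT x|lborel. k x * u x - k x * (?I x *\<^sub>R u x))"
      by (rule Bochner_Integration.integral_diff[symmetric, OF i1 i2])
    also have "norm \<dots> \<le> (LINT x|lborel. norm (k x * u x - k x * (?I x *\<^sub>R u x)))"
      by (rule integral_norm_bound)
    also have "\<dots> \<le> (LINT x|lborel. norm (k x) * (e / 4))"
    proof (rule integral_mono_AE')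
      show "AE x in lborel. norm (k x * u x - k x * (?I x *\<^sub>R u x)) \<le> norm (k x) * (e / 4)"
      proof (rule AE_I2)
        fix x
        show "norm (k x * u x - k x * (?I x *\<^sub>R u x)) \<le> norm (k x) * (e / 4)"
        proof (cases "x \<in> {-R..R}")
          case True
          then show ?thesis using e by simp
        next
          case False
          then have "norm (u x) \<le> e / 4" using R[of x] by (cases "R \<le> \<bar>x\<bar>") (auto simp: abs_le_iff)
          then have "norm (k x) * norm (u x) \<le> norm (k x) * (e / 4)" by (intro mult_left_mono) auto
          then show ?thesis using False by (simp add: norm_mult)
        qed
      qed
    qed (use k(1) e in auto)
    also have "\<dots> = L1norm k * (e / 4)" by (simp add: L1norm_def)
    also have "\<dots> \<le> 1 * (e / 4)" using k e by (intro mult_right_mono) auto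
    finally show ?thesis by simp
  qed
  have "(\<lambda>n. LINT x|lborel. F n x * (?I x *\<^sub>R u x)) \<longlonglongrightarrow> (LINT x|lborel. g x * (?I x *\<^sub>R u x))"
  proof (rule integral_dominated_convergence[where w = "\<lambda>x. C * norm (?I x *\<^sub>R u x)"])
    show "AE x in lborel. (\<lambda>n. F n x * (?I x *\<^sub>R u x)) \<longlonglongrightarrow> g x * (?I x *\<^sub>R u x)"
      using lim by eventually_elim (intro tendsto_intros)
    show "AE x in lborel. norm (F n x * (?I x *\<^sub>R u x)) \<le> C * norm (?I x *\<^sub>R u x)" for n
      using F(3)[of n] by eventually_elim (unfold norm_mult, rule mult_right_mono, assumption, rule norm_ge_zero)
    show "integrable lborel (\<lambda>x. C * norm (?I x *\<^sub>R u x))"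
      by (intro integrable_mult_right integrable_norm ui)
  qed measurable
  from LIMSEQ_D[OF this, of "e / 4"] e obtain N where N: "\<And>n. n \<ge> N \<Longrightarrow>
      norm ((LINT x|lborel. F n x * (?I x *\<^sub>R u x)) - (LINT x|lborel. g x * (?I x *\<^sub>R u x))) < e / 4"
    by auto
  have "norm ((LINT x|lborel. F n x * u x) - (LINT x|lborel. g x * u x)) < e" if "n \<ge> N" for n
  proof -
    have "norm (a - b) \<le> norm (a - a') + norm (a' - b') + norm (b - b')" for a b a' b' :: complex
      using norm_triangle_ineq[of "a - a'" "a' - b"] norm_triangle_ineq[of "a' - b'" "b' - b"]
      by (simp add: norm_minus_commute)
    from this[of "LINT x|lborel. F n x * u x" "LINT x|lborel. g x * u x"
        "LINT x|lborel. F n x * (?I x *\<^sub>R u x)" "LINT x|lborel. g x * (?I x *\<^sub>R u x)"]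
    show ?thesis
      using tail[OF F(1) F(2), of n] tail[OF g(1) g(2)] N[OF that] e by linarith
  qed
  then show "\<exists>no. \<forall>n\<ge>no. norm ((LINT x|lborel. F n x * u x) - (LINT x|lborel. g x * u x)) < e"
    by blast
qed

lemma AE_norm_DB1_le:
  assumes "g \<in> DB1 \<sigma>" "0 < \<sigma>"
  shows "AE x in lborel. norm (g x) \<le> \<sigma>"
proof -
  have g: "g \<in> B1 \<sigma>" "L1norm g \<le> 1" using assms by (auto simp: DB1_def)
  have "\<sigma> * L1norm g \<le> \<sigma> * 1"
    using g(2) assms(2) by (intro mult_left_mono) auto
  then have "norm (bl_rep g x) \<le> \<sigma>" for x
    using bl_rep_bound[OF g(1) assms(2), of x] by simp
  then show ?thesis
    using AE_eq_bl_rep[OF g(1)] by (auto elim: eventually_mono)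
qed

text \<open>The explicit transform decays like \<open>2 / \<bar>x\<bar>\<close>. This makes it an
  admissible test function for detecting the spectrum of a weak limit.\<close>

lemma fourier_indicator_in_C0:
  assumes "a \<le> b"
  shows "fourier (\<lambda>t. of_real (indicator {a<..b} t)) \<in> C0"
proof -
  have int: "integrable lborel (\<lambda>t. complex_of_real (indicator {a<..b} t))"
    using assms by auto
  have "fourier (\<lambda>t. of_real (indicator {a<..b} t)) = fourier (\<lambda>t. of_real (indicator {a..b} t))"
    by (rule fourier_cong_AE)
      (use AE_lborel_singleton[of a] in \<open>auto elim!: eventually_mono simp: indicator_def\<close>)
  then have formula: "fourier (\<lambda>t. of_real (indicator {a<..b} t)) x = (cis (- (x * b)) - cis (- (x * a))) / (- \<i> * x)"
    if "x \<noteq> 0" for x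
  proof -
    let ?G = "\<lambda>t. cis (- (x * t)) / (- \<i> * x)"
    have "has_bochner_integral lborel (\<lambda>t. indicator {a..b} t *\<^sub>R cis (- (x * t))) (?G b - ?G a)"
    proof (rule has_bochner_integral_FTC_Icc[OF assms])
      fix t
      have "((\<lambda>t. cis (- (x * t))) has_vector_derivative ((- x) *\<^sub>R (\<i> * cis (- (x * t))))) (at t within {a..b})"
        unfolding has_vector_derivative_def by (auto intro!: derivative_eq_intros simp: fun_eq_iff)
      from has_vector_derivative_divide[OF this, of "- \<i> * x"]
      show "(?G has_vector_derivative cis (- (x * t))) (at t within {a..b})"
        using that by (simp add: scaleR_conv_of_real)
    qed (auto intro!: continuous_intros)
    then show ?thesis
      using \<open>fourier _ = fourier _\<close>
      by (simp add: fourier_def has_bochner_integral_iff scaleR_conv_of_real diff_divide_distrib)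
  qed
  have "(fourier (\<lambda>t. of_real (indicator {a<..b} t)) \<longlongrightarrow> 0) at_infinity"
  proof (rule tendsto_norm_zero_cancel, rule tendsto_sandwich)
    show "eventually (\<lambda>x::real. 0 \<le> norm (fourier (\<lambda>t. of_real (indicator {a<..b} t)) x)) at_infinity" by simp
    show "eventually (\<lambda>x. norm (fourier (\<lambda>t. of_real (indicator {a<..b} t)) x) \<le> 2 * norm (inverse x)) at_infinity"
      unfolding eventually_at_infinity
    proof (intro exI[of _ 1] allI impI)
      fix x :: real assume "1 \<le> norm x"
      then have x: "x \<noteq> 0" by auto
      have "norm (cis (- (x * b)) - cis (- (x * a))) \<le> 2"
        using norm_triangle_ineq4[of "cis (- (x * b))" "cis (- (x * a))"] by simp
      then show "norm (fourier (\<lambda>t. of_real (indicator {a<..b} t)) x) \<le> 2 * norm (inverse x)"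
        unfolding formula[OF x] using x
        by (simp add: norm_divide norm_mult inverse_eq_divide divide_right_mono)
    qed
    show "((\<lambda>x::real. 2 * norm (inverse x)) \<longlongrightarrow> 0) at_infinity"
      using tendsto_mult_right_zero[OF tendsto_norm_zero[OF tendsto_inverse_0], of 2] .
  qed simp
  then show ?thesis
    using continuous_on_fourier[OF int] by (simp add: C0_def)
qed

text \<open>By the multiplication formula, the integral of \<open>fourier (F n)\<close> over an
  interval is a pairing of \<open>F n\<close> with an element of \<open>C0\<close>. Off the band
  these pairings are 0 and so is their limit; continuity of \<open>fourier g\<close> does the
  rest.\<close>

lemma B1_closed_under_weak_limits:
  assumes F: "\<And>n. F n \<in> B1 \<sigma>" and g: "integrable lborel g"
    and lim: "\<And>u. u \<in> C0 \<Longrightarrow> (\<lambda>n. LINT x|lborel. F n x * u x) \<longlonglongrightarrow> (LINT x|lborel. g x * u x)"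
  shows "g \<in> B1 \<sigma>"
proof -
  have zero: "(LINT t|lborel. fourier g t * of_real (indicator {a<..b} t)) = 0"
    if "a \<le> b" "\<And>t. t \<in> {a..b} \<Longrightarrow> \<sigma> < \<bar>t\<bar>" for a b
  proof -
    let ?\<phi> = "\<lambda>t. complex_of_real (indicator {a<..b} t)"
    have int: "integrable lborel ?\<phi>" using that by auto
    have "(LINT x|lborel. F n x * fourier ?\<phi> x) = 0" for n
    proof -
      have "(LINT x|lborel. F n x * fourier ?\<phi> x) = (LINT t|lborel. fourier (F n) t * ?\<phi> t)"
        using fourier_multiplication[OF B1_integrable[OF F] int] by simp
      also have "\<dots> = (LINT t|(lborel :: real measure). 0)"
        using F[of n] that(2) by (intro Bochner_Integration.integral_cong) (auto simp: B1_def indicator_def)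
      finally show ?thesis by simp
    qed
    then have "(LINT x|lborel. g x * fourier ?\<phi> x) = 0"
      using lim[OF fourier_indicator_in_C0[OF that(1)]] by (simp add: LIMSEQ_const_iff)
    then show ?thesis using fourier_multiplication[OF g int] by simp
  qed
  have gap: "fourier g t = 0" if pq: "p < q" "\<And>t. t \<in> {p..q} \<Longrightarrow> \<sigma> < \<bar>t\<bar>" "t \<in> {p..q}" for p q t
  proof (rule continuous_eq_0_if_AE[OF continuous_on_fourier[OF g] _ pq(3,1)])
    have "AE t in lborel. indicator {p..q} t *\<^sub>R fourier g t = 0"
    proof (rule AE_eq_0_if_interval_integrals_eq_0)
      show "integrable lborel (\<lambda>t. indicator {p..q} t *\<^sub>R fourier g t)"
        by (rule integrable_indicator_continuous[OF continuous_on_fourier[OF g]])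
      fix a b :: real
      let ?a = "max a p" and ?b = "min b q"
      note [measurable] = measurable_fourier[OF g]
      have "(LINT t:{a<..b}|lborel. indicator {p..q} t *\<^sub>R fourier g t) =
            (LINT t|lborel. fourier g t * of_real (indicator {?a<..?b} t))"
        unfolding set_lebesgue_integral_def
        by (rule integral_cong_AE)
          (use AE_lborel_singleton[of p] in \<open>auto elim!: eventually_mono simp: indicator_def\<close>)
      also have "\<dots> = 0"
      proof (cases "?a \<le> ?b")
        case True
        then show ?thesis using pq(2) by (intro zero) auto
      next
        case False
        then have empty: "{?a<..?b} = {}" by auto
        show ?thesis unfolding empty by simp
      qed
      finally show "(LINT t:{a<..b}|lborel. indicator {p..q} t *\<^sub>R fourier g t) = 0" .
    qed
    then show "AE t in lborel. t \<in> {p<..<q} \<longrightarrow> fourier g t = 0"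
      by eventually_elim (auto simp: indicator_def)
  qed
  \<comment> \<open>A point off the band has a unit interval off the band on its outer side.\<close>
  have "fourier g t = 0" if "\<sigma> < \<bar>t\<bar>" for t
  proof (cases "0 \<le> t")
    case True
    then show ?thesis using that by (intro gap[of t "t + 1"]) auto
  next
    case False
    then show ?thesis using that by (intro gap[of "t - 1" t]) auto
  qed
  then show ?thesis using g by (simp add: B1_def)
qed

text \<open>An Arzela-Ascoli argument for the continuous representatives: a diagonal subsequence
  converges at the rationals by boundedness, and the common Lipschitz constant extends this to all
  points. Norm may be lost in the limit.\<close>

lemma DB1_sequentially_compact:
  assumes \<sigma>: "0 < \<sigma>" and F: "\<And>n::nat. F n \<in> DB1 \<sigma>"
  obtains r g where "strict_mono r" "g \<in> DB1 \<sigma>" "AE x in lborel. (\<lambda>n. F (r n) x) \<longlonglongrightarrow> g x"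
proof -
  have FB: "F n \<in> B1 \<sigma>" and Fn: "L1norm (F n) \<le> 1" for n using F by (auto simp: DB1_def)
  note Fi = B1_integrable[OF FB]
  define h where "h n = bl_rep (F n)" for n
  note [measurable] = borel_measurable_integrable[OF Fi]
  have hcont: "continuous_on UNIV (h n)" for n
    unfolding h_def by (rule continuous_on_bl_rep[OF FB])
  have hmeas[measurable]: "h n \<in> borel_measurable borel" for n
    by (rule borel_measurable_continuous_onI[OF hcont])
  have hF: "AE x in lborel. F n x = h n x" for n
    unfolding h_def by (rule AE_eq_bl_rep[OF FB])
  have bound: "norm (h n x) \<le> \<sigma>" for n x
  proof -
    have "\<sigma> * L1norm (F n) \<le> \<sigma> * 1" using Fn \<sigma> by (intro mult_left_mono) auto
    then show ?thesis using bl_rep_bound[OF FB \<sigma>, of n x] by (simp add: h_def)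
  qed
  have lip: "norm (h n x - h n y) \<le> \<sigma>\<^sup>2 * \<bar>x - y\<bar>" for n x y
  proof -
    have "\<sigma>\<^sup>2 * L1norm (F n) * \<bar>x - y\<bar> \<le> \<sigma>\<^sup>2 * 1 * \<bar>x - y\<bar>"
      using Fn \<sigma> by (intro mult_left_mono mult_right_mono) auto
    then show ?thesis using bl_rep_lipschitz[OF FB \<sigma>, of n x y] by (simp add: h_def)
  qed
  obtain r where r: "strict_mono r" and rat: "\<And>q. q \<in> \<rat> \<Longrightarrow> \<exists>l. (\<lambda>n. h (r n) q) \<longlonglongrightarrow> l"
    using function_convergent_subsequence[OF countable_rat, of h \<sigma>] bound by blast
  have "Cauchy (\<lambda>n. h (r n) x)" for x
  proof (rule CauchyI)
    fix e :: real assume e: "e > 0"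
    define \<delta> where "\<delta> = e / (3 * (\<sigma>\<^sup>2 + 1))"
    have \<sigma>2: "\<sigma>\<^sup>2 + 1 > 0" by (simp add: add_nonneg_pos)
    have \<delta>: "\<delta> > 0" using e \<sigma>2 by (simp add: \<delta>_def)
    obtain q where q: "q \<in> \<rat>" "x < q" "q < x + \<delta>"
      using Rats_dense_in_real[of x "x + \<delta>"] \<delta> by auto
    have "\<sigma>\<^sup>2 * \<bar>x - q\<bar> \<le> (\<sigma>\<^sup>2 + 1) * \<delta>"
      using q by (intro mult_mono) auto
    also have "\<dots> = e / 3"
    proof -
      have "c * (e / (3 * c)) = e / 3" if "c > 0" for c :: real using that by simp
      from this[OF \<sigma>2] show ?thesis by (simp only: \<delta>_def)
    qed
    finally have near: "norm (h n x - h n q) \<le> e / 3" for n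
      using lip[of n x q] by linarith
    have "Cauchy (\<lambda>n. h (r n) q)"
      using rat[OF q(1)] LIMSEQ_imp_Cauchy by blast
    from CauchyD[OF this, of "e / 3"] e obtain M
      where M: "\<And>m n. m \<ge> M \<Longrightarrow> n \<ge> M \<Longrightarrow> norm (h (r m) q - h (r n) q) < e / 3" by auto
    have "norm (h (r m) x - h (r n) x) < e" if "m \<ge> M" "n \<ge> M" for m n
    proof -
      have "norm (a - b) \<le> norm (a - a') + norm (a' - b') + norm (b - b')" for a b a' b' :: complex
        using norm_triangle_ineq[of "a - a'" "a' - b"] norm_triangle_ineq[of "a' - b'" "b' - b"]
        by (simp add: norm_minus_commute)
      from this[of "h (r m) x" "h (r n) x" "h (r m) q" "h (r n) q"] show ?thesis
        using M[OF that] near[of "r m"] near[of "r n"] by linarith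
    qed
    then show "\<exists>M. \<forall>m\<ge>M. \<forall>n\<ge>M. norm (h (r m) x - h (r n) x) < e" by blast
  qed
  then have "\<exists>l. (\<lambda>n. h (r n) x) \<longlonglongrightarrow> l" for x
    by (simp add: Cauchy_convergent_iff convergent_def)
  then obtain g where g: "\<And>x. (\<lambda>n. h (r n) x) \<longlonglongrightarrow> g x" by metis
  have gmeas[measurable]: "g \<in> borel_measurable borel"
    by (rule borel_measurable_LIMSEQ_metric[of "\<lambda>n. h (r n)"]) (use g in auto)
  \<comment> \<open>Fatou's lemma keeps the norm of the limit at most 1.\<close>
  have "(\<integral>\<^sup>+ x. norm (g x) \<partial>lborel) = (\<integral>\<^sup>+ x. liminf (\<lambda>n. ennreal (norm (h (r n) x))) \<partial>lborel)"
  proof (rule nn_integral_cong)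
    fix x
    have "(\<lambda>n. ennreal (norm (h (r n) x))) \<longlonglongrightarrow> ennreal (norm (g x))"
      by (intro tendsto_intros g)
    from lim_imp_Liminf[OF sequentially_bot this]
    show "ennreal (norm (g x)) = liminf (\<lambda>n. ennreal (norm (h (r n) x)))"
      by (rule sym)
  qed
  also have "\<dots> \<le> liminf (\<lambda>n. \<integral>\<^sup>+ x. ennreal (norm (h (r n) x)) \<partial>lborel)"
    by (rule nn_integral_liminf) simp
  also have "\<dots> \<le> 1"
  proof -
    have "(\<integral>\<^sup>+ x. ennreal (norm (h n x)) \<partial>lborel) \<le> 1" for n
    proof -
      have "(\<integral>\<^sup>+ x. ennreal (norm (h n x)) \<partial>lborel) = (\<integral>\<^sup>+ x. ennreal (norm (F n x)) \<partial>lborel)"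
        by (rule nn_integral_cong_AE) (use hF[of n] in \<open>auto elim: eventually_mono\<close>)
      also have "\<dots> = ennreal (L1norm (F n))"
        unfolding L1norm_def using Fi by (intro nn_integral_eq_integral) auto
      finally show ?thesis using Fn by simp
    qed
    then have "liminf (\<lambda>n. \<integral>\<^sup>+ x. ennreal (norm (h (r n) x)) \<partial>lborel) \<le> liminf (\<lambda>n. 1)"
      by (intro Liminf_mono always_eventually allI)
    then show ?thesis by (simp add: Liminf_const)
  qed
  finally have gle: "(\<integral>\<^sup>+ x. norm (g x) \<partial>lborel) \<le> 1" .
  have gi: "integrable lborel g"
    by (rule integrableI_bounded) (use gle in \<open>auto intro: le_less_trans\<close>)
  have "ennreal (L1norm g) \<le> 1"
    unfolding L1norm_def using gle gi by (subst nn_integral_eq_integral[symmetric]) auto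
  then have gn: "L1norm g \<le> 1" by simp
  have lim: "AE x in lborel. (\<lambda>n. F (r n) x) \<longlonglongrightarrow> g x"
  proof -
    have "AE x in lborel. \<forall>n. F n x = h n x"
      using hF by (simp add: AE_all_countable)
    then show ?thesis by eventually_elim (use g in simp)
  qed
  have "g \<in> B1 \<sigma>"
  proof (rule B1_closed_under_weak_limits[of "\<lambda>n. F (r n)"])
    show "(\<lambda>n. LINT x|lborel. F (r n) x * u x) \<longlonglongrightarrow> (LINT x|lborel. g x * u x)" if "u \<in> C0" for u
      by (rule integral_mult_C0_tendsto[where C = \<sigma>])
        (use Fi Fn AE_norm_DB1_le[OF F \<sigma>] gi gn lim that in auto)
  qed (use FB gi in auto)
  then show ?thesis
    using that[OF r _ lim] gn by (simp add: DB1_def)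
qed

text \<open>The Brezis--Lieb lemma for \<open>L1\<close>.\<close>

lemma L1norm_diff_tendsto:
  fixes F :: "nat \<Rightarrow> real \<Rightarrow> complex"
  assumes F: "\<And>n. integrable lborel (F n)" and g: "integrable lborel g"
    and lim: "AE x in lborel. (\<lambda>n. F n x) \<longlonglongrightarrow> g x" and norms: "(\<lambda>n. L1norm (F n)) \<longlonglongrightarrow> l"
  shows "(\<lambda>n. L1norm (\<lambda>x. F n x - g x)) \<longlonglongrightarrow> l - L1norm g"
proof -
  note [measurable] = borel_measurable_integrable[OF F] borel_measurable_integrable[OF g]
  have eq: "L1norm (F n) - (LINT x|lborel. norm (F n x) - norm (F n x - g x)) = L1norm (\<lambda>x. F n x - g x)" for n
    unfolding L1norm_def using F g by (subst Bochner_Integration.integral_diff) auto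
  \<comment> \<open>The difference of norms is dominated by \<open>norm (g x)\<close>, although the
    \<open>F n\<close> need not have a common integrable majorant.\<close>
  have "(\<lambda>n. LINT x|lborel. norm (F n x) - norm (F n x - g x)) \<longlonglongrightarrow> (LINT x|lborel. norm (g x) - norm (g x - g x))"
  proof (rule integral_dominated_convergence[where w = "\<lambda>x. norm (g x)"])
    show "AE x in lborel. (\<lambda>n. norm (F n x) - norm (F n x - g x)) \<longlonglongrightarrow> norm (g x) - norm (g x - g x)"
      using lim by eventually_elim (intro tendsto_intros)
    show "AE x in lborel. norm (norm (F n x) - norm (F n x - g x)) \<le> norm (g x)" for n
    proof (rule AE_I2)
      fix x
      show "norm (norm (F n x) - norm (F n x - g x)) \<le> norm (g x)"
        using norm_triangle_ineq3[of "F n x" "F n x - g x"] by simp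
    qed
  qed (use g in auto)
  then have "(\<lambda>n. L1norm (F n) - (LINT x|lborel. norm (F n x) - norm (F n x - g x))) \<longlonglongrightarrow> l - L1norm g"
    by (intro tendsto_diff norms) (simp add: L1norm_def)
  then show ?thesis by (simp add: eq)
qed

text \<open>Otherwise some maximizing sequence stays away from \<open>f\<close> along a subsequence,
  and compactness provides an almost everywhere limit \<open>g\<close>. If
  \<open>\<Psi> g = 1\<close>, then \<open>g = f\<close> by exposedness, no norm is lost, and the
  Brezis-Lieb lemma gives norm convergence. Only the value at \<open>g\<close> remains to be found
  in each application.\<close>

lemma strongly_exposedI:
  assumes \<sigma>: "0 < \<sigma>" and f: "f \<in> DB1 \<sigma>" and exp: "exposing \<sigma> f \<Psi>"
    and lim: "\<And>F g. (\<And>n::nat. F n \<in> DB1 \<sigma>) \<Longrightarrow> g \<in> DB1 \<sigma> \<Longrightarrow> (AE x in lborel. (\<lambda>n. F n x) \<longlonglongrightarrow> g x) \<Longrightarrow>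
      (\<lambda>n. \<Psi> (F n)) \<longlonglongrightarrow> 1 \<Longrightarrow> (\<lambda>n. L1norm (F n)) \<longlonglongrightarrow> 1 \<Longrightarrow> \<Psi> g = 1"
  shows "strongly_exposed \<sigma> f"
proof -
  have \<Psi>: "bounded_functional \<sigma> \<Psi>" "\<Psi> f = 1" "fnorm \<sigma> \<Psi> = 1"
    using exp by (auto simp: exposing_def)
  have unique: "AE x in lborel. g x = f x" if "g \<in> DB1 \<sigma>" "Re (\<Psi> g) = 1" for g
    using exp that unfolding exposing_def by (metis less_irrefl)
  have le: "norm (\<Psi> g) \<le> L1norm g" if "g \<in> DB1 \<sigma>" for g
    using norm_functional_le[OF \<Psi>(1,3)] that by (simp add: DB1_def)
  have fB: "f \<in> B1 \<sigma>" and fn: "L1norm f = 1"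
    using f le[OF f] \<Psi>(2) by (auto simp: DB1_def)
  note [measurable] = borel_measurable_integrable[OF B1_integrable[OF fB]]
  have "(\<lambda>n. L1norm (\<lambda>x. F n x - f x)) \<longlonglongrightarrow> 0"
    if F: "\<And>n::nat. F n \<in> DB1 \<sigma>" and F1: "(\<lambda>n. \<Psi> (F n)) \<longlonglongrightarrow> 1" for F
  proof (rule ccontr)
    assume "\<not> (\<lambda>n. L1norm (\<lambda>x. F n x - f x)) \<longlonglongrightarrow> 0"
    then obtain e where e: "e > 0" "\<forall>N. \<exists>n\<ge>N. \<not> norm (L1norm (\<lambda>x. F n x - f x) - 0) < e"
      unfolding LIMSEQ_iff by blast
    have "norm (L1norm (\<lambda>x. F n x - f x) - 0) = L1norm (\<lambda>x. F n x - f x)" for n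
      using L1norm_nonneg by simp
    with e(2) have "infinite {n. e \<le> L1norm (\<lambda>x. F n x - f x)}"
      unfolding infinite_nat_iff_unbounded_le by (simp only: not_less mem_Collect_eq) blast
    from infinite_enumerate[OF this] obtain s :: "nat \<Rightarrow> nat"
      where s: "strict_mono s" "\<forall>n. s n \<in> {n. e \<le> L1norm (\<lambda>x. F n x - f x)}" by blast
    obtain r g where r: "strict_mono r" and g: "g \<in> DB1 \<sigma>" and AE: "AE x in lborel. (\<lambda>n. F (s (r n)) x) \<longlonglongrightarrow> g x"
      using DB1_sequentially_compact[OF \<sigma>, of "\<lambda>n. F (s n)"] F by blast
    define G where "G n = F (s (r n))" for n
    have G: "G n \<in> DB1 \<sigma>" and Gi: "integrable lborel (G n)" for n
      using F[of "s (r n)"] by (auto simp: G_def DB1_def B1_def)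
    note [measurable] = borel_measurable_integrable[OF Gi]
    have gB: "g \<in> B1 \<sigma>" using g by (simp add: DB1_def)
    note [measurable] = borel_measurable_integrable[OF B1_integrable[OF gB]]
    have G1: "(\<lambda>n. \<Psi> (G n)) \<longlonglongrightarrow> 1"
      using LIMSEQ_subseq_LIMSEQ[OF F1 strict_mono_o[OF s(1) r]] by (simp add: G_def o_def)
    \<comment> \<open>The norms are squeezed between \<open>norm (\<Psi> (G n))\<close> and
      1.\<close>
    have norms: "(\<lambda>n. L1norm (G n)) \<longlonglongrightarrow> 1"
    proof (rule tendsto_sandwich)
      show "(\<lambda>n. norm (\<Psi> (G n))) \<longlonglongrightarrow> 1" using tendsto_norm[OF G1] by simp
      show "\<forall>\<^sub>F n in sequentially. norm (\<Psi> (G n)) \<le> L1norm (G n)" using le[OF G] by simp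
      show "\<forall>\<^sub>F n in sequentially. L1norm (G n) \<le> 1" using G by (simp add: DB1_def)
    qed simp
    have AE': "AE x in lborel. (\<lambda>n. G n x) \<longlonglongrightarrow> g x" using AE by (simp add: G_def)
    have "\<Psi> g = 1" by (rule lim[OF G g AE' G1 norms])
    then have gf: "AE x in lborel. g x = f x" using unique[OF g] by simp
    then have "L1norm g = 1" using L1norm_cong_AE[OF gf] fn by simp
    with L1norm_diff_tendsto[OF Gi B1_integrable[OF gB] AE' norms]
    have "(\<lambda>n. L1norm (\<lambda>x. G n x - g x)) \<longlonglongrightarrow> 0" by simp
    moreover have "L1norm (\<lambda>x. G n x - g x) = L1norm (\<lambda>x. G n x - f x)" for n
      by (rule L1norm_cong_AE) (use gf in auto)
    moreover have "e \<le> L1norm (\<lambda>x. G n x - f x)" for n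
      using s(2) by (simp add: G_def)
    ultimately have "e \<le> 0"
      by (intro LIMSEQ_le_const[of "\<lambda>n. L1norm (\<lambda>x. G n x - f x)"]) auto
    then show False using e by simp
  qed
  then show ?thesis
    unfolding strongly_exposed_def using f exp by blast
qed

section \<open>The weak* topology\<close>

lemma topspace_wstar_top: "topspace (wstar_top \<sigma>) = B1 \<sigma>"
proof -
  have "(\<lambda>x. 0) \<in> C0" by (simp add: C0_def)
  then show ?thesis
    unfolding wstar_top_def topology_generated_by_topspace by blast
qed

text \<open>Convergence of all pairings is convergence for the generated topology: each open set
  containing \<open>g\<close> eventually contains the sequence, by induction on how the set is
  generated.\<close>

lemma wstar_continuous_tendsto:
  assumes \<Psi>: "continuous_map (wstar_top \<sigma>) euclidean \<Psi>"
    and F: "\<And>n::nat. F n \<in> B1 \<sigma>" and g: "g \<in> B1 \<sigma>"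
    and lim: "\<And>u. u \<in> C0 \<Longrightarrow> (\<lambda>n. LINT x|lborel. F n x * u x) \<longlonglongrightarrow> (LINT x|lborel. g x * u x)"
  shows "(\<lambda>n. \<Psi> (F n)) \<longlonglongrightarrow> \<Psi> g"
proof (rule topological_tendstoI)
  fix V assume V: "open V" "\<Psi> g \<in> V"
  let ?S = "{{g \<in> B1 \<sigma>. (LINT x|lborel. g x * u x) \<in> U} | u U. u \<in> C0 \<and> open U}"
  have "eventually (\<lambda>n. F n \<in> W) sequentially" if "generate_topology_on ?S W" "g \<in> W" for W
    using that
  proof induction
    case (UN K)
    then obtain k where k: "k \<in> K" "g \<in> k" by auto
    from UN.IH[OF k] show ?case by eventually_elim (use k in auto)
  next
    case (Basis W)
    then obtain u U where W: "W = {g \<in> B1 \<sigma>. (LINT x|lborel. g x * u x) \<in> U}" and u: "u \<in> C0" "open U" by auto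
    have "eventually (\<lambda>n. (LINT x|lborel. F n x * u x) \<in> U) sequentially"
      using topological_tendstoD[OF lim[OF u(1)] u(2)] Basis W by auto
    then show ?case by eventually_elim (use F W in auto)
  qed (auto simp: eventually_conj_iff)
  moreover have "generate_topology_on ?S {x \<in> topspace (wstar_top \<sigma>). \<Psi> x \<in> V}"
    using openin_continuous_map_preimage[OF \<Psi>, of V] V(1)
    by (simp add: wstar_top_def openin_topology_generated_by_iff)
  ultimately have "eventually (\<lambda>n. F n \<in> {x \<in> topspace (wstar_top \<sigma>). \<Psi> x \<in> V}) sequentially"
    using g V(2) topspace_wstar_top by blast
  then show "eventually (\<lambda>n. \<Psi> (F n) \<in> V) sequentially"
    by eventually_elim simp
qed

text \<open>In the unit ball, almost everywhere convergence implies weak* convergence, because the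
  functions share the pointwise bound \<sigma>.\<close>

lemma wstar_exposed_imp_strongly_exposed:
  assumes \<sigma>: "0 < \<sigma>" and "wstar_exposed \<sigma> f"
  shows "strongly_exposed \<sigma> f"
proof -
  obtain \<Psi> where f: "f \<in> DB1 \<sigma>" and exp: "exposing \<sigma> f \<Psi>" and cont: "continuous_map (wstar_top \<sigma>) euclidean \<Psi>"
    using assms by (auto simp: wstar_exposed_def)
  show ?thesis
  proof (rule strongly_exposedI[OF \<sigma> f exp])
    fix F g assume F: "\<And>n::nat. F n \<in> DB1 \<sigma>" and g: "g \<in> DB1 \<sigma>"
      and AE: "AE x in lborel. (\<lambda>n. F n x) \<longlonglongrightarrow> g x" and lim1: "(\<lambda>n. \<Psi> (F n)) \<longlonglongrightarrow> 1"
    have "(\<lambda>n. \<Psi> (F n)) \<longlonglongrightarrow> \<Psi> g"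
    proof (rule wstar_continuous_tendsto[OF cont])
      show "(\<lambda>n. LINT x|lborel. F n x * u x) \<longlonglongrightarrow> (LINT x|lborel. g x * u x)" if "u \<in> C0" for u
        by (rule integral_mult_C0_tendsto[where C = \<sigma>])
          (use F g AE that AE_norm_DB1_le[OF F \<sigma>] in \<open>auto simp: DB1_def B1_def\<close>)
    qed (use F g in \<open>auto simp: DB1_def\<close>)
    then show "\<Psi> g = 1" using LIMSEQ_unique lim1 by blast
  qed
qed

section \<open>Strong exposedness and failure of weak* exposedness\<close>

lemma LINT_translate:
  fixes h :: "real \<Rightarrow> complex"
  shows "(LINT x|lborel. h (x - c)) = (LINT x|lborel. h x)"
  by (subst lborel_integral_real_affine[where c = 1 and t = c]) auto

lemma B1_translate:
  assumes "g \<in> B1 \<sigma>"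
  shows "(\<lambda>x. g (x - c)) \<in> B1 \<sigma>" and "fourier (\<lambda>x. g (x - c)) t = cis (- (t * c)) * fourier g t"
proof -
  have *: "fourier (\<lambda>x. g (x - c)) t = cis (- (t * c)) * fourier g t" for t
  proof -
    have "fourier (\<lambda>x. g (x - c)) t = (LINT x|lborel. (\<lambda>y. cis (- (t * c)) * (g y * cis (- (t * y)))) (x - c))"
      unfolding fourier_def
      by (intro Bochner_Integration.integral_cong) (auto simp: cis_mult mult.left_commute algebra_simps)
    also have "\<dots> = cis (- (t * c)) * fourier g t"
      using LINT_translate[of "\<lambda>y. cis (- (t * c)) * (g y * cis (- (t * y)))" c] by (simp add: fourier_def)
    finally show ?thesis .
  qed
  show "fourier (\<lambda>x. g (x - c)) t = cis (- (t * c)) * fourier g t" by (rule *)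
  have "integrable lborel (\<lambda>x. g (x - c))"
    using lborel_integrable_real_affine[OF B1_integrable[OF assms], of 1 "- c"] by simp
  then show "(\<lambda>x. g (x - c)) \<in> B1 \<sigma>"
    using assms by (auto simp: B1_def *)
qed

text \<open>The shift is moved onto \<open>u\<close>, which tends to 0 at each fixed point. Assuming
  mere measurability of \<open>u\<close> admits the indicator of \<open>{-\<beta>..\<beta>}\<close>
  besides elements of \<open>C0\<close>.\<close>

lemma translates_tendsto_0:
  assumes g: "integrable lborel g" and u: "u \<in> borel_measurable borel" "\<And>x. norm (u x) \<le> U"
    and lim: "((\<lambda>x. u x :: complex) \<longlongrightarrow> 0) at_top"
  shows "(\<lambda>n. LINT x|lborel. g (x - real n) * u x) \<longlonglongrightarrow> 0"
proof -
  note [measurable] = u(1) borel_measurable_integrable[OF g]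
  have "(LINT x|lborel. g (x - real n) * u x) = (LINT x|lborel. g x * u (x + real n))" for n
    using LINT_translate[of "\<lambda>x. g x * u (x + real n)" "real n"] by simp
  moreover have "(\<lambda>n. LINT x|lborel. g x * u (x + real n)) \<longlonglongrightarrow> (LINT x|lborel. g x * 0)"
  proof (rule integral_dominated_convergence[where w = "\<lambda>x. norm (g x) * U"])
    have "filterlim (\<lambda>n. x + real n) at_top sequentially" for x
      by (rule filterlim_tendsto_add_at_top[OF tendsto_const filterlim_real_sequentially])
    then have "(\<lambda>n. u (x + real n)) \<longlonglongrightarrow> 0" for x
      using filterlim_compose[OF lim] by blast
    then show "AE x in lborel. (\<lambda>n. g x * u (x + real n)) \<longlonglongrightarrow> g x * 0"
      by (intro AE_I2 tendsto_intros)
    show "AE x in lborel. norm (g x * u (x + real n)) \<le> norm (g x) * U" for n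
      by (intro AE_I2) (simp only: norm_mult mult_left_mono[OF u(2) norm_ge_zero])
  qed (use g in auto)
  ultimately show ?thesis by simp
qed

context extremal_example
begin

lemma strongly_exposed_f: "strongly_exposed \<sigma> f"
proof (rule strongly_exposedI[OF \<sigma> f_in_DB1 exposing_\<Phi>])
  fix F g assume F: "\<And>n::nat. F n \<in> DB1 \<sigma>" and g: "g \<in> DB1 \<sigma>"
    and AE: "AE x in lborel. (\<lambda>n. F n x) \<longlonglongrightarrow> g x" and \<Phi>1: "(\<lambda>n. \<Phi> (F n)) \<longlonglongrightarrow> 1"
    and norms: "(\<lambda>n. L1norm (F n)) \<longlonglongrightarrow> 1"
  have FB: "F n \<in> B1 \<sigma>" for n using F by (simp add: DB1_def)
  have gB: "g \<in> B1 \<sigma>" and gn: "L1norm g \<le> 1" using g by (auto simp: DB1_def)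
  note Fi = B1_integrable[OF FB] and gi = B1_integrable[OF gB]
  note [measurable] = borel_measurable_integrable[OF Fi] borel_measurable_integrable[OF gi]
  \<comment> \<open>\<open>D n\<close> is the part that escapes to infinity; its norm tends to the
    lost mass \<open>1 - L1norm g\<close>.\<close>
  define D where "D n = (\<lambda>x. 1 * F n x + (-1) * g x)" for n
  have DB: "D n \<in> B1 \<sigma>" for n unfolding D_def by (rule B1_lincomb[OF FB gB])
  have \<Phi>D: "\<Phi> (D n) = \<Phi> (F n) - \<Phi> g" for n
    unfolding D_def bounded_functional_lincomb[OF bounded_functional_\<Phi> FB gB] by simp
  have normD: "(\<lambda>n. L1norm (D n)) \<longlonglongrightarrow> 1 - L1norm g"
    using L1norm_diff_tendsto[OF Fi gi AE norms] by (simp add: D_def)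
  define J where "J n = (LINT x|lborel. indicator {-\<beta>..\<beta>} x *\<^sub>R D n x)" for n
  have "J \<longlonglongrightarrow> (LINT x|(lborel :: real measure). 0)"
    unfolding J_def
  proof (rule integral_dominated_convergence[where w = "\<lambda>x. indicator {-\<beta>..\<beta>} x * (\<sigma> + \<sigma>)"])
    show "AE x in lborel. (\<lambda>n. indicator {-\<beta>..\<beta>} x *\<^sub>R D n x) \<longlonglongrightarrow> 0"
      using AE
    proof eventually_elim
      case (elim x)
      have "(\<lambda>n. indicator {-\<beta>..\<beta>} x *\<^sub>R (1 * F n x + (-1) * g x)) \<longlonglongrightarrow> indicator {-\<beta>..\<beta>} x *\<^sub>R (1 * g x + (-1) * g x)"
        by (intro tendsto_intros elim)
      then show ?case by (simp add: D_def)
    qed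
    show "AE x in lborel. norm (indicator {-\<beta>..\<beta>} x *\<^sub>R D n x) \<le> indicator {-\<beta>..\<beta>} x * (\<sigma> + \<sigma>)" for n
      using AE_norm_DB1_le[OF F[of n] \<sigma>] AE_norm_DB1_le[OF g \<sigma>]
    proof eventually_elim
      case (elim x)
      then have "norm (D n x) \<le> \<sigma> + \<sigma>"
        using norm_triangle_ineq4[of "F n x" "g x"] by (simp add: D_def)
      then show ?case by (simp add: indicator_def)
    qed
    show "(\<lambda>x. indicator {-\<beta>..\<beta>} x *\<^sub>R D n x) \<in> borel_measurable lborel" for n
      unfolding D_def by measurable
  qed (use \<beta>_pos in auto)
  then have J: "J \<longlonglongrightarrow> 0" by simp
  txt \<open>Escaping mass is seen only by the \<open>- 1/3\<close> part of \<open>\<Phi>\<close>.\<close>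
  have "norm (\<Phi> (F n)) \<le> L1norm g + (L1norm (D n) / 3 + 2 * norm (J n))" for n
  proof -
    have "norm (\<Phi> (D n)) \<le> norm (- fourier (D n) 0 / 3) + norm (2 * J n)"
      unfolding \<Phi>_eq[OF DB] J_def[symmetric] by (rule norm_triangle_ineq4)
    also have "\<dots> \<le> L1norm (D n) / 3 + 2 * norm (J n)"
      using fourier_norm_le[of "D n" 0] by (simp add: norm_divide norm_mult)
    finally have "norm (\<Phi> (D n)) \<le> L1norm (D n) / 3 + 2 * norm (J n)" .
    moreover have "norm (\<Phi> (F n)) \<le> norm (\<Phi> g) + norm (\<Phi> (D n))"
      using norm_triangle_ineq[of "\<Phi> g" "\<Phi> (D n)"] by (simp add: \<Phi>D)
    ultimately show ?thesis using norm_\<Phi>_le[OF gi] by linarith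
  qed
  \<comment> \<open>With \<open>m = L1norm g\<close> the limit reads
    \<open>1 \<le> m + (1 - m) / 3\<close>, which together with \<open>m \<le> 1\<close> forces
    \<open>m = 1\<close>.\<close>
  moreover have "(\<lambda>n. L1norm g + (L1norm (D n) / 3 + 2 * norm (J n))) \<longlonglongrightarrow> L1norm g + ((1 - L1norm g) / 3 + 2 * norm (0::complex))"
    by (intro tendsto_intros normD J) auto
  moreover have "(\<lambda>n. norm (\<Phi> (F n))) \<longlonglongrightarrow> norm (1::complex)"
    by (intro tendsto_norm \<Phi>1)
  ultimately have "norm (1::complex) \<le> L1norm g + ((1 - L1norm g) / 3 + 2 * norm (0::complex))"
    by (intro LIMSEQ_le) auto
  then have "1 \<le> L1norm g" by (simp add: field_simps)
  with gn have "L1norm g = 1" by simp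
  with normD have "(\<lambda>n. L1norm (D n)) \<longlonglongrightarrow> 0" by simp
  then have "(\<lambda>n. \<Phi> (D n)) \<longlonglongrightarrow> 0"
    by (rule Lim_null_comparison[rotated]) (use norm_\<Phi>_le[OF B1_integrable[OF DB]] in simp)
  then have "(\<lambda>n. \<Phi> (F n) - \<Phi> (D n)) \<longlonglongrightarrow> 1 - 0"
    by (intro tendsto_diff \<Phi>1)
  then show "\<Phi> g = 1" by (simp add: \<Phi>D LIMSEQ_const_iff)
qed

section \<open>Uniqueness of the norming functional\<close>

lemma AE_f_nonzero: "AE x in lborel. f x \<noteq> 0"
proof -
  \<comment> \<open>The zeros of the numerator, a countable set; the two points where the
    denominator vanishes are excluded separately.\<close>
  let ?Z = "(\<Union>n::int. {(pi / 3 + of_int (2 * n) * pi) / \<sigma>, (- (pi / 3) + of_int (2 * n) * pi) / \<sigma>})"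
  have Z: "x \<in> ?Z" if "2 * cos (\<sigma> * x) - 1 = 0" for x
  proof -
    have "cos (\<sigma> * x) = cos (pi / 3)" using that by (simp add: cos_60)
    then have "cos (complex_of_real (\<sigma> * x)) = cos (complex_of_real (pi / 3))"
      by (simp only: cos_of_real)
    then obtain m where m: "m \<in> \<int>" "complex_of_real (\<sigma> * x) = of_real (pi / 3) + of_real (2 * m * pi) \<or>
        complex_of_real (\<sigma> * x) = - of_real (pi / 3) + of_real (2 * m * pi)"
      unfolding complex_cos_eq by blast
    then obtain n where n: "m = of_int n" by (auto elim: Ints_cases)
    from m(2) have "\<sigma> * x = pi / 3 + 2 * m * pi \<or> \<sigma> * x = - (pi / 3) + 2 * m * pi"
      unfolding of_real_minus[symmetric] of_real_add[symmetric] of_real_eq_iff .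
    then have "x = (pi / 3 + of_int (2 * n) * pi) / \<sigma> \<or> x = (- (pi / 3) + of_int (2 * n) * pi) / \<sigma>"
      using \<sigma> n by (auto simp: field_simps)
    then show ?thesis by blast
  qed
  have "AE x in lborel. x \<notin> ?Z"
    by (intro AE_not_in countable_imp_null_set_lborel countable_UN) auto
  then show ?thesis
    using AE_not_singular[OF \<sigma>]
  proof eventually_elim
    case (elim x)
    have "2 * cos (\<sigma> * x) - 1 \<noteq> 0" using Z elim(1) by blast
    with elim(2) have "\<alpha> * (2 * cos (\<sigma> * x) - 1) / ((3 * \<sigma> * x)\<^sup>2 - pi\<^sup>2) \<noteq> 0"
      using \<alpha> by auto
    then show ?case unfolding example_fn_def of_real_eq_0_iff .
  qed
qed

text \<open>The norm is Gateaux differentiable at \<open>f\<close> because \<open>f\<close> vanishes only on a null set; hence the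
  norming functional of \<open>f\<close> is unique.\<close>

lemma Re_norming_functional_le:
  assumes \<Psi>: "bounded_functional \<sigma> \<Psi>" "fnorm \<sigma> \<Psi> = 1" "\<Psi> f = 1" and g: "g \<in> B1 \<sigma>"
  shows "Re (\<Psi> g) \<le> Re (\<Phi> g)"
proof -
  note gi = B1_integrable[OF g]
  note [measurable] = borel_measurable_integrable[OF gi]
  define \<epsilon> where "\<epsilon> n = inverse (real (Suc n))" for n
  have \<epsilon>: "\<epsilon> n > 0" "\<epsilon> \<longlonglongrightarrow> 0" for n
    unfolding \<epsilon>_def by simp (rule LIMSEQ_inverse_real_of_nat)
  \<comment> \<open>Difference quotients of the norm at \<open>f\<close> in direction
    \<open>g\<close>. Their integrals dominate \<open>Re (\<Psi> g)\<close>, since \<Psi> is linear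
    of norm 1 with \<open>\<Psi> f = 1\<close>.\<close>
  define q where "q n x = (norm (f x + \<epsilon> n *\<^sub>R g x) - norm (f x)) / \<epsilon> n" for n x
  have "Re (\<Psi> g) \<le> (LINT x|lborel. q n x)" for n
  proof -
    let ?h = "\<lambda>x. 1 * f x + of_real (\<epsilon> n) * g x"
    have hB: "?h \<in> B1 \<sigma>" by (rule B1_lincomb[OF f_in_B1 g])
    have "1 + \<epsilon> n * Re (\<Psi> g) = Re (\<Psi> ?h)"
      unfolding bounded_functional_lincomb[OF \<Psi>(1) f_in_B1 g] by (simp add: \<Psi>(3))
    also have "\<dots> \<le> L1norm ?h"
      using complex_Re_le_cmod norm_functional_le[OF \<Psi>(1,2) hB] by (rule order_trans)
    finally have "Re (\<Psi> g) \<le> (L1norm ?h - L1norm f) / \<epsilon> n"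
      using \<epsilon>(1)[of n] norm1 by (simp add: field_simps)
    also have "\<dots> = (LINT x|lborel. q n x)"
    proof -
      have "(LINT x|lborel. norm (?h x) - norm (f x)) = L1norm ?h - L1norm f"
        unfolding L1norm_def
        using B1_integrable[OF hB] integrable_f by (intro Bochner_Integration.integral_diff) auto
      then have "(L1norm ?h - L1norm f) / \<epsilon> n = (LINT x|lborel. (norm (?h x) - norm (f x)) / \<epsilon> n)"
        by simp
      then show ?thesis by (simp add: q_def scaleR_conv_of_real)
    qed
    finally show ?thesis .
  qed
  moreover have "(\<lambda>n. LINT x|lborel. q n x) \<longlonglongrightarrow> (LINT x|lborel. Re (g x * of_real (sgn_f x)))"
  proof (rule integral_dominated_convergence[where w = "\<lambda>x. norm (g x)"])
    show "AE x in lborel. (\<lambda>n. q n x) \<longlonglongrightarrow> Re (g x * of_real (sgn_f x))"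
      using AE_f_nonzero
    proof eventually_elim
      case (elim x)
      \<comment> \<open>The modulus is differentiable at the nonzero value \<open>f x\<close>; the
        chain rule along the line in direction \<open>g x\<close> yields the limit of the
        quotients.\<close>
      have nd: "(norm has_derivative (\<lambda>h. inner h (sgn (f x)))) (at (f x + 0 *\<^sub>R g x))"
        using has_derivative_norm[OF elim] by simp
      have "((\<lambda>t. f x + t *\<^sub>R g x) has_derivative (\<lambda>t. t *\<^sub>R g x)) (at 0)"
        by (auto intro!: derivative_eq_intros)
      from has_derivative_compose[OF this nd]
      have "((\<lambda>t. norm (f x + t *\<^sub>R g x)) has_real_derivative inner (g x) (sgn (f x))) (at 0)"
        by (simp add: has_field_derivative_def mult_commute_abs)
      then have "((\<lambda>t. (norm (f x + t *\<^sub>R g x) - norm (f x)) / t) \<longlongrightarrow> inner (g x) (sgn (f x))) (at 0)"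
        by (simp add: has_field_derivative_iff)
      moreover have "filterlim \<epsilon> (at 0) sequentially"
        using \<epsilon> by (intro filterlim_atI) (auto simp: less_imp_neq[symmetric])
      ultimately have "(\<lambda>n. q n x) \<longlonglongrightarrow> inner (g x) (sgn (f x))"
        unfolding q_def by (rule filterlim_compose)
      moreover have "sgn (f x) = of_real (sgn_f x)"
      proof -
        have "f x = of_real (Re (f x))" by (simp add: example_fn_def)
        then show ?thesis unfolding sgn_f_def by (metis sgn_of_real)
      qed
      ultimately show ?case by (simp add: inner_complex_def)
    qed
    show "AE x in lborel. norm (q n x) \<le> norm (g x)" for n
    proof (rule AE_I2)
      fix x
      have "\<bar>norm (f x + \<epsilon> n *\<^sub>R g x) - norm (f x)\<bar> \<le> \<epsilon> n * norm (g x)"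
        using norm_triangle_ineq3[of "f x + \<epsilon> n *\<^sub>R g x" "f x"] \<epsilon>(1)[of n] by simp
      then show "norm (q n x) \<le> norm (g x)"
        using \<epsilon>(1)[of n] by (simp add: q_def field_simps)
    qed
    show "q n \<in> borel_measurable lborel" for n
      unfolding q_def by measurable
  qed (use gi in auto)
  ultimately have "Re (\<Psi> g) \<le> (LINT x|lborel. Re (g x * of_real (sgn_f x)))"
    by (intro LIMSEQ_le_const) auto
  then show ?thesis
    unfolding \<Phi>_def by (simp only: integral_Re[OF integrable_mult_sgn_f[OF gi]])
qed

text \<open>The reverse inequality is the previous lemma at \<open>- g\<close>.\<close>

lemma Re_norming_functional_eq:
  assumes \<Psi>: "bounded_functional \<sigma> \<Psi>" "fnorm \<sigma> \<Psi> = 1" "\<Psi> f = 1" and g: "g \<in> B1 \<sigma>"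
  shows "Re (\<Psi> g) = Re (\<Phi> g)"
  using Re_norming_functional_le[OF \<Psi> g] Re_norming_functional_le[OF \<Psi> B1_cmult[OF g, of "-1"]]
  unfolding bounded_functional_cmult[OF \<Psi>(1) g] bounded_functional_cmult[OF bounded_functional_\<Phi> g] by simp

lemma not_wstar_exposed_f: "\<not> wstar_exposed \<sigma> f"
proof
  assume "wstar_exposed \<sigma> f"
  then obtain \<Psi> where exp: "exposing \<sigma> f \<Psi>" and cont: "continuous_map (wstar_top \<sigma>) euclidean \<Psi>"
    by (auto simp: wstar_exposed_def)
  have \<Psi>: "bounded_functional \<sigma> \<Psi>" "fnorm \<sigma> \<Psi> = 1" "\<Psi> f = 1"
    using exp by (auto simp: exposing_def)
  define G where "G n = (\<lambda>x. f (x - real n))" for n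
  have GB: "G n \<in> B1 \<sigma>" for n unfolding G_def by (rule B1_translate[OF f_in_B1])
  have "(\<lambda>n. \<Psi> (G n)) \<longlonglongrightarrow> \<Psi> (\<lambda>x. 0)"
  proof (rule wstar_continuous_tendsto[OF cont GB B1_zero])
    fix u assume u: "u \<in> C0"
    obtain U where U: "\<And>x. norm (u x) \<le> U" using C0_bounded[OF u] by blast
    have lim: "(u \<longlongrightarrow> 0) at_top"
      using u by (auto simp: C0_def intro: filterlim_mono[OF _ order_refl at_top_le_at_infinity])
    show "(\<lambda>n. LINT x|lborel. G n x * u x) \<longlonglongrightarrow> (LINT x|lborel. 0 * u x)"
      using translates_tendsto_0[OF integrable_f measurable_C0[OF u] U lim] by (simp add: G_def)
  qed
  moreover have "\<Psi> (\<lambda>x. 0) = 0"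
    using bounded_functional_cmult[OF \<Psi>(1) f_in_B1, of 0] by simp
  ultimately have "(\<lambda>n. Re (\<Psi> (G n))) \<longlonglongrightarrow> 0"
    using tendsto_Re by fastforce
  \<comment> \<open>Any exposing functional has the real part of \<Phi>, so its values on the
    translates can be computed from \<Phi>.\<close>
  then have 1: "(\<lambda>n. Re (\<Phi> (G n))) \<longlonglongrightarrow> 0"
    using Re_norming_functional_eq[OF \<Psi> GB] by simp
  have "(\<lambda>n. LINT x|lborel. f (x - real n) * of_real (indicator {-\<beta>..\<beta>} x)) \<longlonglongrightarrow> 0"
  proof (rule translates_tendsto_0[OF integrable_f, of _ 1])
    have "eventually (\<lambda>x. of_real (indicator {-\<beta>..\<beta>} x) = (0::complex)) at_top"
      using eventually_gt_at_top[of \<beta>] by eventually_elim simp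
    then show "((\<lambda>x. of_real (indicator {-\<beta>..\<beta>} x) :: complex) \<longlongrightarrow> 0) at_top"
      by (rule tendsto_eventually)
  qed (auto simp: indicator_def)
  then have J: "(\<lambda>n. LINT x|lborel. indicator {-\<beta>..\<beta>} x *\<^sub>R G n x) \<longlonglongrightarrow> 0"
    by (simp add: G_def scaleR_conv_of_real mult.commute)
  \<comment> \<open>Translation leaves the transform at 0 unchanged, so only the interval term
    depends on \<open>n\<close>.\<close>
  have "\<Phi> (G n) = - fourier f 0 / 3 - 2 * (LINT x|lborel. indicator {-\<beta>..\<beta>} x *\<^sub>R G n x)" for n
    unfolding \<Phi>_eq[OF GB] using B1_translate(2)[OF f_in_B1, of "real n" 0] by (simp add: G_def)
  moreover have "(\<lambda>n. - fourier f 0 / 3 - 2 * (LINT x|lborel. indicator {-\<beta>..\<beta>} x *\<^sub>R G n x)) \<longlonglongrightarrow> - fourier f 0 / 3 - 2 * 0"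
    by (intro tendsto_intros J)
  ultimately have "(\<lambda>n. Re (\<Phi> (G n))) \<longlonglongrightarrow> Re (- fourier f 0 / 3 - 2 * 0)"
    by (intro tendsto_Re) simp
  with 1 have "Re (- fourier f 0 / 3) = 0"
    using LIMSEQ_unique by fastforce
  moreover have "fourier f 0 = of_real (Re (fourier f 0))"
    by (simp add: fourier_f)
  ultimately show False
    using fourier_f_0 by (metis Re_divide_numeral divide_eq_0_iff neg_equal_0_iff_equal of_real_0 uminus_complex.simps(1) zero_neq_numeral)
qed

end

theorem theorem4p6:
  fixes \<sigma> \<alpha> :: real
  assumes "0 < \<sigma>" and "0 < \<alpha>" and "L1norm (example_fn \<sigma> \<alpha>) = 1"
  shows "strongly_exposed \<sigma> (example_fn \<sigma> \<alpha>) \<and> \<not> wstar_exposed \<sigma> (example_fn \<sigma> \<alpha>) \<and>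
         {f. wstar_exposed \<sigma> f} \<subset> {f. strongly_exposed \<sigma> f}"
proof -
  interpret extremal_example \<sigma> \<alpha>
    using assms by unfold_locales
  \<comment> \<open>\<open>f\<close> itself witnesses that the inclusion is proper.\<close>
  show ?thesis
    using strongly_exposed_f not_wstar_exposed_f wstar_exposed_imp_strongly_exposed[OF \<sigma>] by blast
qed

end
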